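(* Let $\Lambda=t_0\Lambda_0+t_1\Lambda_1$ be a dominant integral weight, and assume the multicharge $\boldsymbol\kappa$ and $\ell \in \mathbb{Z}_{>0}$ are such that $\Lambda = \Lambda(\boldsymbol\kappa, \ell):=\sum_{t=1}^\ell\Lambda_{\kappa_t}$. Then the maps $\mathcal{W}^{\boldsymbol\kappa}, \mathcal{Z}^{\boldsymbol\kappa}$ restrict to mutually inverse crystal isomorphisms $$\mathcal{W}^{(\boldsymbol\kappa, \ell)}: \mathcal{UL}^{\Lambda} \to \mathcal{MP}_{\mathrm{K}}^{(\boldsymbol\kappa, \ell)} \qquad\text{and}\qquad \mathcal{Z}^{(\boldsymbol\kappa, \ell)}: \mathcal{MP}_{\mathrm{K}}^{(\boldsymbol\kappa, \ell)} \to \mathcal{UL}^{\Lambda}.$$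
   Context: Write $\hat i=i+1$ for $i\in\mathbb{Z}_2$; $\alpha_0,\alpha_1$ are the simple roots and $\Lambda_0,\Lambda_1$ the fundamental weights of type ${\tt A}_1^{(1)}$, $\langle\alpha_i,\alpha_i^\vee\rangle=2$, $\langle\alpha_{\hat i},\alpha_i^\vee\rangle=-2$. A crystal isomorphism is a bijection commuting with all operators $e_i,f_i$ and statistics $\mathrm{wt},\varepsilon_i,\varphi_i$, $i\in\mathbb{Z}_2$. Kleshchev multipartitions: a multicharge $\boldsymbol\kappa=(\kappa_1,\kappa_2,\ldots)$ is a sequence in $\mathbb{Z}_2$ containing infinitely many $0$'s and infinitely many $1$'s. A $\boldsymbol\kappa$-multipartition $\boldsymbol\lambda=(\lambda^{(1)},\lambda^{(2)},\ldots)$ is a sequence of partitions, all but finitely many empty; the box in row $r$, column $c$ of $\lambda^{(t)}$ has residue $\kappa_t+c-r\in\mathbb{Z}_2$. $\mathcal{MP}^{\boldsymbol\kappa}$ is the set of these; the content is $\#\{\text{residue-}0\text{ boxes}\}\alpha_0+\#\{\text{residue-}1\text{ boxes}\}\alpha_1$. Young diagrams follow the English convention, and components are arranged vertically with $\lambda^{(1)}$ at the bottom. A box $u\in\boldsymbol\lambda$ of residue $i$ is $i$-removable if $\boldsymbol\lambda\setminus u\in\mathcal{MP}^{\boldsymbol\kappa}$; a box $u\notin\boldsymbol\lambda$ of residue $i$ is $i$-addable if $\boldsymbol\lambda\sqcup u\in\mathcal{MP}^{\boldsymbol\kappa}$. The $i$-arc arrangement $\boldsymbol\lambda[i]$: reading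 top to bottom, whenever an $i$-removable box is followed by an $i$-addable box with no unarced $i$-removable or $i$-addable boxes between them, draw an arc; repeat until impossible. $f_i\boldsymbol\lambda$ adds the bottommost unarced $i$-addable box; $e_i\boldsymbol\lambda$ deletes the topmost unarced $i$-removable box (and is $0$ if none). $\boldsymbol\lambda$ is Kleshchev if $\boldsymbol\lambda=f_{i_m}\cdots f_{i_1}\varnothing$ for some $(i_1,\ldots,i_m)\in\mathbb{Z}_2^m$; $\mathcal{MP}_{\mathrm{K}}^{\boldsymbol\kappa}$ is the set of these, with $\mathrm{wt}=-\mathrm{cont}$ and $\varepsilon_i(\boldsymbol\lambda)$ the number of unarced $i$-removable boxes in $\boldsymbol\lambda[i]$. $\mathcal{MP}_{\mathrm{K}}^{(\boldsymbol\kappa,\ell)}$ is the set of $\boldsymbol\lambda\in\mathcal{MP}_{\mathrm{K}}^{\boldsymbol\kappa}$ with $\lambda^{(m)}=\varnothing$ for $m>\ell$, with crystal operators inherited from $e_i,f_i$ by setting all $\boldsymbol\lambda\notin\mathcal{MP}_{\mathrm{K}}^{(\boldsymbol\kappa,\ell)}$ equal to $0$, weight $\Lambda(\boldsymbol\kappa,\ell)+\mathrm{wt}$, the same $\varepsilon_i$, and $\varphi_i^{(\boldsymbol\kappa,\ell)}(\boldsymbol\lambda)$ the number of unarced $i$-addable boxes in components $1$ through $\ell$ of $\boldsymbol\lambda[i]$. Upper ledge diagrams: a ledge diagram is a left-aligned arrangement of boxes with row lengths $(d_1,\ldots,d_m)\in\mathbb{Z}_{>0}^m$ from top to bottom ($m=0$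 allowed), boxes colored by $\mathbb{Z}_2$, such that for some $t$, $(d_1,\ldots,d_t)$ is weakly increasing and $(d_t,\ldots,d_m)$ weakly decreasing, each row has a single color, and colors alternate down columns. It is upper (resp. lower) ledge if $(d_1,\ldots,d_t)$ is strictly increasing (resp. $(d_t,\ldots,d_m)$ is strictly decreasing). $\mathcal{UL}$ (resp. $\mathcal{LL}$) is the set of upper (resp. lower) ledge diagrams. A peak row is a row of maximal length; an $i$-peak row is a longest $i$-colored row; an $i$-colored box is $i$-bottom (resp. $i$-top) if there is no box directly below (resp. above) it. $\mathrm{cont}(\mathsf{D})=\#\{0\text{-boxes}\}\alpha_0+\#\{1\text{-boxes}\}\alpha_1$. The arrangement $\mathsf{D}[i]$: reading right to left, whenever an $i$-top (resp. $i$-bottom) box is followed by an $\hat i$-top (resp. $\hat i$-bottom) box with no unarced top (resp. bottom) boxes between them, draw an arc; repeat until impossible. $\mathrm{wt}=-\mathrm{cont}$; $\varepsilon_i$ (resp. $\varepsilon_i^*$) = number of unarced $i$-bottom (resp. $i$-top) boxes in $\mathsf{D}[i]$; $\varphi_i=\varepsilon_i+\langle\mathrm{wt},\alpha_i^\vee\rangle$; $e_i$ deletes the rightmost unarced $i$-bottom box ($0$ if none); $f_i$ adds an $i$-colored box directly below the leftmost unarced $\hat i$-bottom box, or if none exists appends an $i$-colored box to the uppermost $i$-peak row (for $\varnothing$: gives the one-box diagram of color $i$). $\mathcal{UL}^\Lambda=\{\mathsf{D}\in\mathcal{UL}\mid\varepsilon_i^*(\mathsf{D})\le t_i,\ i\in\mathbb{Z}_2\}$,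 with operators inherited by setting all $\mathsf{D}\notin\mathcal{UL}^\Lambda$ equal to $0$, $\mathrm{wt}^\Lambda=\Lambda+\mathrm{wt}$, $\varepsilon_i^\Lambda=\varepsilon_i$, $\varphi_i^\Lambda=\varphi_i+t_i$. Given a lower ledge diagram there is a unique way to rearrange it into an upper ledge diagram by shifting its columns vertically in increments of two (so box colors are preserved); this bijection is $\mathrm{float}:\mathcal{LL}\to\mathcal{UL}$. The map $\mathrm{split}^i:\mathcal{UL}\to\mathcal{UL}\times\mathcal{UL}$, $\mathsf{D}\mapsto(\mathrm{split}^i(\mathsf{D})_\downarrow,\mathrm{split}^i(\mathsf{D})_\uparrow)$: let $u$ be the uppermost box of color $i$ in the first column of $\mathsf{D}$; if none, $\mathrm{split}^i(\mathsf{D})=(\varnothing,\mathsf{D})$. Otherwise, extend a ray southeast at $-45^\circ$ from the centroid of $u$; let $\mathsf{L}$ be the boxes whose centroid lies weakly below the ray and $\mathsf{U}$ those strictly above (if $u$ is in row $a$, the box in row $r$, column $c$ is in $\mathsf{L}$ iff $r-c\ge a-1$). Then $\mathsf{L}$ is upper ledge, and left-justifying the rows of $\mathsf{U}$ gives a lower ledge diagram $\mathsf{U}'$; $\mathrm{split}^i(\mathsf{D})_\downarrow=\mathsf{L}$ and $\mathrm{split}^i(\mathsf{D})_\uparrow=\mathrm{float}(\mathsf{U}')$. Put $\mathrm{split}^{\boldsymbol\kappa}(\mathsf{D})=(\mathsf{D}_1,\mathsf{D}_2,\ldots)$ with $\mathsf{D}_1=\mathrm{split}^{\kappa_1}(\mathsf{D})_\downarrow$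 and $(\mathsf{D}_2,\mathsf{D}_3,\ldots)=\mathrm{split}^{(\kappa_2,\kappa_3,\ldots)}(\mathrm{split}^{\kappa_1}(\mathsf{D})_\uparrow)$. Define $\mathcal{W}^{\boldsymbol\kappa}(\mathsf{D})=(\lambda^{(1)},\lambda^{(2)},\ldots)$, where $\lambda^{(t)}$ is the partition constructed by top-aligning every column of $\mathsf{D}_t$. Gluing: for $\mathsf{D}_1,\mathsf{D}_2\in\mathcal{UL}$, $\mathrm{glue}(\mathsf{D}_1,\mathsf{D}_2)\in\mathcal{UL}$ is defined thus (with $\mathrm{glue}(\mathsf{D},\varnothing)=\mathrm{glue}(\varnothing,\mathsf{D})=\mathsf{D}$): set $\mathsf{D}_2$ to the right of $\mathsf{D}_1$ with top rows aligned if they have matching color, or with the top row of $\mathsf{D}_2$ one notch higher otherwise. Starting from the leftmost column of $\mathsf{D}_2$ whose bottom box is above the uppermost peak row of $\mathsf{D}_1$ (if such exists), work to the right, shifting columns down as far as possible in steps of two so that the bottom box is still (a) not below the uppermost peak row of $\mathsf{D}_1$ and (b) not below the bottom box in the column directly to its left. Then combine the diagrams, left-justifying all rows. For $\underline{\mathsf{D}}=(\mathsf{D}_1,\mathsf{D}_2,\ldots)$ with $\mathsf{D}_k=\varnothing$ for $k\gg0$, let $M$ be maximal with $\mathsf{D}_M\neq\varnothing$ (if all are empty, $\mathrm{glue}(\underline{\mathsf{D}})=\varnothing$), put $\mathsf{D}'_{M+1}=\varnothing$, $\mathsf{D}'_t=\mathrm{glue}(\mathsf{D}_t,\mathsf{D}'_{t+1})$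 for $t=M,\ldots,1$, and $\mathrm{glue}(\underline{\mathsf{D}})=\mathsf{D}'_1$. For $\boldsymbol\lambda\in\mathcal{MP}^{\boldsymbol\kappa}$, let $\mathsf{D}_t$ be obtained from $\lambda^{(t)}$ by shifting, for all $k$, the $k$th column down by $k-1$ notches and then left-aligning all rows, the color of each box being its pre-shift residue; set $\mathcal{Z}^{\boldsymbol\kappa}(\boldsymbol\lambda)=\mathrm{glue}(\mathsf{D}_1,\mathsf{D}_2,\ldots)$. *)

theory Defs
  imports "HOL-Library.Z2" "HOL-Library.Product_Plus"
begin

text \<open>
  The colour set Z/2Z is the type \<^typ>\<open>bit\<close>, so the colour other than \<open>i\<close> is \<open>i + 1\<close>.
  Rows, columns and components are numbered from 0 throughout; in particular
  \<open>\<kappa> 0, \<kappa> 1, \<dots>\<close> is the multicharge and \<open>\<mu> 0, \<mu> 1, \<dots>\<close> are the components of a multipartition.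
  Row numbers increase downwards.
\<close>

section \<open>Weights and crystals\<close>

text \<open>
  \<open>(a, b, d)\<close> stands for \<open>a \<Lambda>\<^sub>0 + b \<Lambda>\<^sub>1 + d \<delta>\<close>, where \<open>\<delta> = \<alpha>\<^sub>0 + \<alpha>\<^sub>1\<close> pairs to zero with both
  simple coroots; with the \<open>\<delta>\<close>-coordinate the two simple roots are linearly independent.
\<close>

type_synonym weight = "int \<times> int \<times> int"

definition fund :: "bit \<Rightarrow> weight" where
  "fund i = (if i = 0 then (1, 0, 0) else (0, 1, 0))"

definition simple_root :: "bit \<Rightarrow> weight" where
  "simple_root i = (if i = 0 then (2, -2, 1) else (-2, 2, 0))"

definition pairing :: "weight \<Rightarrow> bit \<Rightarrow> int" where
  "pairing w i = (case w of (a, b, d) \<Rightarrow> if i = 0 then a else b)"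

definition wscale :: "nat \<Rightarrow> weight \<Rightarrow> weight" where
  "wscale n w = (case w of (a, b, d) \<Rightarrow> (int n * a, int n * b, int n * d))"

lemma pairing_simple_root:
  "pairing (simple_root i) i = 2" "pairing (simple_root (i + 1)) i = -2"
  by (cases i; simp add: pairing_def simple_root_def)+

lemma pairing_fund: "pairing (fund j) i = (if i = j then 1 else 0)"
  by (cases i; cases j; simp add: pairing_def fund_def)

text \<open>In the codomain of the crystal operators, \<^const>\<open>None\<close> is the formal zero.\<close>

record 'a crystal =
  cr_set :: "'a set"
  cr_wt :: "'a \<Rightarrow> weight"
  cr_eps :: "bit \<Rightarrow> 'a \<Rightarrow> int"
  cr_phi :: "bit \<Rightarrow> 'a \<Rightarrow> int"
  cr_e :: "bit \<Rightarrow> 'a \<Rightarrow> 'a option"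
  cr_f :: "bit \<Rightarrow> 'a \<Rightarrow> 'a option"

definition crystal_iso :: "('a \<Rightarrow> 'b) \<Rightarrow> 'a crystal \<Rightarrow> 'b crystal \<Rightarrow> bool" where
  "crystal_iso h X Y \<longleftrightarrow>
     bij_betw h (cr_set X) (cr_set Y) \<and>
     (\<forall>x \<in> cr_set X.
        cr_wt Y (h x) = cr_wt X x \<and>
        (\<forall>i. cr_eps Y i (h x) = cr_eps X i x \<and>
             cr_phi Y i (h x) = cr_phi X i x \<and>
             cr_e Y i (h x) = map_option h (cr_e X i x) \<and>
             cr_f Y i (h x) = map_option h (cr_f X i x)))"

definition zero_outside :: "'a set \<Rightarrow> 'a option \<Rightarrow> 'a option" where
  "zero_outside S x = Option.bind x (\<lambda>y. if y \<in> S then Some y else None)"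

section \<open>Arc arrangements\<close>

text \<open>
  \<open>bef\<close> is the reading order, \<open>opn\<close> and \<open>cls\<close> are the sets of symbols at which an arc may start and
  end.  A set of arcs is a set of pairs, so the symbols already arced are the members of its
  \<^const>\<open>Field\<close>.  When \<open>opn\<close> and \<open>cls\<close> are disjoint, \<open>bef\<close> is a strict linear order on their
  union and one of them is finite, the order in which the arcs are drawn is irrelevant, and
  the process stops.  (The set of addable boxes of a multipartition is infinite.)
\<close>

definition arc_step ::
  "'a set \<Rightarrow> 'a set \<Rightarrow> ('a \<Rightarrow> 'a \<Rightarrow> bool) \<Rightarrow> ('a \<times> 'a) set \<Rightarrow> ('a \<times> 'a) set \<Rightarrow> bool" where
  "arc_step opn cls bef A B \<longleftrightarrow>
     (\<exists>u \<in> opn. \<exists>v \<in> cls. bef u v \<and> u \<notin> Field A \<and> v \<notin> Field A \<and>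
        (\<forall>w \<in> opn \<union> cls. bef u w \<and> bef w v \<longrightarrow> w \<in> Field A) \<and>
        B = insert (u, v) A)"

definition arcs ::
  "'a set \<Rightarrow> 'a set \<Rightarrow> ('a \<Rightarrow> 'a \<Rightarrow> bool) \<Rightarrow> ('a \<times> 'a) set" where
  "arcs opn cls bef =
     (THE A. (arc_step opn cls bef)\<^sup>*\<^sup>* {} A \<and> (\<nexists>B. arc_step opn cls bef A B))"

definition first_in :: "('a \<Rightarrow> 'a \<Rightarrow> bool) \<Rightarrow> 'a set \<Rightarrow> 'a" where
  "first_in bef S = (THE x. x \<in> S \<and> (\<forall>y \<in> S. y = x \<or> bef x y))"

definition last_in :: "('a \<Rightarrow> 'a \<Rightarrow> bool) \<Rightarrow> 'a set \<Rightarrow> 'a" where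
  "last_in bef S = (THE x. x \<in> S \<and> (\<forall>y \<in> S. y = x \<or> bef y x))"

section \<open>Kleshchev multipartitions\<close>

text \<open>A partition is given by its Young diagram, a set of boxes (row, column).\<close>

type_synonym multipartition = "nat \<Rightarrow> (nat \<times> nat) set"

type_synonym node = "nat \<times> nat \<times> nat"  \<comment> \<open>(component, row, column)\<close>

definition multicharge :: "(nat \<Rightarrow> bit) \<Rightarrow> bool" where
  "multicharge \<kappa> \<longleftrightarrow> infinite {t. \<kappa> t = 0} \<and> infinite {t. \<kappa> t = 1}"

definition young :: "(nat \<times> nat) set \<Rightarrow> bool" where
  "young Y \<longleftrightarrow> finite Y \<and> (\<forall>(r, c) \<in> Y. \<forall>r' \<le> r. \<forall>c' \<le> c. (r', c') \<in> Y)"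

definition MP :: "multipartition set" where
  "MP = {\<mu>. (\<forall>t. young (\<mu> t)) \<and> finite {t. \<mu> t \<noteq> {}}}"

definition empty_mp :: multipartition where
  "empty_mp = (\<lambda>_. {})"

definition nodes :: "multipartition \<Rightarrow> node set" where
  "nodes \<mu> = {(t, r, c). (r, c) \<in> \<mu> t}"

definition residue :: "(nat \<Rightarrow> bit) \<Rightarrow> node \<Rightarrow> bit" where
  "residue \<kappa> u = (case u of (t, r, c) \<Rightarrow> \<kappa> t + of_nat c - of_nat r)"

definition add_node :: "node \<Rightarrow> multipartition \<Rightarrow> multipartition" where
  "add_node u \<mu> = (case u of (t, r, c) \<Rightarrow> \<mu>(t := insert (r, c) (\<mu> t)))"

definition del_node :: "node \<Rightarrow> multipartition \<Rightarrow> multipartition" where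
  "del_node u \<mu> = (case u of (t, r, c) \<Rightarrow> \<mu>(t := \<mu> t - {(r, c)}))"

definition removables :: "(nat \<Rightarrow> bit) \<Rightarrow> bit \<Rightarrow> multipartition \<Rightarrow> node set" where
  "removables \<kappa> i \<mu> = {u \<in> nodes \<mu>. residue \<kappa> u = i \<and> del_node u \<mu> \<in> MP}"

definition addables :: "(nat \<Rightarrow> bit) \<Rightarrow> bit \<Rightarrow> multipartition \<Rightarrow> node set" where
  "addables \<kappa> i \<mu> = {u. u \<notin> nodes \<mu> \<and> residue \<kappa> u = i \<and> add_node u \<mu> \<in> MP}"

text \<open>
  Component 0 is at the bottom, so larger component numbers are read first.  A row contains
  at most one box that is removable or addable of a given residue.
\<close>

definition above :: "node \<Rightarrow> node \<Rightarrow> bool" where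
  "above u v = (case (u, v) of ((t, r, c), (t', r', c')) \<Rightarrow> t' < t \<or> t = t' \<and> r < r')"

definition mp_arcs :: "(nat \<Rightarrow> bit) \<Rightarrow> bit \<Rightarrow> multipartition \<Rightarrow> (node \<times> node) set" where
  "mp_arcs \<kappa> i \<mu> = arcs (removables \<kappa> i \<mu>) (addables \<kappa> i \<mu>) above"

definition free_removables :: "(nat \<Rightarrow> bit) \<Rightarrow> bit \<Rightarrow> multipartition \<Rightarrow> node set" where
  "free_removables \<kappa> i \<mu> = removables \<kappa> i \<mu> - Field (mp_arcs \<kappa> i \<mu>)"

definition free_addables :: "(nat \<Rightarrow> bit) \<Rightarrow> bit \<Rightarrow> multipartition \<Rightarrow> node set" where
  "free_addables \<kappa> i \<mu> = addables \<kappa> i \<mu> - Field (mp_arcs \<kappa> i \<mu>)"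

text \<open>
  For a multicharge, every multipartition has infinitely many unarced \<open>i\<close>-addable boxes,
  so \<open>mp_f\<close> is never zero.
\<close>

definition mp_f :: "(nat \<Rightarrow> bit) \<Rightarrow> bit \<Rightarrow> multipartition \<Rightarrow> multipartition" where
  "mp_f \<kappa> i \<mu> = add_node (last_in above (free_addables \<kappa> i \<mu>)) \<mu>"

definition mp_e :: "(nat \<Rightarrow> bit) \<Rightarrow> bit \<Rightarrow> multipartition \<Rightarrow> multipartition option" where
  "mp_e \<kappa> i \<mu> =
     (if free_removables \<kappa> i \<mu> = {} then None
      else Some (del_node (first_in above (free_removables \<kappa> i \<mu>)) \<mu>))"

definition mp_cont :: "(nat \<Rightarrow> bit) \<Rightarrow> multipartition \<Rightarrow> weight" where
  "mp_cont \<kappa> \<mu> = (\<Sum>u \<in> nodes \<mu>. simple_root (residue \<kappa> u))"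

definition MPK :: "(nat \<Rightarrow> bit) \<Rightarrow> multipartition set" where
  "MPK \<kappa> = {fold (mp_f \<kappa>) is empty_mp | is. True}"

definition MPK_level :: "(nat \<Rightarrow> bit) \<Rightarrow> nat \<Rightarrow> multipartition set" where
  "MPK_level \<kappa> l = {\<mu> \<in> MPK \<kappa>. \<forall>t \<ge> l. \<mu> t = {}}"

definition level_weight :: "(nat \<Rightarrow> bit) \<Rightarrow> nat \<Rightarrow> weight" where
  "level_weight \<kappa> l = (\<Sum>t<l. fund (\<kappa> t))"

definition MPK_crystal :: "(nat \<Rightarrow> bit) \<Rightarrow> nat \<Rightarrow> multipartition crystal" where
  "MPK_crystal \<kappa> l =
     \<lparr> cr_set = MPK_level \<kappa> l,
       cr_wt = (\<lambda>\<mu>. level_weight \<kappa> l - mp_cont \<kappa> \<mu>),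
       cr_eps = (\<lambda>i \<mu>. int (card (free_removables \<kappa> i \<mu>))),
       cr_phi = (\<lambda>i \<mu>. int (card {u \<in> free_addables \<kappa> i \<mu>. fst u < l})),
       cr_e = (\<lambda>i \<mu>. zero_outside (MPK_level \<kappa> l) (mp_e \<kappa> i \<mu>)),
       cr_f = (\<lambda>i \<mu>. zero_outside (MPK_level \<kappa> l) (Some (mp_f \<kappa> i \<mu>))) \<rparr>"

section \<open>Ledge diagrams\<close>

text \<open>
  The rows of a diagram from top to bottom, each with its length and colour.
  The first column meets every row, so colours alternate down columns iff consecutive rows
  have different colours.  The empty list, the diagram without rows, belongs to \<open>UL\<close>.
\<close>

type_synonym diagram = "(nat \<times> bit) list"

definition alternating :: "diagram \<Rightarrow> bool" where
  "alternating D \<longleftrightarrow> (\<forall>r. Suc r < length D \<longrightarrow> snd (D ! r) \<noteq> snd (D ! Suc r))"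

definition UL :: "diagram set" where
  "UL = {D. (\<forall>x \<in> set D. 0 < fst x) \<and> alternating D \<and>
     (\<exists>t. sorted_wrt (<) (take (Suc t) (map fst D)) \<and> sorted_wrt (\<ge>) (drop t (map fst D)))}"

text \<open>Boxes as triples (row, column, colour); rows are integers so that boxes can be shifted.\<close>

type_synonym cell = "int \<times> nat \<times> bit"

definition cells :: "diagram \<Rightarrow> cell set" where
  "cells D = {(int r, c, snd (D ! r)) | r c. r < length D \<and> c < fst (D ! r)}"

text \<open>Push the boxes in every row of an arrangement to the left; row colours must be constant.\<close>

definition left_justify :: "cell set \<Rightarrow> diagram" where
  "left_justify S =
     map (\<lambda>r. (card {c. \<exists>k. (r, c, k) \<in> S}, THE k. \<exists>c. (r, c, k) \<in> S))
       (sorted_list_of_set (fst ` S))"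

definition bottoms :: "bit \<Rightarrow> diagram \<Rightarrow> cell set" where
  "bottoms i D = {(r, c, k) \<in> cells D. k = i \<and> (\<forall>k'. (r + 1, c, k') \<notin> cells D)}"

definition tops :: "bit \<Rightarrow> diagram \<Rightarrow> cell set" where
  "tops i D = {(r, c, k) \<in> cells D. k = i \<and> (\<forall>k'. (r - 1, c, k') \<notin> cells D)}"

text \<open>Every column has exactly one top and one bottom box.\<close>

definition right_of :: "cell \<Rightarrow> cell \<Rightarrow> bool" where
  "right_of u v = (case (u, v) of ((r, c, k), (r', c', k')) \<Rightarrow> c' < c)"

definition bottom_arcs :: "bit \<Rightarrow> diagram \<Rightarrow> (cell \<times> cell) set" where
  "bottom_arcs i D = arcs (bottoms i D) (bottoms (i + 1) D) right_of"

definition top_arcs :: "bit \<Rightarrow> diagram \<Rightarrow> (cell \<times> cell) set" where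
  "top_arcs i D = arcs (tops i D) (tops (i + 1) D) right_of"

definition ul_eps :: "bit \<Rightarrow> diagram \<Rightarrow> nat" where
  "ul_eps i D = card (bottoms i D - Field (bottom_arcs i D))"

definition ul_eps_star :: "bit \<Rightarrow> diagram \<Rightarrow> nat" where
  "ul_eps_star i D = card (tops i D - Field (top_arcs i D))"

definition ul_cont :: "diagram \<Rightarrow> weight" where
  "ul_cont D = (\<Sum>(r, c, k) \<in> cells D. simple_root k)"

definition ul_phi :: "bit \<Rightarrow> diagram \<Rightarrow> int" where
  "ul_phi i D = int (ul_eps i D) + pairing (- ul_cont D) i"

definition ul_e :: "bit \<Rightarrow> diagram \<Rightarrow> diagram option" where
  "ul_e i D =
     (let B = bottoms i D - Field (bottom_arcs i D)
      in if B = {} then None else Some (left_justify (cells D - {first_in right_of B})))"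

text \<open>The uppermost among the longest rows of colour \<open>i\<close>.\<close>

definition peak_row_of :: "bit \<Rightarrow> diagram \<Rightarrow> nat" where
  "peak_row_of i D =
     (LEAST r. r < length D \<and> snd (D ! r) = i \<and>
        (\<forall>r' < length D. snd (D ! r') = i \<longrightarrow> fst (D ! r') \<le> fst (D ! r)))"

definition ul_f :: "bit \<Rightarrow> diagram \<Rightarrow> diagram" where
  "ul_f i D =
     (let B = bottoms (i + 1) D - Field (bottom_arcs i D)
      in if D = [] then [(1, i)]
         else if B \<noteq> {} then
           (case last_in right_of B of (r, c, k) \<Rightarrow> left_justify (insert (r + 1, c, i) (cells D)))
         else
           (let p = peak_row_of i D
            in left_justify (insert (int p, fst (D ! p), i) (cells D))))"

definition UL_level :: "(bit \<Rightarrow> nat) \<Rightarrow> diagram set" where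
  "UL_level t = {D \<in> UL. \<forall>i. ul_eps_star i D \<le> t i}"

definition dom_weight :: "(bit \<Rightarrow> nat) \<Rightarrow> weight" where
  "dom_weight t = wscale (t 0) (fund 0) + wscale (t 1) (fund 1)"

definition UL_crystal :: "(bit \<Rightarrow> nat) \<Rightarrow> diagram crystal" where
  "UL_crystal t =
     \<lparr> cr_set = UL_level t,
       cr_wt = (\<lambda>D. dom_weight t - ul_cont D),
       cr_eps = (\<lambda>i D. int (ul_eps i D)),
       cr_phi = (\<lambda>i D. ul_phi i D + int (t i)),
       cr_e = (\<lambda>i D. zero_outside (UL_level t) (ul_e i D)),
       cr_f = (\<lambda>i D. zero_outside (UL_level t) (Some (ul_f i D))) \<rparr>"

section \<open>Splitting\<close>

text \<open>
  \<open>s c\<close> counts the steps of two by which column \<open>c\<close> is moved down; \<open>m\<close> only accounts for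
  the fact that the rows of a \<^typ>\<open>diagram\<close> are numbered from 0.  The argument of \<open>float\<close>
  is meant to be a lower ledge diagram.
\<close>

definition float :: "diagram \<Rightarrow> diagram" where
  "float D =
     (THE D'. D' \<in> UL \<and>
        (\<exists>(s :: nat \<Rightarrow> int) m. (\<lambda>(r, c, k). (r + m, c, k)) ` cells D' =
                               (\<lambda>(r, c, k). (r + 2 * s c, c, k)) ` cells D))"

text \<open>
  The components are the lower and the upper part.  Unlike the usual formula with columns numbered
  from 1, the condition for lying weakly below the ray has no summand \<open>-1\<close>.
\<close>

definition split :: "bit \<Rightarrow> diagram \<Rightarrow> diagram \<times> diagram" where
  "split i D =
     (let R = {r. (r, 0, i) \<in> cells D}
      in if R = {} then ([], D)
         else
           (let L = {(r, c, k) \<in> cells D. r - int c \<ge> Min R}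
            in (left_justify L, float (left_justify (cells D - L)))))"

primrec split_seq :: "(nat \<Rightarrow> bit) \<Rightarrow> diagram \<Rightarrow> nat \<Rightarrow> diagram" where
  "split_seq \<kappa> D 0 = fst (split (\<kappa> 0) D)"
| "split_seq \<kappa> D (Suc t) = split_seq (\<lambda>s. \<kappa> (Suc s)) (snd (split (\<kappa> 0) D)) t"

definition W_map :: "(nat \<Rightarrow> bit) \<Rightarrow> diagram \<Rightarrow> multipartition" where
  "W_map \<kappa> D = (\<lambda>t. {(r, c). r < card {r'. \<exists>k. (r', c, k) \<in> cells (split_seq \<kappa> D t)}})"

section \<open>Gluing\<close>

definition width :: "diagram \<Rightarrow> nat" where
  "width D = Max (fst ` set D)"

definition peak_row :: "diagram \<Rightarrow> nat" where
  "peak_row D = (LEAST r. r < length D \<and> fst (D ! r) = width D)"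

definition col_bottom :: "diagram \<Rightarrow> nat \<Rightarrow> int" where
  "col_bottom D c = Max {r. \<exists>k. (r, c, k) \<in> cells D}"

text \<open>
  The number of steps of two by which column \<open>c\<close> of the right-hand diagram is moved down: \<open>p\<close>
  is the uppermost peak row of the left-hand diagram, \<open>q\<close> the bottom row of its last column, and
  \<open>b c\<close> the bottom row of column \<open>c\<close> of the right-hand diagram before shifting.
\<close>

primrec col_drop :: "int \<Rightarrow> int \<Rightarrow> (nat \<Rightarrow> int) \<Rightarrow> nat \<Rightarrow> nat" where
  "col_drop p q b 0 =
     (if b 0 < p then GREATEST k. b 0 + 2 * int k \<le> p \<and> b 0 + 2 * int k \<le> q else 0)"
| "col_drop p q b (Suc c) =
     (if \<exists>c' \<le> Suc c. b c' < p
      then GREATEST k. b (Suc c) + 2 * int k \<le> p \<and>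
             b (Suc c) + 2 * int k \<le> b c + 2 * int (col_drop p q b c)
      else 0)"

definition glue :: "diagram \<Rightarrow> diagram \<Rightarrow> diagram" where
  "glue D1 D2 =
     (if D1 = [] then D2 else if D2 = [] then D1
      else
        (let off = (if snd (hd D1) = snd (hd D2) then 0 else - 1);
             w = width D1;
             drp = col_drop (int (peak_row D1)) (col_bottom D1 (w - 1))
                     (\<lambda>c. col_bottom D2 c + off)
         in left_justify
              (cells D1 \<union> (\<lambda>(r, c, k). (r + off + 2 * int (drp c), w + c, k)) ` cells D2)))"

definition glue_seq :: "(nat \<Rightarrow> diagram) \<Rightarrow> diagram" where
  "glue_seq Ds =
     (if \<forall>t. Ds t = [] then []
      else foldr glue (map Ds [0..<Suc (GREATEST t. Ds t \<noteq> [])]) [])"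

definition ledge_of :: "(nat \<Rightarrow> bit) \<Rightarrow> multipartition \<Rightarrow> nat \<Rightarrow> diagram" where
  "ledge_of \<kappa> \<mu> t =
     left_justify ((\<lambda>(r, c). (int r + int c, c, residue \<kappa> (t, r, c))) ` \<mu> t)"

definition Z_map :: "(nat \<Rightarrow> bit) \<Rightarrow> multipartition \<Rightarrow> diagram" where
  "Z_map \<kappa> \<mu> = glue_seq (ledge_of \<kappa> \<mu>)"

end

(*
  Left-justifying both parts of a split diagram shows that the lower part is a partition with
  strictly decreasing columns, read along its diagonals, while floating does not change the
  lengths and colours of the columns of the upper part.  Read from right to left, the bottom
  boxes of a diagram and the addable and removable boxes of the corresponding multipartition are
  words of opening and closing brackets, and e and f act where the walk of partial sums of such a
  word attains its maximum for the first and the last time.  Passing from a diagram to its two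
  parts inserts cancelling pairs of brackets between consecutive rows, so splitting obeys the
  tensor product rule, exactly as the removal of the first component of a multipartition does.
  Hence W intertwines the operators, and as every upper ledge diagram is generated from the empty
  one, its image is the set of Kleshchev multipartitions.  Gluing undoes one splitting, so Z is
  left inverse to W.  The same cancellation for top boxes shows that splitting off charge i lowers
  epsilon*_i by one, if it is positive, and keeps the other one; this matches the level
  restrictions.
*)
theory Submission
  imports Defs
begin

locale bracketing =
  fixes opn cls :: "'a set" and bef :: "'a \<Rightarrow> 'a \<Rightarrow> bool" and rk :: "'a \<Rightarrow> nat"
  assumes fin: "finite opn" and disj: "opn \<inter> cls = {}" and inj: "inj_on rk (opn \<union> cls)"
    and bef: "\<And>x y. x \<in> opn \<union> cls \<Longrightarrow> y \<in> opn \<union> cls \<Longrightarrow> bef x y \<longleftrightarrow> rk y < rk x"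
begin

definition stp :: "nat \<Rightarrow> int" where
  "stp m = (if m \<in> rk ` opn then 1 else if m \<in> rk ` cls then - 1 else 0)"

definition lv :: "nat \<Rightarrow> int" where
  "lv m = (\<Sum>j<m. stp j)"

lemma lv_0 [simp]: "lv 0 = 0" and lv_Suc: "lv (Suc m) = lv m + stp m"
  by (simp_all add: lv_def)

lemma stp_opn: "u \<in> opn \<Longrightarrow> stp (rk u) = 1"
  by (simp add: stp_def)

lemma stp_cls: "v \<in> cls \<Longrightarrow> stp (rk v) = - 1"
  using disj inj by (auto simp: stp_def inj_on_def)

lemma stp_cases: "stp m = 1 \<and> (\<exists>u\<in>opn. rk u = m) \<or> stp m = - 1 \<and> (\<exists>v\<in>cls. rk v = m) \<or> stp m = 0"
  by (auto simp: stp_def)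

lemma rk_inj: "x \<in> opn \<union> cls \<Longrightarrow> y \<in> opn \<union> cls \<Longrightarrow> rk x = rk y \<Longrightarrow> x = y"
  using inj by (auto dest: inj_onD)

text \<open>
  Ranks increase against the reading order, so the matching symbol of \<open>v \<in> cls\<close> is found
  where the walk \<^term>\<open>lv\<close> first returns to its level before the down-step at \<open>v\<close>.
\<close>

definition matched :: "'a \<Rightarrow> 'a \<Rightarrow> bool" where
  "matched u v \<longleftrightarrow> u \<in> opn \<and> v \<in> cls \<and> rk v < rk u \<and> lv (Suc (rk u)) = lv (rk v) \<and>
     (\<forall>m. rk v < m \<and> m \<le> rk u \<longrightarrow> lv m < lv (rk v))"

lemma first_return:
  assumes v: "v \<in> cls" and b: "rk v < b" "lv (rk v) \<le> lv b"
  obtains u where "matched u v" "rk u < b"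
proof -
  let ?P = "\<lambda>b. rk v < b \<and> lv (rk v) \<le> lv b"
  define b0 where "b0 = (LEAST b. ?P b)"
  have b0: "?P b0" unfolding b0_def by (rule LeastI[of ?P b]) (use b in auto)
  have least: "\<And>m. m < b0 \<Longrightarrow> \<not> ?P m" unfolding b0_def by (rule not_less_Least)
  have "b0 \<le> b" unfolding b0_def by (rule Least_le) (use b in auto)
  have "lv (Suc (rk v)) < lv (rk v)" using stp_cls[OF v] by (simp add: lv_Suc)
  then have "b0 \<noteq> Suc (rk v)" using b0 by auto
  then obtain k where k: "b0 = Suc k" "rk v < k" using b0 by (cases b0) auto
  have "lv k < lv (rk v)" using least[of k] k by auto
  then obtain u where u: "u \<in> opn" "rk u = k" "lv (Suc k) = lv (rk v)"
    using stp_cases[of k] b0 k by (auto simp: lv_Suc)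
  have "matched u v" unfolding matched_def
  proof (intro conjI allI impI)
    fix m assume "rk v < m \<and> m \<le> rk u"
    then show "lv m < lv (rk v)" using least[of m] u k by auto
  qed (use u v k in auto)
  then show thesis using that u k \<open>b0 \<le> b\<close> by auto
qed

lemma last_departure:
  assumes u: "u \<in> opn" and b: "b \<le> rk u" "lv (Suc (rk u)) \<le> lv b"
  obtains v where "matched u v" "b \<le> rk v"
proof -
  let ?P = "\<lambda>b. b \<le> rk u \<and> lv (Suc (rk u)) \<le> lv b"
  define b0 where "b0 = (GREATEST b. ?P b)"
  have b0: "?P b0" unfolding b0_def by (rule GreatestI_nat[of ?P b "rk u"]) (use b in auto)
  have gr: "?P m \<Longrightarrow> m \<le> b0" for m unfolding b0_def
    by (rule Greatest_le_nat[of ?P m "rk u"]) auto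
  have "lv (Suc (rk u)) > lv (rk u)" using stp_opn[OF u] by (simp add: lv_Suc)
  then have "b0 < rk u" using b0 by (metis nat_less_le not_le)
  moreover have low: "lv m < lv (Suc (rk u))" if "b0 < m" "m \<le> rk u" for m
    using gr[of m] that by force
  ultimately have "lv (Suc b0) < lv (Suc (rk u))" by auto
  then obtain v where v: "v \<in> cls" "rk v = b0" "lv b0 = lv (Suc (rk u))"
    using stp_cases[of b0] b0 by (auto simp: lv_Suc)
  have "matched u v" unfolding matched_def using u v low \<open>b0 < rk u\<close> by auto
  then show thesis using that v gr b by auto
qed

lemma matched_unique:
  assumes "matched u v"
  shows "matched u v' \<Longrightarrow> v' = v" and "matched u' v \<Longrightarrow> u' = u"
proof -
  have *: False if m: "matched u v" "matched u v'" "rk v < rk v'" for u v v'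
  proof -
    have "rk v' < rk u" using m by (auto simp: matched_def)
    then have "lv (rk v') < lv (rk v)" using m by (auto simp: matched_def)
    then show False using m by (auto simp: matched_def)
  qed
  show "matched u v' \<Longrightarrow> v' = v"
    using *[OF assms] *[OF _ assms] by (metis assms UnCI linorder_neqE_nat matched_def rk_inj)
  have *: False if m: "matched u v" "matched u' v" "rk u < rk u'" for u u'
  proof -
    have "lv (Suc (rk u)) < lv (rk v)" using m unfolding matched_def
      by (metis Suc_leI less_SucI)
    then show False using m by (auto simp: matched_def)
  qed
  show "matched u' v \<Longrightarrow> u' = u"
    using *[OF assms] *[OF _ assms] by (metis assms UnCI linorder_neqE_nat matched_def rk_inj)
qed

definition sound :: "('a \<times> 'a) set \<Rightarrow> bool" where
  "sound A \<longleftrightarrow> (\<forall>(u, v) \<in> A. matched u v \<and>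
     (\<forall>w \<in> opn \<union> cls. rk v < rk w \<and> rk w < rk u \<longrightarrow> w \<in> Field A))"

lemma sound_step:
  assumes A: "sound A" and st: "arc_step opn cls bef A B"
  shows "sound B"
proof -
  obtain u v where uv: "u \<in> opn" "v \<in> cls" "bef u v" "u \<notin> Field A" "v \<notin> Field A"
    and btw: "\<And>w. w \<in> opn \<union> cls \<Longrightarrow> bef u w \<Longrightarrow> bef w v \<Longrightarrow> w \<in> Field A"
    and B: "B = insert (u, v) A"
    using st unfolding arc_step_def by blast
  have lt: "rk v < rk u" using uv bef by auto
  have btw': "w \<in> Field A" if "w \<in> opn \<union> cls" "rk v < rk w" "rk w < rk u" for w
    using that btw bef uv by auto
  have partner: "\<exists>w'. (matched w w' \<and> (w, w') \<in> A \<or> matched w' w \<and> (w', w) \<in> A)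
                    \<and> rk v < rk w' \<and> rk w' < rk u"
    if w: "w \<in> opn \<union> cls" "rk v < rk w" "rk w < rk u" for w
  proof -
    have "w \<in> Field A" using btw' w by auto
    then obtain x y where xy: "(x, y) \<in> A" "w = x \<or> w = y" by (auto simp: Field_def)
    have m: "matched x y" "\<And>z. z \<in> opn \<union> cls \<Longrightarrow> rk y < rk z \<Longrightarrow> rk z < rk x \<Longrightarrow> z \<in> Field A"
      using A xy unfolding sound_def by blast+
    have ne: "x \<noteq> u" "y \<noteq> v" using xy uv by (auto simp: Field_def)
    have "x \<in> opn" "y \<in> cls" "rk y < rk x" using m by (auto simp: matched_def)
    then have ne': "rk x \<noteq> rk u" "rk y \<noteq> rk v" using ne rk_inj uv by blast+
    have "rk x < rk u"
      using xy w m(2)[of u] uv ne' \<open>rk y < rk x\<close> by (metis UnI1 linorder_neqE_nat)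
    moreover have "rk v < rk y"
      using xy w m(2)[of v] uv ne' \<open>rk y < rk x\<close> by (metis UnI2 linorder_neqE_nat)
    ultimately show ?thesis using xy m(1) \<open>rk y < rk x\<close> by (metis dual_order.strict_trans)
  qed
  have sv: "lv (Suc (rk v)) = lv (rk v) - 1" using stp_cls uv by (simp add: lv_Suc)
  have low: "lv m < lv (rk v)" if m: "rk v < m" "m \<le> rk u" for m
  proof (rule ccontr)
    assume "\<not> lv m < lv (rk v)"
    then obtain x where x: "matched x v" "rk x < m" using first_return uv m by (metis not_le)
    then have "(x, v) \<in> A \<or> x \<in> opn \<and> rk v < rk x \<and> rk x < rk u" using m by (auto simp: matched_def)
    then obtain w' where "matched x w' \<and> (x, w') \<in> A \<or> matched w' x \<and> (w', x) \<in> A"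
      using partner[of x] uv(5) by (metis FieldI2 UnI1)
    moreover have "x \<notin> cls" using x disj by (auto simp: matched_def)
    ultimately have "(x, v) \<in> A" using matched_unique(1)[OF x(1)] by (auto simp: matched_def)
    then show False using uv by (auto simp: Field_def)
  qed
  have "lv (rk v) \<le> lv (Suc (rk u))"
  proof (rule ccontr)
    assume n: "\<not> lv (rk v) \<le> lv (Suc (rk u))"
    then have "lv (Suc (rk u)) \<le> lv (Suc (rk v))" using sv by linarith
    then obtain y where y: "matched u y" "Suc (rk v) \<le> rk y"
      using last_departure[OF uv(1), of "Suc (rk v)"] lt by auto
    then obtain w' where "matched y w' \<and> (y, w') \<in> A \<or> matched w' y \<and> (w', y) \<in> A"
      using partner[of y] by (auto simp: matched_def)
    moreover have "y \<notin> opn" using y disj by (auto simp: matched_def)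
    ultimately have "(u, y) \<in> A" using matched_unique(2)[OF y(1)] by (auto simp: matched_def)
    then show False using uv by (auto simp: Field_def)
  qed
  moreover have "lv (Suc (rk u)) \<le> lv (rk v)"
    using low[of "rk u"] lt stp_opn uv by (auto simp: lv_Suc)
  ultimately have "matched u v" unfolding matched_def using uv lt low by auto
  then show ?thesis
    using A btw' unfolding sound_def B by (auto simp: Field_def; blast)
qed

lemma sound_reach: "(arc_step opn cls bef)\<^sup>*\<^sup>* {} A \<Longrightarrow> sound A"
proof (induction rule: rtranclp_induct)
  case base show ?case by (simp add: sound_def)
next
  case (step y z) then show ?case using sound_step by auto
qed

lemma matched_inside:
  assumes "matched u v" "w \<in> opn \<union> cls" "rk v < rk w" "rk w < rk u"
  obtains x y where "matched x y" "w = x \<or> w = y" "rk v < rk y" "rk x < rk u"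
proof (cases "w \<in> opn")
  case True
  have "lv (Suc (rk w)) \<le> lv (rk v) - 1"
    using assms unfolding matched_def by (metis Suc_leI less_SucI zle_diff1_eq)
  also have "lv (rk v) - 1 = lv (Suc (rk v))" using assms(1) stp_cls by (simp add: lv_Suc matched_def)
  finally obtain y where "matched w y" "Suc (rk v) \<le> rk y"
    using last_departure[OF True, of "Suc (rk v)"] assms(3) by auto
  then show thesis using that[of w y] assms by auto
next
  case False
  then have w: "w \<in> cls" using assms by auto
  have "lv (rk w) \<le> lv (rk v) - 1" using assms by (auto simp: matched_def)
  also have "\<dots> = lv (rk u)" using assms(1) stp_opn[of u] by (auto simp: lv_Suc matched_def)
  finally obtain x where "matched x w" "rk x < rk u"
    using first_return[OF w, of "rk u"] assms by auto
  then show thesis using that[of x w] assms by auto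
qed

lemma matched_subset_terminal:
  assumes A: "sound A" and stuck: "\<nexists>B. arc_step opn cls bef A B"
  shows "matched u v \<Longrightarrow> (u, v) \<in> A"
proof (induction "rk u - rk v" arbitrary: u v rule: less_induct)
  case less
  note m = less.prems
  show ?case
  proof (rule ccontr)
    assume n: "(u, v) \<notin> A"
    have mA: "\<And>x y. (x, y) \<in> A \<Longrightarrow> matched x y" using A unfolding sound_def by blast
    have uv: "u \<in> opn" "v \<in> cls" "rk v < rk u" using m by (auto simp: matched_def)
    have nF: "u \<notin> Field A"
    proof
      assume "u \<in> Field A"
      then obtain x y where xy: "(x, y) \<in> A" "u = x \<or> u = y" by (auto simp: Field_def)
      have "matched x y" using mA xy by auto
      moreover from this have "u = x" using xy uv disj by (auto simp: matched_def)
      ultimately show False using matched_unique(1)[OF m] n xy by auto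
    qed
    have nF': "v \<notin> Field A"
    proof
      assume "v \<in> Field A"
      then obtain x y where xy: "(x, y) \<in> A" "v = x \<or> v = y" by (auto simp: Field_def)
      have "matched x y" using mA xy by auto
      moreover from this have "v = y" using xy uv disj by (auto simp: matched_def)
      ultimately show False using matched_unique(2)[OF m] n xy by auto
    qed
    have "w \<in> Field A" if w: "w \<in> opn \<union> cls" "bef u w" "bef w v" for w
    proof -
      have "rk w < rk u" "rk v < rk w" using w bef uv by auto
      then obtain x y where xy: "matched x y" "w = x \<or> w = y" "rk v < rk y" "rk x < rk u"
        using matched_inside m w by metis
      then have "rk x - rk y < rk u - rk v" by (auto simp: matched_def)
      then have "(x, y) \<in> A" using less.hyps xy by auto
      then show ?thesis using xy by (auto simp: Field_def)
    qed
    then have "arc_step opn cls bef A (insert (u, v) A)"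
      unfolding arc_step_def using uv nF nF' bef by blast
    then show False using stuck by blast
  qed
qed

lemma matched_finite: "finite {(u, v). matched u v}"
proof (rule finite_imageD)
  show "finite (fst ` {(u, v). matched u v})"
    by (rule finite_subset[OF _ fin]) (auto simp: matched_def)
  show "inj_on fst {(u, v). matched u v}" using matched_unique(1) by (auto simp: inj_on_def)
qed

lemma arcs_eq: "arcs opn cls bef = {(u, v). matched u v}"
proof -
  let ?R = "\<lambda>A. (arc_step opn cls bef)\<^sup>*\<^sup>* {} A"
  let ?M = "{(u, v). matched u v}"
  have sub: "A \<subseteq> ?M" if "?R A" for A using sound_reach[OF that] by (auto simp: sound_def)
  have "finite {A. ?R A}" by (rule finite_subset[of _ "Pow ?M"]) (use sub matched_finite in auto)
  moreover have "{} \<in> {A. ?R A}" by auto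
  ultimately obtain A where A: "?R A" "\<And>B. ?R B \<Longrightarrow> A \<subseteq> B \<Longrightarrow> A = B"
    using finite_has_maximal[of "{A. ?R A}"] by auto
  have stuck: "\<nexists>B. arc_step opn cls bef A B"
  proof
    assume "\<exists>B. arc_step opn cls bef A B"
    then obtain B where B: "arc_step opn cls bef A B" by auto
    have "?R B" using A(1) B by (meson rtranclp.rtrancl_into_rtrancl)
    moreover have "A \<subset> B" using B by (auto simp: arc_step_def Field_def)
    ultimately show False using A(2) by auto
  qed
  have eq: "B = ?M" if "?R B" "\<nexists>C. arc_step opn cls bef B C" for B
    using sub[OF that(1)] matched_subset_terminal[OF sound_reach[OF that(1)] that(2)] by auto
  show ?thesis unfolding arcs_def
  proof (rule the_equality)
    show "?R ?M \<and> (\<nexists>B. arc_step opn cls bef ?M B)"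
      using A(1) stuck unfolding eq[OF A(1) stuck, symmetric] by (rule conjI)
  qed (erule conjE, rule eq)
qed

lemma free_opn:
  "opn - Field (arcs opn cls bef) = {u \<in> opn. \<forall>m \<le> rk u. lv m < lv (Suc (rk u))}"
proof -
  have "u \<in> Field {(u, v). matched u v} \<longleftrightarrow> (\<exists>v. matched u v)" if "u \<in> opn" for u
    using that disj by (auto simp: Field_def matched_def)
  moreover have "(\<exists>v. matched u v) \<longleftrightarrow> \<not> (\<forall>m \<le> rk u. lv m < lv (Suc (rk u)))" if "u \<in> opn" for u
  proof
    assume "\<exists>v. matched u v"
    then obtain v where "matched u v" by auto
    then show "\<not> (\<forall>m \<le> rk u. lv m < lv (Suc (rk u)))"
      by (auto simp: matched_def intro!: exI[of _ "rk v"])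
  next
    assume "\<not> (\<forall>m \<le> rk u. lv m < lv (Suc (rk u)))"
    then show "\<exists>v. matched u v" using last_departure[OF that] by (metis not_less)
  qed
  ultimately show ?thesis unfolding arcs_eq by blast
qed

lemma free_cls:
  "cls - Field (arcs opn cls bef) = {v \<in> cls. \<forall>m > rk v. lv m < lv (rk v)}"
proof -
  have "v \<in> Field {(u, v). matched u v} \<longleftrightarrow> (\<exists>u. matched u v)" if "v \<in> cls" for v
    using that disj by (auto simp: Field_def matched_def)
  moreover have "(\<exists>u. matched u v) \<longleftrightarrow> \<not> (\<forall>m > rk v. lv m < lv (rk v))" if "v \<in> cls" for v
    using first_return[OF that] by (auto simp: not_less matched_def) (metis less_SucI order.refl)+
  ultimately show ?thesis unfolding arcs_eq by blast
qed

lemma free_opn_levels: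
  "bij_betw (\<lambda>u. lv (Suc (rk u))) (opn - Field (arcs opn cls bef)) {L. 1 \<le> L \<and> (\<exists>m. L \<le> lv m)}"
  unfolding bij_betw_def
proof
  show "inj_on (\<lambda>u. lv (Suc (rk u))) (opn - Field (arcs opn cls bef))"
  proof (rule inj_onI)
    fix x y assume x: "x \<in> opn - Field (arcs opn cls bef)" and y: "y \<in> opn - Field (arcs opn cls bef)"
      and eq: "lv (Suc (rk x)) = lv (Suc (rk y))"
    have *: "\<And>u m. u \<in> opn - Field (arcs opn cls bef) \<Longrightarrow> m \<le> rk u \<Longrightarrow> lv m < lv (Suc (rk u))"
      unfolding free_opn by blast
    have "\<not> rk x < rk y" "\<not> rk y < rk x"
      using *[OF x, of "Suc (rk y)"] *[OF y, of "Suc (rk x)"] eq by auto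
    then show "x = y" using rk_inj x y by (metis DiffD1 UnI1 linorder_neqE_nat)
  qed
  show "(\<lambda>u. lv (Suc (rk u))) ` (opn - Field (arcs opn cls bef)) = {L. 1 \<le> L \<and> (\<exists>m. L \<le> lv m)}"
  proof (intro equalityI subsetI)
    fix L assume "L \<in> (\<lambda>u. lv (Suc (rk u))) ` (opn - Field (arcs opn cls bef))"
    then obtain u where u: "u \<in> opn" "\<forall>m \<le> rk u. lv m < lv (Suc (rk u))" "L = lv (Suc (rk u))"
      unfolding free_opn by auto
    have "lv 0 < L" using u by blast
    then show "L \<in> {L. 1 \<le> L \<and> (\<exists>m. L \<le> lv m)}" using u by auto
  next
    fix L assume L: "L \<in> {L. 1 \<le> L \<and> (\<exists>m. L \<le> lv m)}"
    define m where "m = (LEAST m. L \<le> lv m)"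
    have m: "L \<le> lv m" unfolding m_def by (rule LeastI_ex) (use L in auto)
    have lo: "lv j < L" if "j < m" for j using not_less_Least[of j "\<lambda>m. L \<le> lv m"] that by (auto simp: m_def)
    have "m \<noteq> 0" using m L by (intro notI) auto
    then obtain k where k: "m = Suc k" by (cases m) auto
    then obtain u where u: "u \<in> opn" "rk u = k" "lv m = L"
      using stp_cases[of k] m lo[of k] by (auto simp: lv_Suc)
    then show "L \<in> (\<lambda>u. lv (Suc (rk u))) ` (opn - Field (arcs opn cls bef))"
      unfolding free_opn using lo k by (intro image_eqI[of _ _ u]) auto
  qed
qed

lemma lv_le_card: "lv m \<le> int (card (opn - Field (arcs opn cls bef)))"
  and lv_card: "\<exists>m. lv m = int (card (opn - Field (arcs opn cls bef)))"
proof -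
  let ?F = "opn - Field (arcs opn cls bef)" and ?S = "{L. 1 \<le> L \<and> (\<exists>m. L \<le> lv m)}"
  have c: "card ?F = card ?S" using bij_betw_same_card[OF free_opn_levels] .
  have fS: "finite ?S" using bij_betw_finite[OF free_opn_levels] fin by auto
  show le: "lv m \<le> int (card ?F)" for m
  proof -
    have "{1..lv m} \<subseteq> ?S" by auto
    from card_mono[OF fS this] show ?thesis using c by auto
  qed
  show "\<exists>m. lv m = int (card ?F)"
  proof (cases "?S = {}")
    case True then show ?thesis using c by (intro exI[of _ 0]) (simp add: card_eq_0_iff)
  next
    case False
    define M where "M = Max ?S"
    have M: "M \<in> ?S" unfolding M_def using Max_in[OF fS False] .
    have "?S = {1..M}"
    proof (intro equalityI subsetI)
      fix L assume "L \<in> ?S"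
      then show "L \<in> {1..M}" using Max_ge[OF fS, of L] unfolding M_def by auto
    next
      fix L assume "L \<in> {1..M}"
      then show "L \<in> ?S" using M by (auto intro: order.trans)
    qed
    then have "int (card ?F) = M" using M c by auto
    moreover obtain m where "M \<le> lv m" using M by auto
    ultimately show ?thesis using le[of m] by (intro exI[of _ m]) auto
  qed
qed

lemma last_free_cls:
  assumes "v \<in> cls" "\<And>m. rk v < m \<Longrightarrow> lv m < lv (rk v)" "\<And>m. m \<le> rk v \<Longrightarrow> lv m \<le> lv (rk v)"
  shows "v \<in> cls - Field (arcs opn cls bef)"
    and "last_in bef (cls - Field (arcs opn cls bef)) = v"
proof -
  show v: "v \<in> cls - Field (arcs opn cls bef)" unfolding free_cls using assms by auto
  have first: "y = v \<or> rk v < rk y" if "y \<in> cls - Field (arcs opn cls bef)" for y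
  proof -
    have y: "y \<in> cls" "\<And>m. rk y < m \<Longrightarrow> lv m < lv (rk y)" using that unfolding free_cls by auto
    have "\<not> rk y < rk v" using y(2)[of "rk v"] assms(3)[of "rk y"] by auto
    moreover have "rk y = rk v \<Longrightarrow> y = v" using rk_inj[of y v] y(1) assms(1) by blast
    ultimately show ?thesis by linarith
  qed
  show "last_in bef (cls - Field (arcs opn cls bef)) = v"
    unfolding last_in_def
  proof (rule the_equality)
    show "v \<in> cls - Field (arcs opn cls bef) \<and> (\<forall>y\<in>cls - Field (arcs opn cls bef). y = v \<or> bef y v)"
      using v first bef by auto
    fix x assume x: "x \<in> cls - Field (arcs opn cls bef) \<and> (\<forall>y\<in>cls - Field (arcs opn cls bef). y = x \<or> bef y x)"
    then have "v = x \<or> rk x < rk v" using v bef by auto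
    then show "x = v" using first[of x] x by auto
  qed
qed

lemma first_free_opn:
  assumes "u \<in> opn" "\<And>m. m \<le> rk u \<Longrightarrow> lv m < lv (Suc (rk u))" "\<And>m. lv m \<le> lv (Suc (rk u))"
  shows "u \<in> opn - Field (arcs opn cls bef)"
    and "first_in bef (opn - Field (arcs opn cls bef)) = u"
proof -
  show u: "u \<in> opn - Field (arcs opn cls bef)" unfolding free_opn using assms by auto
  have last: "y = u \<or> rk y < rk u" if y: "y \<in> opn - Field (arcs opn cls bef)" for y
  proof -
    have yo: "y \<in> opn" "\<And>m. m \<le> rk y \<Longrightarrow> lv m < lv (Suc (rk y))" using y unfolding free_opn by auto
    have "\<not> rk u < rk y" using yo(2)[of "Suc (rk u)"] assms(3)[of "Suc (rk y)"] by auto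
    moreover have "rk y = rk u \<Longrightarrow> y = u" using rk_inj[of y u] yo(1) assms(1) by blast
    ultimately show ?thesis by linarith
  qed
  show "first_in bef (opn - Field (arcs opn cls bef)) = u"
    unfolding first_in_def
  proof (rule the_equality)
    show "u \<in> opn - Field (arcs opn cls bef) \<and> (\<forall>y\<in>opn - Field (arcs opn cls bef). y = u \<or> bef u y)"
      using u last bef by auto
    fix x assume x: "x \<in> opn - Field (arcs opn cls bef) \<and> (\<forall>y\<in>opn - Field (arcs opn cls bef). y = x \<or> bef x y)"
    then have "u = x \<or> rk u < rk x" using u bef by auto
    then show "x = u" using last[of x] x by auto
  qed
qed

lemma first_free_opn_exists:
  assumes "opn - Field (arcs opn cls bef) \<noteq> {}"
  obtains u where "u \<in> opn" "\<And>m. m \<le> rk u \<Longrightarrow> lv m < lv (Suc (rk u))" "\<And>m. lv m \<le> lv (Suc (rk u))"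
proof -
  define L where "L = int (card (opn - Field (arcs opn cls bef)))"
  have L: "L \<ge> 1" using assms fin by (simp add: L_def Suc_le_eq card_gt_0_iff)
  have "L \<in> {L. 1 \<le> L \<and> (\<exists>m. L \<le> lv m)}" using L lv_card by (auto simp: L_def[symmetric] intro: eq_refl[OF sym])
  then obtain u where u: "u \<in> opn - Field (arcs opn cls bef)" "lv (Suc (rk u)) = L"
    using free_opn_levels unfolding bij_betw_def by (metis (no_types, lifting) imageE)
  show thesis by (rule that[of u]) (use u lv_le_card in \<open>auto simp: free_opn L_def\<close>)
qed

lemma card_free_cls:
  assumes X: "finite X" "X \<subseteq> cls" and cl: "\<And>u v. matched u v \<Longrightarrow> v \<in> X"
  shows "int (card (X - Field (arcs opn cls bef))) =
         int (card X) - int (card opn) + int (card (opn - Field (arcs opn cls bef)))"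
proof -
  let ?M = "{(u, v). matched u v}"
  have "card (fst ` ?M) = card ?M" "card (snd ` ?M) = card ?M"
    by (rule card_image; use matched_unique in \<open>auto simp: inj_on_def\<close>)+
  moreover have "fst ` ?M \<subseteq> opn" "snd ` ?M \<subseteq> X" using cl by (auto simp: matched_def)
  moreover have "X - Field ?M = X - snd ` ?M" "opn - Field ?M = opn - fst ` ?M"
  proof -
    have m: "u \<in> opn" "v \<in> cls" "u \<notin> cls" "v \<notin> opn" if "matched u v" for u v
      using that disj by (auto simp: matched_def)
    show "X - Field ?M = X - snd ` ?M" using X m by (auto simp: Field_def image_iff)
    show "opn - Field ?M = opn - fst ` ?M" using m by (auto simp: Field_def image_iff)
  qed
  moreover have "finite ?M" by (rule matched_finite)
  moreover from calculation have "card ?M \<le> card X" "card ?M \<le> card opn"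
    using card_mono[OF X(1), of "snd ` ?M"] card_mono[OF fin, of "fst ` ?M"] by auto
  ultimately show ?thesis unfolding arcs_eq using X fin
    by (simp add: card_Diff_subset of_nat_diff)
qed

end

section \<open>Row functions\<close>

declare add_bit_eq_xor [simp del]

lemma bit_neq_iff: "(k :: bit) \<noteq> i \<longleftrightarrow> k = i + 1"
  by (cases k; cases i) simp_all

lemma bit_add_self [simp]: "(k :: bit) + k = 0" "(k :: bit) + (k + j) = j"
  by (cases k; cases j; simp)+

lemma of_nat_bit: "(of_nat n :: bit) = (if even n then 0 else 1)"
  by (induction n) auto

lemma of_nat_bit_eq_iff: "(of_nat m :: bit) = of_nat n \<longleftrightarrow> (even m \<longleftrightarrow> even n)"
  by (simp add: of_nat_bit)

definition sg :: "bit \<Rightarrow> bit \<Rightarrow> int" where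
  "sg i k = (if k = i then 1 else - 1)"

lemma sg_Suc [simp]: "sg i (k + 1) = - sg i k" "sg i (1 + k) = - sg i k"
  by (cases i; cases k; simp add: sg_def)+

text \<open>
  Row \<open>r\<close> of a diagram has \<open>d r\<close> boxes and colour \<open>c + of_nat r\<close>; \<open>t\<close> is a peak row.
  The last conjunct of \<open>ul\<close> excludes empty rows at the top.
\<close>

definition um :: "(nat \<Rightarrow> nat) \<Rightarrow> nat \<Rightarrow> bool" where
  "um d t \<longleftrightarrow> (\<forall>r<t. d r \<le> d (Suc r)) \<and> (\<forall>r\<ge>t. d (Suc r) \<le> d r) \<and> (\<exists>n. \<forall>r\<ge>n. d r = 0)"

definition ul :: "(nat \<Rightarrow> nat) \<Rightarrow> nat \<Rightarrow> bool" where
  "ul d t \<longleftrightarrow> (\<forall>r<t. d r < d (Suc r)) \<and> (\<forall>r\<ge>t. d (Suc r) \<le> d r) \<and> (\<exists>n. \<forall>r\<ge>n. d r = 0) \<and>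
     (t = 0 \<or> 0 < d 0)"

lemma ul_um: "ul d t \<Longrightarrow> um d t"
  by (auto simp: ul_def um_def less_imp_le)

lemma um_mono: "um d t \<Longrightarrow> r \<le> s \<Longrightarrow> s \<le> t \<Longrightarrow> d r \<le> d s"
proof (induction s)
  case (Suc s)
  then show ?case by (cases "r = Suc s") (auto simp: um_def intro: order.trans)
qed auto

lemma um_antimono: "um d t \<Longrightarrow> t \<le> r \<Longrightarrow> r \<le> s \<Longrightarrow> d s \<le> d r"
proof (induction s)
  case (Suc s)
  show ?case
  proof (cases "r = Suc s")
    case False
    then have "d s \<le> d r" "d (Suc s) \<le> d s" using Suc by (auto simp: um_def)
    then show ?thesis by auto
  qed auto
qed auto

lemma um_le_peak: "um d t \<Longrightarrow> d r \<le> d t"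
  using um_mono[of d t r t] um_antimono[of d t t r] by (cases "r \<le> t") auto

lemma um_finite: "um d t \<Longrightarrow> finite {r. x < d r}"
proof -
  assume "um d t"
  then obtain n where "\<forall>r\<ge>n. d r = 0" by (auto simp: um_def)
  then have "{r. x < d r} \<subseteq> {..<n}" by (force simp: not_less[symmetric])
  then show ?thesis using finite_subset by blast
qed

text \<open>\<open>ft d x\<close> is the row directly below the last box of column \<open>x\<close>.\<close>

definition hg :: "(nat \<Rightarrow> nat) \<Rightarrow> nat \<Rightarrow> nat" where
  "hg d x = card {r. x < d r}"

definition ft :: "(nat \<Rightarrow> nat) \<Rightarrow> nat \<Rightarrow> nat" where
  "ft d x = (LEAST r. \<forall>s\<ge>r. d s \<le> x)"

definition tp :: "(nat \<Rightarrow> nat) \<Rightarrow> nat \<Rightarrow> nat" where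
  "tp d x = ft d x - hg d x"

lemma hg_pos: "um d t \<Longrightarrow> 0 < hg d x \<longleftrightarrow> x < d t"
  using um_finite[of d t x] um_le_peak[of d t] unfolding hg_def
  by (auto simp: card_gt_0_iff intro: less_le_trans)

lemma um_column:
  assumes "um d t" "x < d t"
  shows "x < d r \<longleftrightarrow> tp d x \<le> r \<and> r < ft d x" and "tp d x \<le> t" and "t < ft d x"
    and "ft d x = tp d x + hg d x"
proof -
  define p where "p = (LEAST r. x < d r)"
  have pt: "p \<le> t" unfolding p_def by (rule Least_le) fact
  have p: "x < d p" unfolding p_def by (rule LeastI) fact
  have below: "x < d r \<longleftrightarrow> p \<le> r" if "r \<le> t" for r
    using that um_mono[OF assms(1), of p r] p unfolding p_def by (auto intro: Least_le)
  obtain n where "\<forall>r\<ge>n. d r = 0" using assms by (auto simp: um_def)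
  then have "\<forall>s\<ge>n. d s \<le> x" by auto
  then have f: "\<forall>s\<ge>ft d x. d s \<le> x" unfolding ft_def by (rule LeastI)
  have above: "x < d r \<longleftrightarrow> r < ft d x" if "t \<le> r" for r
  proof
    assume "r < ft d x"
    then have "\<not> (\<forall>s\<ge>r. d s \<le> x)" unfolding ft_def by (rule not_less_Least)
    then obtain s where "s \<ge> r" "x < d s" by (auto simp: not_le)
    then show "x < d r" using um_antimono[OF assms(1) that, of s] by auto
  next
    assume "x < d r"
    then have "\<not> ft d x \<le> r" using f by (metis leD)
    then show "r < ft d x" by auto
  qed
  have tf: "t < ft d x" using above[of t] assms by auto
  have iff: "x < d r \<longleftrightarrow> p \<le> r \<and> r < ft d x" for r
    using below[of r] above[of r] pt tf by (cases "r \<le> t") auto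
  have "{r. x < d r} = {p..<ft d x}" by (simp add: set_eq_iff iff)
  then have "hg d x = ft d x - p" by (simp add: hg_def)
  then have "tp d x = p" using tf pt by (simp add: tp_def)
  then show "x < d r \<longleftrightarrow> tp d x \<le> r \<and> r < ft d x" "tp d x \<le> t" "t < ft d x"
    "ft d x = tp d x + hg d x"
    using iff[of r] pt tf \<open>hg d x = ft d x - p\<close> by simp_all
qed

lemma ft_eq:
  assumes "um d t" "t \<le> r" "d (Suc r) \<le> x" "x < d r"
  shows "ft d x = Suc r"
proof -
  have x: "x < d t" using assms um_le_peak[of d t r] by auto
  show ?thesis using um_column(1)[OF assms(1) x, of r] um_column(1)[OF assms(1) x, of "Suc r"]
    um_column(2)[OF assms(1) x] assms by auto
qed

section \<open>Bottom words\<close>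

definition fc :: "bit \<Rightarrow> (nat \<Rightarrow> nat) \<Rightarrow> nat \<Rightarrow> bit" where
  "fc c d x = c + of_nat (ft d x)"

definition clet :: "bit \<Rightarrow> bit \<Rightarrow> (nat \<Rightarrow> nat) \<Rightarrow> nat \<Rightarrow> int" where
  "clet i c d x = (if hg d x = 0 then 0 else if fc c d x = i then - 1 else 1)"

definition clv :: "bit \<Rightarrow> bit \<Rightarrow> (nat \<Rightarrow> nat) \<Rightarrow> nat \<Rightarrow> int" where
  "clv i c d C = (\<Sum>x<C. clet i c d x)"

lemma clv_0 [simp]: "clv i c d 0 = 0" and clv_Suc: "clv i c d (Suc C) = clv i c d C + clet i c d C"
  by (simp_all add: clv_def)

lemma clv_segment:
  assumes "um d t" "t \<le> r" "d (Suc r) \<le> C" "C \<le> d r"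
  shows "clv i c d C = clv i c d (d (Suc r)) + sg i (c + of_nat r) * (int C - int (d (Suc r)))"
  using assms(3,4)
proof (induction C rule: dec_induct)
  case (step C)
  then have "ft d C = Suc r" "C < d t"
    using assms ft_eq[of d t r C] um_le_peak[OF assms(1), of r] by auto
  then have "clet i c d C = sg i (c + of_nat r)"
    using hg_pos[OF assms(1), of C] by (auto simp: clet_def fc_def sg_def bit_neq_iff algebra_simps)
  then show ?case using step by (simp add: clv_Suc algebra_simps)
qed auto

lemma clv_row:
  assumes "um d t" "t \<le> r"
  shows "clv i c d (d r) = clv i c d (d (Suc r)) + sg i (c + of_nat r) * (int (d r) - int (d (Suc r)))"
  using clv_segment[OF assms, of "d r"] assms by (auto simp: um_def)

lemma clv_beyond: "um d t \<Longrightarrow> d t \<le> C \<Longrightarrow> clv i c d C = clv i c d (d t)"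
proof (induction C)
  case (Suc C)
  show ?case
  proof (cases "d t = Suc C")
    case False
    then have "clet i c d C = 0" using Suc.prems hg_pos[of d t C] by (auto simp: clet_def)
    then show ?thesis using Suc False by (simp add: clv_Suc)
  qed auto
qed auto

text \<open>\<open>f\<^sub>i\<close> adds its box to row \<open>r\<close>.\<close>

definition fr :: "bit \<Rightarrow> bit \<Rightarrow> (nat \<Rightarrow> nat) \<Rightarrow> nat \<Rightarrow> nat \<Rightarrow> bool" where
  "fr i c d t r \<longleftrightarrow> t \<le> r \<and> c + of_nat r = i \<and> (\<forall>s\<ge>t. clv i c d (d s) \<le> clv i c d (d r)) \<and>
     (\<forall>s. t \<le> s \<and> s < r \<and> c + of_nat s = i \<longrightarrow> clv i c d (d s) < clv i c d (d r))"

lemma clv_next_row: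
  assumes "um d t" "t \<le> r" "c + of_nat r \<noteq> i"
  shows "clv i c d (d r) \<le> clv i c d (d (Suc r))"
proof -
  have "d (Suc r) \<le> d r" using assms by (auto simp: um_def)
  then show ?thesis using clv_row[OF assms(1,2), of i c] assms(3) by (simp add: sg_def)
qed

lemma fr_exists:
  assumes um: "um d t"
  obtains r where "fr i c d t r"
proof -
  let ?V = "(\<lambda>s. clv i c d (d s)) ` {t..}"
  have "?V \<subseteq> clv i c d ` {..d t}" using um_le_peak[OF um] by auto
  then have fin: "finite ?V" using finite_subset by blast
  have "?V \<noteq> {}" by auto
  define M where "M = Max ?V"
  have "M \<in> ?V" unfolding M_def using Max_in[OF fin \<open>?V \<noteq> {}\<close>] .
  then obtain s where s: "t \<le> s" "M = clv i c d (d s)" by auto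
  have le: "clv i c d (d s) \<le> M" if "t \<le> s" for s unfolding M_def using that by (intro Max_ge fin) auto
  have ex: "\<exists>r. t \<le> r \<and> c + of_nat r = i \<and> clv i c d (d r) = M"
  proof (cases "c + of_nat s = i")
    case False
    then have "clv i c d (d (Suc s)) = M" using clv_next_row[OF um s(1)] le[of "Suc s"] s by force
    moreover have "c + of_nat (Suc s) = i" using False by (auto simp: bit_neq_iff algebra_simps)
    ultimately show ?thesis using s by (intro exI[of _ "Suc s"]) auto
  qed (use s in auto)
  define r where "r = (LEAST r. t \<le> r \<and> c + of_nat r = i \<and> clv i c d (d r) = M)"
  have r: "t \<le> r \<and> c + of_nat r = i \<and> clv i c d (d r) = M" unfolding r_def by (rule LeastI_ex[OF ex])
  have "fr i c d t r" unfolding fr_def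
  proof (intro conjI allI impI)
    fix s assume s: "t \<le> s \<and> s < r \<and> c + of_nat s = i"
    then have "clv i c d (d s) \<noteq> M" using not_less_Least[of s] unfolding r_def by blast
    then show "clv i c d (d s) < clv i c d (d r)" using s le[of s] r by auto
  qed (use r le in auto)
  then show thesis using that by blast
qed

definition last_argmax :: "(nat \<Rightarrow> int) \<Rightarrow> nat \<Rightarrow> nat \<Rightarrow> bool" where
  "last_argmax f w C \<longleftrightarrow> C \<le> w \<and> (\<forall>m\<le>w. f m \<le> f C) \<and> (\<forall>m\<le>w. C < m \<longrightarrow> f m < f C)"

lemma last_argmax_unique: "last_argmax f w C \<Longrightarrow> last_argmax f w C' \<Longrightarrow> C = C'"
  unfolding last_argmax_def by (metis linorder_neqE_nat not_le)

lemma column_row: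
  assumes um: "um d t" and C: "0 < C" "C \<le> d t"
  obtains s where "t \<le> s" "d (Suc s) < C" "C \<le> d s"
proof -
  have x: "C - 1 < d t" using C by auto
  note col = um_column[OF um x]
  show thesis
  proof (rule that[of "ft d (C - 1) - 1"])
    show "t \<le> ft d (C - 1) - 1" using col(3) by auto
    show "d (Suc (ft d (C - 1) - 1)) < C" using col(1)[of "ft d (C - 1)"] col(3) C by (auto simp: not_less)
    show "C \<le> d (ft d (C - 1) - 1)" using col(1)[of "ft d (C - 1) - 1"] col(2,3) C by linarith
  qed
qed

lemma clv_le_row:
  assumes um: "um d t" and C: "C \<le> d t"
  obtains s where "t \<le> s" "clv i c d C \<le> clv i c d (d s)"
    "c + of_nat s = i \<and> C \<le> d s \<or> clv i c d C < clv i c d (d s)"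
proof (cases "C = 0")
  case True
  obtain n where n: "\<forall>r\<ge>n. d r = 0" using um by (auto simp: um_def)
  obtain s where "c + of_nat s = i" "s \<ge> n" "s \<ge> t"
  proof (cases "c + of_nat (max n t) = i")
    case False
    then have "c + of_nat (Suc (max n t)) = i" by (auto simp: bit_neq_iff algebra_simps)
    then show thesis using that[of "Suc (max n t)"] by simp
  qed (use that[of "max n t"] in auto)
  then show thesis using that[of s] n True by auto
next
  case False
  then obtain s where s: "t \<le> s" "d (Suc s) < C" "C \<le> d s" using column_row[OF um _ C] by auto
  note seg = clv_segment[OF um s(1), of C i c] clv_row[OF um s(1), of i c]
  show thesis
  proof (cases "c + of_nat s = i")
    case True
    then show ?thesis using that[of s] seg s by (simp add: sg_def)
  next
    case False
    then have "clv i c d C < clv i c d (d (Suc s))" using seg s by (simp add: sg_def)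
    then show ?thesis using that[of "Suc s"] s by auto
  qed
qed

lemma fr_last_argmax:
  assumes um: "um d t" and r: "fr i c d t r"
  shows "last_argmax (clv i c d) (d t) (d r)"
  unfolding last_argmax_def
proof (intro conjI allI impI)
  fix C assume C: "C \<le> d t"
  then obtain s where s: "t \<le> s" "clv i c d C \<le> clv i c d (d s)"
    "c + of_nat s = i \<and> C \<le> d s \<or> clv i c d C < clv i c d (d s)" using clv_le_row[OF um C, of i c] by blast
  have le: "clv i c d (d s) \<le> clv i c d (d r)" using r s by (auto simp: fr_def)
  then show "clv i c d C \<le> clv i c d (d r)" using s by auto
  show "clv i c d C < clv i c d (d r)" if lt: "d r < C"
  proof (cases "clv i c d C < clv i c d (d s)")
    case False
    then have "c + of_nat s = i" "d r < d s" using s lt by auto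
    then have "s < r" using um_antimono[OF um, of r s] r by (auto simp: fr_def not_less[symmetric])
    then show ?thesis using r s \<open>c + of_nat s = i\<close> unfolding fr_def by (metis le_less_trans)
  qed (use le in auto)
qed (rule um_le_peak[OF um])

lemma clv_le_fr: "um d t \<Longrightarrow> fr i c d t r \<Longrightarrow> clv i c d C \<le> clv i c d (d r)"
  using fr_last_argmax[of d t i c r] clv_beyond[of d t C i c]
  by (cases "C \<le> d t") (auto simp: last_argmax_def)

lemma fr_shape:
  assumes um: "um d t" and r: "fr i c d t r"
  shows "r = t \<or> r = Suc t \<and> d r = d t \<or> t < r \<and> d r < d (r - 1)"
proof (rule ccontr)
  assume n: "\<not> ?thesis"
  have tr: "t < r" "r \<noteq> Suc t \<or> d r \<noteq> d t" "d (r - 1) = d r"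
    using n um_antimono[OF um, of "r - 1" r] r by (auto simp: fr_def)
  then obtain s where s: "r = Suc (Suc s)" "t \<le> s"
    by (cases r; cases "r - 1") (auto simp: less_Suc_eq_le le_Suc_eq)
  have ci: "c + of_nat s = i" using r s by (auto simp: fr_def add.assoc)
  have "clv i c d (d s) < clv i c d (d r)" using r s ci by (auto simp: fr_def)
  moreover have "clv i c d (d s) = clv i c d (d (Suc s)) + (int (d s) - int (d (Suc s)))"
    using clv_row[OF um s(2), of i c] ci by (simp add: sg_def)
  moreover have "d (Suc s) = d r" "d (Suc s) \<le> d s" using tr s um_antimono[OF um, of s "Suc s"] by auto
  ultimately show False by simp
qed

lemma fr_ul:
  assumes ul: "ul d t" and r: "fr i c d t r" and ne: "0 < d 0 \<or> c = i"
  shows "\<exists>t'. ul (d(r := Suc (d r))) t'"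
proof -
  have um: "um d t" by (rule ul_um[OF ul])
  obtain n where n: "\<forall>r\<ge>n. d r = 0" using um by (auto simp: um_def)
  have fin: "\<exists>n. \<forall>s\<ge>n. (d(r := Suc (d r))) s = 0" using n by (intro exI[of _ "max n (Suc r)"]) auto
  have tr: "t \<le> r" using r by (auto simp: fr_def)
  consider "r = t" | "r = Suc t" "d r = d t" | "t < r" "d r < d (r - 1)" using fr_shape[OF um r] by auto
  then show ?thesis
  proof cases
    case 1 then show ?thesis using ul fin by (intro exI[of _ t]) (auto simp: ul_def le_Suc_eq)
  next
    case 2
    have "d (Suc (Suc t)) \<le> d t" using 2 um_antimono[OF um, of t "Suc (Suc t)"] by auto
    moreover have "0 < d 0"
    proof (rule ccontr)
      assume z: "\<not> 0 < d 0"
      then have "t = 0" "c = i" using ul ne by (auto simp: ul_def)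
      then have "c + 1 = c" using r 2 by (simp add: fr_def del: bit_add_self)
      then show False by (cases c) simp_all
    qed
    ultimately show ?thesis using 2 ul fin by (intro exI[of _ "Suc t"]) (auto simp: ul_def less_Suc_eq le_Suc_eq)
  next
    case 3 then show ?thesis using ul fin by (intro exI[of _ t]) (auto simp: ul_def le_Suc_eq)
  qed
qed

lemma hg_add: "um d t \<Longrightarrow> hg (d(r := Suc (d r))) x = hg d x + (if x = d r then 1 else 0)"
proof -
  assume "um d t"
  then have fin: "finite {r. x < d r}" by (rule um_finite)
  have "{s. x < (d(r := Suc (d r))) s} = (if x = d r then insert r {r. x < d r} else {r. x < d r})"
    by (auto simp: less_Suc_eq)
  moreover have "card (insert r {r. x < d r}) = Suc (card {r. x < d r})" if "x = d r"
    using that by (subst card_insert_disjoint[OF fin]) auto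
  ultimately show ?thesis by (simp add: hg_def)
qed

lemma ft_add_other: "x \<noteq> d r \<Longrightarrow> ft (d(r := Suc (d r))) x = ft d x"
proof -
  assume "x \<noteq> d r"
  then have "(d(r := Suc (d r))) s \<le> x \<longleftrightarrow> d s \<le> x" for s by auto
  then show ?thesis unfolding ft_def by metis
qed

lemma ft_add_same:
  assumes "um d t" "t \<le> r"
  shows "ft (d(r := Suc (d r))) (d r) = Suc r"
  unfolding ft_def
proof (rule Least_equality)
  show "\<forall>s\<ge>Suc r. (d(r := Suc (d r))) s \<le> d r" using um_antimono[OF assms] by auto
  fix y assume "\<forall>s\<ge>y. (d(r := Suc (d r))) s \<le> d r"
  then have "\<not> y \<le> r" by (metis fun_upd_same not_less_eq_eq order_refl)
  then show "Suc r \<le> y" by auto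
qed

section \<open>Columns determine upper ledge diagrams\<close>

definition samec :: "bit \<Rightarrow> (nat \<Rightarrow> nat) \<Rightarrow> bit \<Rightarrow> (nat \<Rightarrow> nat) \<Rightarrow> bool" where
  "samec c d c' d' \<longleftrightarrow> (\<forall>x. hg d x = hg d' x \<and> (0 < hg d x \<longrightarrow> fc c d x = fc c' d' x))"

lemma samec_trans: "samec c d c' d' \<Longrightarrow> samec c' d' c'' d'' \<Longrightarrow> samec c d c'' d''"
  by (auto simp: samec_def)

lemma samec_clv: "samec c d c' d' \<Longrightarrow> clv i c d = clv i c' d'"
  by (auto simp: samec_def clv_def clet_def fun_eq_iff intro!: sum.cong)

lemma samec_width:
  assumes "samec c d c' d'" "um d t" "um d' t'"
  shows "d t = d' t'"
proof -
  have "x < d t \<longleftrightarrow> x < d' t'" for x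
    using assms hg_pos[OF assms(2)] hg_pos[OF assms(3)] by (auto simp: samec_def)
  then show ?thesis by (metis linorder_neqE_nat less_irrefl)
qed

lemma samec_add:
  assumes s: "samec c d c' d'" and um: "um d t" "um d' t'" and r: "fr i c d t r" "fr i c' d' t' r'"
  shows "samec c (d(r := Suc (d r))) c' (d'(r' := Suc (d' r')))" and "d r = d' r'"
proof -
  show eq: "d r = d' r'"
    using fr_last_argmax[OF um(1) r(1)] fr_last_argmax[OF um(2) r(2)] last_argmax_unique
      samec_width[OF s um] samec_clv[OF s] by metis
  have "fc c (d(r := Suc (d r))) (d r) = fc c' (d'(r' := Suc (d' r'))) (d r)"
    using ft_add_same[OF um(1), of r] ft_add_same[OF um(2), of r'] r eq by (auto simp: fc_def fr_def)
  then show "samec c (d(r := Suc (d r))) c' (d'(r' := Suc (d' r')))"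
    using s eq ft_add_other[of _ d r] ft_add_other[of _ d' r']
    unfolding samec_def hg_add[OF um(1)] hg_add[OF um(2)]
    by (auto simp: fc_def)
qed

lemma samec_top:
  assumes "samec c d c' d'" "um d t" "um d' t'" "x < d t"
  shows "c + of_nat (tp d x) = c' + of_nat (tp d' x)"
proof -
  have "hg d x = hg d' x" "0 < hg d x" "fc c d x = fc c' d' x"
    using assms hg_pos[of d t x] by (auto simp: samec_def)
  moreover have "x < d' t'" using samec_width[OF assms(1-3)] assms(4) by simp
  ultimately have "c + of_nat (tp d x) + of_nat (hg d x) = c' + of_nat (tp d' x) + of_nat (hg d x)"
    using um_column(4)[OF assms(2,4)] um_column(4)[OF assms(3), of x]
    by (simp only: fc_def add.assoc of_nat_add)
  then show ?thesis by (simp only: add_right_cancel)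
qed

lemma tp_mono: "um d t \<Longrightarrow> Suc x < d t \<Longrightarrow> tp d x \<le> tp d (Suc x)"
proof -
  assume a: "um d t" "Suc x < d t"
  have "Suc x < d (tp d (Suc x))"
    using um_column(1)[OF a, of "tp d (Suc x)"] um_column(2,3)[OF a] by linarith
  then show ?thesis using um_column(1)[of d t x "tp d (Suc x)"] a by linarith
qed

lemma ft_antimono: "um d t \<Longrightarrow> Suc x < d t \<Longrightarrow> ft d (Suc x) \<le> ft d x"
proof -
  assume a: "um d t" "Suc x < d t"
  have "Suc x < d (ft d (Suc x) - 1)"
    using um_column(1)[OF a, of "ft d (Suc x) - 1"] um_column(2,3)[OF a] by linarith
  then have "ft d (Suc x) - 1 < ft d x"
    using um_column(1)[of d t x "ft d (Suc x) - 1"] a by linarith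
  then show ?thesis by auto
qed

lemma ul_tp_step:
  assumes ul: "ul d t" and x: "Suc x < d t"
  shows "tp d (Suc x) = tp d x \<or> tp d (Suc x) = Suc (tp d x)"
proof -
  note um = ul_um[OF ul]
  have x': "x < d t" using x by auto
  have "tp d (Suc x) \<le> Suc (tp d x)"
  proof (cases "tp d x < t")
    case True
    have "x < d (tp d x)" using um_column[OF um x'] by auto
    then have "Suc x < d (Suc (tp d x))" using ul True by (fastforce simp: ul_def)
    then show ?thesis using um_column(1)[OF um x] by auto
  next
    case False
    then have "tp d x = t" using um_column(2)[OF um x'] by auto
    then show ?thesis using um_column(2)[OF um x] by auto
  qed
  then show ?thesis using tp_mono[OF um x] by auto
qed

lemma ul_tp_0: "ul d t \<Longrightarrow> 0 < d t \<Longrightarrow> tp d 0 = 0"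
  using um_column(1)[OF ul_um, of d t 0 0] by (auto simp: ul_def)

lemma ul_unique:
  assumes ul: "ul d t" "ul d' t'" and s: "samec c d c' d'"
  shows "d = d'" and "0 < d t \<Longrightarrow> c = c'"
proof -
  note um = ul(1)[THEN ul_um] ul(2)[THEN ul_um]
  note w = samec_width[OF s um]
  show c: "c = c'" if "0 < d t"
  proof -
    have "0 < d' t'" using w that by simp
    then show ?thesis using samec_top[OF s um that] ul_tp_0[OF ul(1) that] ul_tp_0[OF ul(2)]
      by (simp only: of_nat_0 add_0_right)
  qed
  have "tp d x = tp d' x" if "x < d t" for x using that
  proof (induction x)
    case 0 then show ?case using ul_tp_0[OF ul(1)] ul_tp_0[OF ul(2)] w by auto
  next
    case (Suc x)
    have "even (tp d (Suc x)) = even (tp d' (Suc x))"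
    proof -
      have "c = c'" using c Suc.prems by auto
      with samec_top[OF s um Suc.prems] have "(of_nat (tp d (Suc x)) :: bit) = of_nat (tp d' (Suc x))"
        by (simp only: add_left_cancel)
      then show ?thesis by (simp only: of_nat_bit_eq_iff)
    qed
    moreover have "tp d x = tp d' x" using Suc by auto
    ultimately show ?case
      using ul_tp_step[OF ul(1) Suc.prems] ul_tp_step[OF ul(2), of x] Suc.prems w by auto
  qed
  moreover have "hg d x = hg d' x" for x using s by (auto simp: samec_def)
  ultimately have "x < d r \<longleftrightarrow> x < d' r" for x r
    using um_column(1,4)[OF um(1), of x] um_column(1,4)[OF um(2), of x] w
      um_le_peak[OF um(1), of r] um_le_peak[OF um(2), of r]
    by (metis less_le_trans)
  then show "d = d'" by (metis ext linorder_neqE_nat less_irrefl)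
qed

text \<open>
  A column of an upper ledge diagram starts in the same row as the column to its left or one
  row below, and the colours decide which; columns of equal length in a unimodal arrangement
  start in the same row.
\<close>

lemma ul_exists:
  assumes um: "um d t"
  obtains c' d' t' where "ul d' t'" "samec c d c' d'"
proof (cases "d t = 0")
  case True
  then have "d = (\<lambda>_. 0)" using um_le_peak[OF um] by auto
  then show thesis using that[of d 0 c] by (auto simp: ul_def samec_def)
next
  case False
  define w where "w = d t"
  define p where "p = rec_nat 0 (\<lambda>x q. if even (tp d x) = even (tp d (Suc x)) then q else Suc q)"
  have p0: "p 0 = 0" and pS: "\<And>x. p (Suc x) = (if even (tp d x) = even (tp d (Suc x)) then p x else Suc (p x))"
    by (simp_all add: p_def)
  have par: "even (tp d 0 + p x) = even (tp d x)" for x by (induction x) (auto simp: p0 pS)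
  have hstep: "p (Suc x) + hg d (Suc x) \<le> p x + hg d x" if "Suc x < w" for x
  proof -
    note f = um_column(4)[OF um, of x] um_column(4)[OF um, of "Suc x"]
    have "tp d x \<le> tp d (Suc x)" "ft d (Suc x) \<le> ft d x"
      using tp_mono[OF um] ft_antimono[OF um] that w_def by auto
    moreover have "ft d x = tp d x + hg d x" "ft d (Suc x) = tp d (Suc x) + hg d (Suc x)"
      using f that w_def by auto
    moreover have "tp d x \<noteq> tp d (Suc x)" if "even (tp d x) \<noteq> even (tp d (Suc x))" using that by metis
    ultimately show ?thesis unfolding pS by (cases "even (tp d x) = even (tp d (Suc x))") auto
  qed
  have pm: "p x \<le> p y" if "x \<le> y" for x y using that
    by (induction y rule: dec_induct) (auto simp: pS)
  have bm: "p y + hg d y \<le> p x + hg d x" if "x \<le> y" "y < w" for x y using that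
    by (induction y rule: dec_induct) (auto intro: order.trans[OF hstep])
  have hp: "0 < hg d x \<longleftrightarrow> x < w" for x using hg_pos[OF um] w_def by auto
  define d' where "d' r = card {x. x < w \<and> p x \<le> r \<and> r < p x + hg d x}" for r
  have mem: "x < d' r \<longleftrightarrow> x < w \<and> p x \<le> r \<and> r < p x + hg d x" for x r
  proof -
    let ?S = "{x. x < w \<and> p x \<le> r \<and> r < p x + hg d x}"
    have down: "y \<in> ?S" if "x \<in> ?S" "y \<le> x" for x y using that pm[of y x] bm[of y x] by auto
    have "?S = {..<d' r}"
    proof (cases "?S = {}")
      case True then show ?thesis unfolding d'_def True by simp
    next
      case False
      define m where "m = Max ?S"
      have fin: "finite ?S" by auto
      have m: "m \<in> ?S" unfolding m_def by (rule Max_in[OF fin False])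
      have S: "?S = {..m}"
      proof (intro equalityI subsetI)
        fix y assume "y \<in> ?S" then show "y \<in> {..m}" using Max_ge[OF fin] by (auto simp: m_def)
      next
        fix y assume "y \<in> {..m}" then show "y \<in> ?S" using down[OF m, of y] by auto
      qed
      have "d' r = Suc m" unfolding d'_def S by simp
      then show ?thesis unfolding S by (simp only: lessThan_Suc_atMost)
    qed
    then show ?thesis by auto
  qed
  have rowset: "{r. x < d' r} = {p x..<p x + hg d x}" if "x < w" for x using that mem by auto
  have hg': "hg d' x = hg d x" for x
  proof (cases "x < w")
    case True then show ?thesis using rowset by (simp add: hg_def[of d'])
  next
    case False
    then have "{r. x < d' r} = {}" using mem by auto
    then show ?thesis using hp[of x] False by (simp add: hg_def[of d'])
  qed
  have w0: "w > 0" using False w_def by auto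
  have ul: "ul d' (p (w - 1))"
    unfolding ul_def
  proof (intro conjI allI impI)
    fix r assume r: "r < p (w - 1)"
    have "\<exists>x. x < w \<and> r < p x" using r w0 by (intro exI[of _ "w - 1"]) auto
    define y where "y = (LEAST x. r < p x)"
    have y: "r < p y" unfolding y_def by (rule LeastI[of _ "w - 1"]) (rule r)
    have yw: "y \<le> w - 1" unfolding y_def by (rule Least_le) (rule r)
    then obtain x where x: "y = Suc x" using y p0 by (cases y) auto
    have "p x \<le> r" using not_less_Least[of x "\<lambda>x. r < p x"] x unfolding y_def by auto
    then have px: "p (Suc x) = Suc r" using y unfolding x pS by (auto split: if_splits)
    have "Suc x < w" using yw x w0 by auto
    then have "Suc x < d' (Suc r)" unfolding mem using px hp[of "Suc x"] by auto
    moreover have "\<not> Suc x < d' r" unfolding mem using px by auto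
    ultimately show "d' r < d' (Suc r)" by auto
  next
    fix r assume r: "p (w - 1) \<le> r"
    have "x < d' r" if "x < d' (Suc r)" for x
    proof -
      have "x \<le> w - 1" using that unfolding mem by auto
      then show ?thesis using that r pm[of x "w - 1"] unfolding mem by auto
    qed
    then show "d' (Suc r) \<le> d' r" by (meson not_le order_refl)
  next
    have "d' r = 0" if "p 0 + hg d 0 \<le> r" for r
    proof -
      have "\<not> 0 < d' r" unfolding mem using that by auto
      then show ?thesis by auto
    qed
    then show "\<exists>n. \<forall>r\<ge>n. d' r = 0" by blast
  next
    have "0 < d' 0" unfolding mem using w0 hp[of 0] p0 by auto
    then show "p (w - 1) = 0 \<or> 0 < d' 0" by auto
  qed
  have wd: "d' (p (w - 1)) = w"
  proof -
    have "x < d' (p (w - 1)) \<longleftrightarrow> x < w" for x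
      using hg_pos[OF ul_um[OF ul], of x] hp[of x] hg'[of x] by auto
    then show ?thesis by (metis linorder_neqE_nat less_irrefl)
  qed
  have tp': "tp d' x = p x" if "x < w" for x
    using um_column[OF ul_um[OF ul], of x] that wd rowset[OF that] hp[of x] hg'[of x]
    by (metis (no_types, lifting) le_add1 le_antisym less_add_same_cancel1 mem order_refl)
  show thesis
  proof (rule that[OF ul])
    show "samec c d (c + of_nat (tp d 0)) d'"
      unfolding samec_def hg'
    proof (intro allI conjI impI)
      fix x assume "0 < hg d x"
      then have x: "x < w" using hp by auto
      have "ft d x = tp d x + hg d x" "ft d' x = p x + hg d x"
        using um_column(4)[OF um, of x] um_column(4)[OF ul_um[OF ul], of x] x w_def wd tp' hg' by auto
      then have "even (ft d x) = even (tp d 0 + ft d' x)" using par[of x] by auto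
      then have "(of_nat (ft d x) :: bit) = of_nat (tp d 0 + ft d' x)" unfolding of_nat_bit_eq_iff .
      then show "fc c d x = fc (c + of_nat (tp d 0)) d' x" by (simp only: fc_def of_nat_add add.assoc)
    qed auto
  qed
qed

section \<open>Upper ledge diagrams as row functions\<close>

definition box :: "bit \<Rightarrow> (nat \<Rightarrow> nat) \<Rightarrow> cell set" where
  "box c d = {(int r, x, c + of_nat r) | r x. x < d r}"

definition nr :: "(nat \<Rightarrow> nat) \<Rightarrow> nat" where
  "nr d = (LEAST n. d n = 0)"

definition dg :: "bit \<Rightarrow> (nat \<Rightarrow> nat) \<Rightarrow> diagram" where
  "dg c d = map (\<lambda>r. (d r, c + of_nat r)) [0..<nr d]"

lemma box_iff: "(\<rho>, x, k) \<in> box c d \<longleftrightarrow> (\<exists>r. \<rho> = int r \<and> k = c + of_nat r \<and> x < d r)"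
  by (auto simp: box_def)

lemma box_mem: "(\<rho>, x, k) \<in> box c d \<longleftrightarrow> 0 \<le> \<rho> \<and> k = c + of_nat (nat \<rho>) \<and> x < d (nat \<rho>)"
  unfolding box_iff by (metis nat_int nat_0_le of_nat_0_le_iff)

lemma ul_strict: "ul d t \<Longrightarrow> r < s \<Longrightarrow> s \<le> t \<Longrightarrow> d r < d s"
proof (induction s)
  case (Suc s)
  then show ?case by (cases "r = s") (auto simp: ul_def intro: less_trans)
qed auto

lemma ul_zero: "ul d t \<Longrightarrow> d 0 = 0 \<Longrightarrow> d r = 0"
  using ul_um[of d t] um_le_peak[of d t r] by (auto simp: ul_def)

lemma ul_peak_pos: "ul d t \<Longrightarrow> 0 < d t \<longleftrightarrow> 0 < d 0"
  using ul_zero[of d t t] um_le_peak[OF ul_um, of d t 0] by (metis less_le_trans not_gr0)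

lemma ul_support:
  assumes ul: "ul d t"
  shows "0 < d r \<longleftrightarrow> r < nr d"
proof (cases "0 < d t")
  case False
  then have "d s = 0" for s using um_le_peak[OF ul_um[OF ul], of s] by auto
  then show ?thesis by (simp add: nr_def)
next
  case True
  note c = um_column(1)[OF ul_um[OF ul] True] ul_tp_0[OF ul True]
  have "nr d = ft d 0" unfolding nr_def
  proof (rule Least_equality)
    show "d (ft d 0) = 0" using c(1)[of "ft d 0"] by simp
    show "ft d 0 \<le> y" if "d y = 0" for y using c(1)[of y] c(2) that by simp
  qed
  then show ?thesis using c by auto
qed

lemma nr_0 [simp]: "d 0 = 0 \<Longrightarrow> nr d = 0"
  by (simp add: nr_def)

lemma dg_zero: "d 0 = 0 \<Longrightarrow> dg c d = []"
  by (simp add: dg_def)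

lemma dg_Nil_iff: "ul d t \<Longrightarrow> dg c d = [] \<longleftrightarrow> d 0 = 0"
  using ul_support[of d t 0] by (auto simp: dg_def)

lemma cells_dg: "ul d t \<Longrightarrow> cells (dg c d) = box c d"
proof -
  assume "ul d t"
  then have "r < nr d" if "x < d r" for r x using ul_support[of d t r] that by auto
  then show ?thesis unfolding cells_def box_def dg_def by auto
qed

lemma dg_UL:
  assumes ul: "ul d t"
  shows "dg c d \<in> UL"
proof -
  have "sorted_wrt (<) (take (Suc t) (map d [0..<nr d]))"
    unfolding sorted_wrt_iff_nth_less using ul_strict[OF ul] by auto
  moreover have "sorted_wrt (\<ge>) (drop t (map d [0..<nr d]))"
    unfolding sorted_wrt_iff_nth_less using um_antimono[OF ul_um[OF ul]] by auto
  moreover have "map fst (dg c d) = map d [0..<nr d]" by (simp add: dg_def)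
  moreover have "alternating (dg c d)" unfolding alternating_def
  proof (intro allI impI)
    fix r assume "Suc r < length (dg c d)"
    then have "snd (dg c d ! r) = c + of_nat r" "snd (dg c d ! Suc r) = c + of_nat r + 1"
      by (simp_all add: dg_def del: upt_Suc bit_add_self add: algebra_simps)
    then show "snd (dg c d ! r) \<noteq> snd (dg c d ! Suc r)" by (metis bit_neq_iff)
  qed
  moreover have "\<forall>x \<in> set (dg c d). 0 < fst x" using ul_support[OF ul] by (auto simp: dg_def)
  ultimately show ?thesis unfolding UL_def by auto
qed

lemma UL_dg:
  assumes D: "D \<in> UL"
  obtains c d t where "ul d t" "D = dg c d"
proof (cases "D = []")
  case True
  then show thesis using that[of "\<lambda>_. 0" 0] by (auto simp: ul_def dg_def nr_def)
next
  case False
  define d where "d r = (if r < length D then fst (D ! r) else 0)" for r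
  define c where "c = snd (hd D)"
  have pos: "0 < d r \<longleftrightarrow> r < length D" for r using D by (auto simp: d_def UL_def)
  obtain t where t: "sorted_wrt (<) (take (Suc t) (map fst D))" "sorted_wrt (\<ge>) (drop t (map fst D))"
    using D by (auto simp: UL_def)
  have inc: "d r < d (Suc r)" if "r < t" "Suc r < length D" for r
    using t(1) that unfolding sorted_wrt_iff_nth_less by (auto simp: d_def)
  have dec: "d (Suc r) \<le> d r" if "t \<le> r" for r
  proof (cases "Suc r < length D")
    case True
    then have "drop t (map fst D) ! (Suc r - t) \<le> drop t (map fst D) ! (r - t)"
      using t(2) that unfolding sorted_wrt_iff_nth_less
      by (elim allE[of _ "r - t"] allE[of _ "Suc r - t"]) auto
    then show ?thesis using True that by (simp add: d_def)
  qed (simp add: d_def)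
  have "ul d (min t (length D - 1))"
    unfolding ul_def
  proof (intro conjI allI impI)
    fix r assume "r < min t (length D - 1)" then show "d r < d (Suc r)" using inc by auto
  next
    fix r assume "min t (length D - 1) \<le> r" then show "d (Suc r) \<le> d r"
      using dec[of r] pos[of "Suc r"] by (cases "t \<le> r") auto
  next
    show "\<exists>n. \<forall>r\<ge>n. d r = 0" by (intro exI[of _ "length D"]) (auto simp: d_def)
  next
    show "min t (length D - 1) = 0 \<or> 0 < d 0" using pos[of 0] False by auto
  qed
  moreover have "D = dg c d"
  proof -
    have "nr d = length D" unfolding nr_def
    proof (rule Least_equality)
      show "d (length D) = 0" using pos[of "length D"] by simp
      show "length D \<le> y" if "d y = 0" for y using pos[of y] that by simp
    qed
    moreover have "snd (D ! r) = c + of_nat r" if "r < length D" for r using that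
    proof (induction r)
      case 0 then show ?case using False by (simp add: c_def hd_conv_nth)
    next
      case (Suc r)
      moreover have "alternating D" using D by (simp add: UL_def)
      ultimately have "snd (D ! Suc r) \<noteq> snd (D ! r)" unfolding alternating_def by fastforce
      then have "snd (D ! Suc r) = snd (D ! r) + 1" unfolding bit_neq_iff .
      then show ?case using Suc by (simp add: algebra_simps)
    qed
    ultimately have l: "length D = length (dg c d)"
      and e: "\<And>r. r < length D \<Longrightarrow> snd (D ! r) = snd (dg c d ! r)"
      by (simp_all add: dg_def)
    have "fst (D ! r) = fst (dg c d ! r)" if "r < length D" for r
    proof -
      have "r < nr d" using that l by (simp add: dg_def)
      then have "fst (dg c d ! r) = d r" by (simp add: dg_def)
      then show ?thesis using that by (simp add: d_def)
    qed
    then have f: "\<And>r. r < length D \<Longrightarrow> D ! r = dg c d ! r"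
      using e by (blast intro: prod_eqI)
    show ?thesis by (rule nth_equalityI[OF l f])
  qed
  ultimately show thesis using that by blast
qed

lemma left_justify_rows:
  fixes S :: "cell set"
  assumes rows: "fst ` S = (\<lambda>r. z + int r) ` {0..<n}"
    and len: "\<And>r. r < n \<Longrightarrow> card {x. \<exists>k. (z + int r, x, k) \<in> S} = d r"
    and col: "\<And>r x k. r < n \<Longrightarrow> (z + int r, x, k) \<in> S \<Longrightarrow> k = q r"
  shows "left_justify S = map (\<lambda>r. (d r, q r)) [0..<n]"
proof -
  have "sorted_list_of_set (set (map (\<lambda>r. z + int r) [0..<n])) = map (\<lambda>r. z + int r) [0..<n]"
    by (intro sorted_list_of_set.idem_if_sorted_distinct)
       (auto simp: distinct_map inj_on_def sorted_wrt_iff_nth_less)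
  then have l: "sorted_list_of_set (fst ` S) = map (\<lambda>r. z + int r) [0..<n]" by (simp add: rows)
  have "(THE k. \<exists>x. (z + int r, x, k) \<in> S) = q r" if "r < n" for r
  proof -
    have "z + int r \<in> fst ` S" using rows that by auto
    then obtain x k where "(z + int r, x, k) \<in> S" by auto
    then show ?thesis using col[OF that] by (intro the_equality) blast+
  qed
  then show ?thesis unfolding left_justify_def l using len by simp
qed

lemma left_justify_shift:
  assumes "\<And>r. 0 < d (r + a) \<longleftrightarrow> r < n" and "\<And>r. r < a \<Longrightarrow> d r = 0"
  shows "left_justify (box c d) = dg (c + of_nat a) (\<lambda>r. d (r + a))"
proof -
  have n: "nr (\<lambda>r. d (r + a)) = n" unfolding nr_def
  proof (rule Least_equality)
    show "d (n + a) = 0" using assms(1)[of n] by simp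
    show "n \<le> y" if "d (y + a) = 0" for y using assms(1)[of y] that by simp
  qed
  have "left_justify (box c d) = map (\<lambda>r. (d (r + a), c + of_nat a + of_nat r)) [0..<n]"
  proof (rule left_justify_rows[of _ "int a"])
    show "fst ` box c d = (\<lambda>r. int a + int r) ` {0..<n}"
    proof (intro equalityI subsetI)
      fix y assume "y \<in> fst ` box c d"
      then obtain r x where y: "y = int r" "x < d r" by (auto simp: box_def)
      then have "a \<le> r" using assms(2)[of r] by (cases "a \<le> r") auto
      moreover from this have "r - a < n" using assms(1)[of "r - a"] y by auto
      ultimately show "y \<in> (\<lambda>r. int a + int r) ` {0..<n}" using y by (intro image_eqI[of _ _ "r - a"]) auto
    next
      fix y assume "y \<in> (\<lambda>r. int a + int r) ` {0..<n}"
      then obtain r where "r < n" "y = int (r + a)" by auto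
      then have "(y, 0, c + of_nat (r + a)) \<in> box c d" using assms(1)[of r] unfolding box_iff by blast
      then show "y \<in> fst ` box c d" by force
    qed
    show "card {x. \<exists>k. (int a + int r, x, k) \<in> box c d} = d (r + a)" for r
    proof -
      have "{x. \<exists>k. (int a + int r, x, k) \<in> box c d} = {..<d (r + a)}"
        by (auto simp: box_mem nat_int_add add.commute)
      then show ?thesis by simp
    qed
    show "k = c + of_nat a + of_nat r" if "(int a + int r, x, k) \<in> box c d" for r x k
    proof -
      obtain s where "int a + int r = int s" "k = c + of_nat s" using \<open>(int a + int r, x, k) \<in> box c d\<close>
        by (auto simp: box_iff)
      moreover from this have "s = a + r" by linarith
      ultimately show ?thesis by (simp only: of_nat_add add.assoc)
    qed
  qed
  then show ?thesis unfolding dg_def n .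
qed

lemma left_justify_box: "ul d t \<Longrightarrow> left_justify (box c d) = dg c d"
  using left_justify_shift[of d 0 "nr d" c] ul_support[of d t] by simp

lemma box_insert: "insert (int r, d r, c + of_nat r) (box c d) = box c (d(r := Suc (d r)))"
proof (rule set_eqI)
  fix u :: cell
  obtain \<rho> x k where u: "u = (\<rho>, x, k)" by (cases u)
  show "u \<in> insert (int r, d r, c + of_nat r) (box c d) \<longleftrightarrow> u \<in> box c (d(r := Suc (d r)))"
    unfolding u insert_iff box_mem prod.inject fun_upd_apply
    by (cases "nat \<rho> = r") (auto simp: less_Suc_eq split: if_splits)
qed

lemma box_remove: "d r = Suc y \<Longrightarrow> box c d - {(int r, y, c + of_nat r)} = box c (d(r := y))"
proof (rule set_eqI)
  assume d: "d r = Suc y"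
  fix u :: cell
  obtain \<rho> x k where u: "u = (\<rho>, x, k)" by (cases u)
  show "u \<in> box c d - {(int r, y, c + of_nat r)} \<longleftrightarrow> u \<in> box c (d(r := y))"
    unfolding u Diff_iff singleton_iff box_mem prod.inject fun_upd_apply
    by (cases "nat \<rho> = r") (auto simp: less_Suc_eq d split: if_splits)
qed

section \<open>The crystal operators on row functions\<close>

lemma bottoms_dg:
  assumes ul: "ul d t"
  shows "bottoms i (dg c d) = (\<lambda>x. (int (ft d x) - 1, x, i)) ` {x. x < d t \<and> fc c d x = i + 1}"
proof -
  note um = ul_um[OF ul]
  have 1: "\<rho> = int (ft d x) - 1 \<and> x < d t \<and> fc c d x = i + 1"
    if p: "(\<rho>, x, i) \<in> box c d" "\<forall>k'. (\<rho> + 1, x, k') \<notin> box c d" for \<rho> x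
  proof -
    obtain r where r: "\<rho> = int r" "i = c + of_nat r" "x < d r" using p(1) unfolding box_iff by blast
    have "nat (int r + 1) = Suc r" by simp
    then have "\<not> x < d (Suc r)" using p(2) r by (simp add: box_mem)
    have x: "x < d t" using r um_le_peak[OF um, of r] by auto
    have "ft d x = Suc r"
      using um_column(1)[OF um x, of r] um_column(1)[OF um x, of "Suc r"] r \<open>\<not> x < d (Suc r)\<close> by linarith
    then show ?thesis using r x by (simp add: fc_def algebra_simps)
  qed
  have 2: "(int (ft d x) - 1, x, i) \<in> box c d \<and> (\<forall>k'. (int (ft d x) - 1 + 1, x, k') \<notin> box c d)"
    if x: "x < d t" and f: "fc c d x = i + 1" for x
  proof -
    note col = um_column(1)[OF um x] um_column(2,3)[OF um x]
    obtain g where g: "ft d x = Suc g" using col(3) by (cases "ft d x") auto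
    have "x < d g" "\<not> x < d (Suc g)"
      using col(1)[of g] col(1)[of "Suc g"] col(2,3) g by linarith+
    moreover have "i = c + of_nat g"
    proof -
      have "i + 1 = c + of_nat g + 1" using f g by (simp add: fc_def add.assoc add.commute add.left_commute)
      then show ?thesis by (simp only: add_right_cancel)
    qed
    moreover have "nat (int g + 1) = Suc g" by simp
    ultimately show ?thesis by (simp add: box_mem g)
  qed
  show ?thesis
  proof (intro equalityI subsetI)
    fix u assume "u \<in> bottoms i (dg c d)"
    then show "u \<in> (\<lambda>x. (int (ft d x) - 1, x, i)) ` {x. x < d t \<and> fc c d x = i + 1}"
      using 1 unfolding bottoms_def cells_dg[OF ul] by auto
  next
    fix u assume "u \<in> (\<lambda>x. (int (ft d x) - 1, x, i)) ` {x. x < d t \<and> fc c d x = i + 1}"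
    then show "u \<in> bottoms i (dg c d)"
      using 2 unfolding bottoms_def cells_dg[OF ul] by auto
  qed
qed

definition cell_col :: "cell \<Rightarrow> nat" where
  "cell_col u = fst (snd u)"

lemma bottoms_bracketing:
  assumes ul: "ul d t"
  shows "bracketing (bottoms i (dg c d)) (bottoms (i + 1) (dg c d)) right_of cell_col"
    and "bracketing.lv (bottoms i (dg c d)) (bottoms (i + 1) (dg c d)) cell_col = clv i c d"
proof -
  note um = ul_um[OF ul]
  show b: "bracketing (bottoms i (dg c d)) (bottoms (i + 1) (dg c d)) right_of cell_col"
  proof
    show "finite (bottoms i (dg c d))" unfolding bottoms_dg[OF ul] by simp
    show "bottoms i (dg c d) \<inter> bottoms (i + 1) (dg c d) = {}" unfolding bottoms_dg[OF ul] by auto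
    have "u = (int (ft d (cell_col u)) - 1, cell_col u, fc c d (cell_col u) + 1)"
      if "u \<in> bottoms j (dg c d)" for u j
      using that unfolding bottoms_dg[OF ul] by (auto simp: cell_col_def add.assoc)
    then show "inj_on cell_col (bottoms i (dg c d) \<union> bottoms (i + 1) (dg c d))"
      unfolding inj_on_def by (metis UnE)
    show "right_of x y = (cell_col y < cell_col x)" for x y
      by (auto simp: right_of_def cell_col_def split: prod.splits)
  qed
  interpret bracketing "bottoms i (dg c d)" "bottoms (i + 1) (dg c d)" right_of cell_col by fact
  have "x \<in> cell_col ` bottoms j (dg c d) \<longleftrightarrow> x < d t \<and> fc c d x = j + 1" for x j
    unfolding bottoms_dg[OF ul] by (simp add: cell_col_def image_image)
  moreover have "i + 1 + 1 = i" by (simp add: add.assoc)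
  ultimately have "stp x = clet i c d x" for x
    unfolding stp_def clet_def using hg_pos[OF um, of x] bit_neq_iff[of "fc c d x" i]
      bit_neq_iff[of "fc c d x" "i + 1"] by auto
  then show "lv = clv i c d" by (simp add: lv_def clv_def fun_eq_iff)
qed

lemma ul_eps_ge: "ul d t \<Longrightarrow> clv i c d C \<le> int (ul_eps i (dg c d))"
  and ul_eps_attained: "ul d t \<Longrightarrow> \<exists>C. clv i c d C = int (ul_eps i (dg c d))"
  using bracketing.lv_le_card[OF bottoms_bracketing(1), of d t i c C]
    bracketing.lv_card[OF bottoms_bracketing(1), of d t i c]
  by (simp_all add: bottoms_bracketing(2) ul_eps_def bottom_arcs_def)

lemma ul_eps_fr:
  assumes "ul d t" "fr i c d t r"
  shows "int (ul_eps i (dg c d)) = clv i c d (d r)"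
proof -
  obtain C where "clv i c d C = int (ul_eps i (dg c d))" using ul_eps_attained[OF assms(1)] by blast
  then show ?thesis
    using ul_eps_ge[OF assms(1), of i c "d r"] clv_le_fr[OF ul_um[OF assms(1)] assms(2), of C] by auto
qed

lemma ul_f_dg:
  assumes ul: "ul d t" and r: "fr i c d t r" and ne: "0 < d 0 \<or> c = i"
  shows "ul_f i (dg c d) = dg c (d(r := Suc (d r)))"
proof (cases "0 < d 0")
  case False
  then have z: "d s = 0" for s using ul_zero[OF ul] by auto
  have t: "t = 0" using False ul by (auto simp: ul_def)
  have "r = 0"
  proof (rule ccontr)
    assume "r \<noteq> 0"
    then have "clv i c d (d 0) < clv i c d (d r)" using r t ne False by (auto simp: fr_def)
    then show False by (simp add: z)
  qed
  moreover have "nr (d(0 := Suc 0)) = 1" unfolding nr_def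
    by (rule Least_equality) (auto simp: z Suc_le_eq intro: Nat.gr0I)
  ultimately show ?thesis using False ne by (simp add: ul_f_def dg_def z)
next
  case True
  note um = ul_um[OF ul]
  interpret bracketing "bottoms i (dg c d)" "bottoms (i + 1) (dg c d)" right_of cell_col
    by (rule bottoms_bracketing[OF ul])
  note lv = bottoms_bracketing(2)[OF ul, of i c]
  define B where "B = bottoms (i + 1) (dg c d) - Field (bottom_arcs i (dg c d))"
  have ne': "dg c d \<noteq> []" using True dg_Nil_iff[OF ul] by auto
  have dt: "0 < d t" using True ul_peak_pos[OF ul] by auto
  have am: "last_argmax (clv i c d) (d t) (d r)" by (rule fr_last_argmax[OF um r])
  have ci: "c + of_nat r = i" using r by (simp add: fr_def)
  obtain t' where ul': "ul (d(r := Suc (d r))) t'" using fr_ul[OF ul r ne] by auto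
  have goal: "left_justify (insert (int r, d r, i) (cells (dg c d))) = dg c (d(r := Suc (d r)))"
    using box_insert[of r d c] left_justify_box[OF ul'] by (simp add: cells_dg[OF ul] ci)
  have "d r < d t \<or> d r = d t" using um_le_peak[OF um, of r] by auto
  then consider "d r < d t" | "d r = d t" by blast
  then show ?thesis
  proof cases
    case 1
    then have s: "t < r" "d r < d (r - 1)" using fr_shape[OF um r] by auto
    then have f: "ft d (d r) = r" using ft_eq[OF um, of "r - 1" "d r"] by auto
    define v where "v = (int r - 1, d r, i + 1)"
    have v: "v \<in> bottoms (i + 1) (dg c d)"
      unfolding bottoms_dg[OF ul] v_def using 1 f ci by (intro image_eqI[of _ _ "d r"]) (auto simp: fc_def add.assoc)
    have "clv i c d m < clv i c d (d r)" if "d r < m" for m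
      using am that 1 clv_beyond[OF um, of m i c] unfolding last_argmax_def
      by (cases "m \<le> d t") auto
    moreover have "clv i c d m \<le> clv i c d (d r)" for m by (rule clv_le_fr[OF um r])
    ultimately have "v \<in> B" "last_in right_of B = v"
      using last_free_cls[OF v] unfolding lv B_def bottom_arcs_def by (auto simp: v_def cell_col_def)
    then show ?thesis using ne' goal unfolding ul_f_def Let_def B_def[symmetric] by (auto simp: v_def)
  next
    case 2
    have "B = {}"
    proof (rule ccontr)
      assume "B \<noteq> {}"
      then obtain v where v: "v \<in> B" by auto
      then have "cell_col v < d t" unfolding B_def bottoms_dg[OF ul] by (auto simp: cell_col_def)
      moreover from this v have "clv i c d (d t) < clv i c d (cell_col v)"
        unfolding B_def bottom_arcs_def free_cls lv by auto
      ultimately show False using am 2 unfolding last_argmax_def by (metis less_imp_le not_less)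
    qed
    moreover have "peak_row_of i (dg c d) = r"
      unfolding peak_row_of_def
    proof (rule Least_equality)
      have rl: "r < nr d" using ul_support[OF ul, of r] 2 dt by auto
      then show "r < length (dg c d) \<and> snd (dg c d ! r) = i \<and>
        (\<forall>r'<length (dg c d). snd (dg c d ! r') = i \<longrightarrow> fst (dg c d ! r') \<le> fst (dg c d ! r))"
        using um_le_peak[OF um] 2 ci by (auto simp: dg_def)
      fix y assume y: "y < length (dg c d) \<and> snd (dg c d ! y) = i \<and>
        (\<forall>r'<length (dg c d). snd (dg c d ! r') = i \<longrightarrow> fst (dg c d ! r') \<le> fst (dg c d ! y))"
      then have y': "c + of_nat y = i" "d r \<le> d y" using rl ci by (auto simp: dg_def)
      then have "t \<le> y" using ul_strict[OF ul, of y t] 2 by force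
      moreover have "r = t \<or> r = Suc t" using fr_shape[OF um r] 2 um_le_peak[OF um, of "r - 1"] by auto
      moreover have "y \<noteq> t" if "r = Suc t"
      proof
        assume "y = t"
        then have "i + 1 = i" using ci y' that by (metis add.assoc add.commute of_nat_Suc)
        then show False by (cases i) simp_all
      qed
      ultimately show "r \<le> y" by auto
    qed
    ultimately show ?thesis using ne' goal ul_support[OF ul, of r] 2 dt unfolding ul_f_def Let_def B_def[symmetric]
      by (auto simp: dg_def)
  qed
qed

lemma last_argmaxI:
  assumes "C \<le> w" "\<And>m. m \<le> C \<Longrightarrow> f m \<le> f C" "\<And>m. m \<le> w \<Longrightarrow> C < m \<Longrightarrow> f m < f C"
  shows "last_argmax f w C"
  using assms unfolding last_argmax_def by (metis le_less not_le)

lemma samec_bump: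
  assumes um: "um d t" and r: "t \<le> r" "t \<le> s" "d r = d s" and col: "c + of_nat r = c + of_nat s"
  shows "samec c (d(r := Suc (d r))) c (d(s := Suc (d s)))"
  unfolding samec_def
proof (intro allI conjI impI)
  fix x
  show "hg (d(r := Suc (d r))) x = hg (d(s := Suc (d s))) x"
    unfolding hg_add[OF um] using r by simp
  show "fc c (d(r := Suc (d r))) x = fc c (d(s := Suc (d s))) x"
  proof (cases "x = d r")
    case True
    then have "ft (d(r := Suc (d r))) x = Suc r" "ft (d(s := Suc (d s))) x = Suc s"
      using ft_add_same[OF um r(1)] ft_add_same[OF um r(2)] r(3) by auto
    then show ?thesis using col by (simp add: fc_def add.left_commute[of c])
  next
    case False
    then show ?thesis using ft_add_other[of x d r] ft_add_other[of x d s] r by (simp add: fc_def)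
  qed
qed

lemma ul_e_dg:
  assumes ul: "ul d t" and e: "ul_e i (dg c d) = Some D'"
  obtains b d' t' where "ul d' t'" "D' = dg c d'" "d = d'(b := Suc (d' b))" "c + of_nat b = i"
    "ul_f i (dg c d') = dg c d"
proof -
  note um = ul_um[OF ul]
  interpret bracketing "bottoms i (dg c d)" "bottoms (i + 1) (dg c d)" right_of cell_col
    by (rule bottoms_bracketing[OF ul])
  note lv = bottoms_bracketing(2)[OF ul, of i c]
  define B where "B = bottoms i (dg c d) - Field (bottom_arcs i (dg c d))"
  have B: "B \<noteq> {}" "D' = left_justify (cells (dg c d) - {first_in right_of B})"
    using e unfolding ul_e_def Let_def B_def[symmetric] by (auto split: if_splits)
  obtain u where u: "u \<in> bottoms i (dg c d)" "\<And>m. m \<le> cell_col u \<Longrightarrow> clv i c d m < clv i c d (Suc (cell_col u))"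
    "\<And>m. clv i c d m \<le> clv i c d (Suc (cell_col u))"
    using first_free_opn_exists B(1) unfolding B_def bottom_arcs_def lv by blast
  have first: "first_in right_of B = u"
    using first_free_opn(2)[OF u(1)] u(2,3) unfolding B_def bottom_arcs_def lv by blast
  obtain x where x: "u = (int (ft d x) - 1, x, i)" "x < d t" "fc c d x = i + 1"
    using u(1) unfolding bottoms_dg[OF ul] by auto
  have cx: "cell_col u = x" by (simp add: x cell_col_def)
  note max = u(2,3)[unfolded cx]
  note col = um_column(1)[OF um x(2)] um_column(2,3)[OF um x(2)]
  obtain b where b: "ft d x = Suc b" using col(3) by (cases "ft d x") auto
  have tb: "t \<le> b" using col(3) b by auto
  have cb: "c + of_nat b = i"
  proof -
    have "c + of_nat b + 1 = i + 1" using x(3) b by (simp add: fc_def add.assoc add.commute add.left_commute)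
    then show ?thesis by (simp only: add_right_cancel)
  qed
  have xb: "x < d b" "d (Suc b) \<le> x" using col(1)[of b] col(1)[of "Suc b"] col(2,3) b by linarith+
  have "\<not> Suc x < d b"
  proof
    assume s: "Suc x < d b"
    then have f: "ft d (Suc x) = Suc b" using ft_eq[OF um tb, of "Suc x"] xb by auto
    have "Suc x < d t" using s um_le_peak[OF um, of b] by auto
    then have "clet i c d (Suc x) = 1"
      using f b x(3) hg_pos[OF um, of "Suc x"] by (auto simp: clet_def fc_def)
    then have "clv i c d (Suc (Suc x)) = clv i c d (Suc x) + 1" by (simp add: clv_Suc)
    then show False using max(2)[of "Suc (Suc x)"] by linarith
  qed
  then have db: "d b = Suc x" using xb by auto
  define d' where "d' = d(b := x)"
  have dd: "d = d'(b := Suc (d' b))" using db by (auto simp: d'_def)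
  obtain n where n: "\<forall>r\<ge>n. d r = 0" using um by (auto simp: um_def)
  have fin: "\<exists>n. \<forall>s\<ge>n. d' s = 0" using n xb by (intro exI[of _ n]) (auto simp: d'_def)
  have "\<exists>t'. ul d' t' \<and> t' \<le> b"
  proof (cases "t < b \<or> t = 0 \<or> d (t - 1) < x")
    case True
    have "ul d' t" unfolding ul_def
    proof (intro conjI allI impI)
      fix r assume "r < t"
      moreover from this have "r = t - 1" if "Suc r = b" using that tb by auto
      ultimately show "d' r < d' (Suc r)" using ul True tb by (auto simp: d'_def ul_def)
    next
      fix r assume "t \<le> r"
      then show "d' (Suc r) \<le> d' r" using um_antimono[OF um, of r "Suc r"] xb db by (auto simp: d'_def)
    next
      show "t = 0 \<or> 0 < d' 0" using ul tb by (auto simp: ul_def d'_def)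
    qed (rule fin)
    then show ?thesis using tb by auto
  next
    case False
    then have f: "b = t" "0 < t" "x \<le> d (t - 1)" using tb by auto
    have x': "d (t - 1) = x" using f db ul_strict[OF ul, of "t - 1" t] by auto
    have "ul d' (t - 1)" unfolding ul_def
    proof (intro conjI allI impI)
      fix r assume "r < t - 1"
      then show "d' r < d' (Suc r)" using ul f by (auto simp: d'_def ul_def)
    next
      fix r assume "t - 1 \<le> r"
      then consider "r = t - 1" | "t \<le> r" by linarith
      then show "d' (Suc r) \<le> d' r"
        by cases (use f x' um_antimono[OF um, of r "Suc r"] xb db in \<open>auto simp: d'_def\<close>)
    next
      show "t - 1 = 0 \<or> 0 < d' 0" using ul f by (auto simp: ul_def d'_def)
    qed (rule fin)
    then show ?thesis using f by auto
  qed
  then obtain t' where ul': "ul d' t'" "t' \<le> b" by auto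
  note um' = ul_um[OF ul'(1)]
  have "D' = dg c d'"
    using B(2) box_remove[of d b x c] db left_justify_box[OF ul'(1)]
    by (simp add: first x(1) b cb cells_dg[OF ul] d'_def)
  moreover have "ul_f i (dg c d') = dg c d"
  proof -
    obtain r where r: "fr i c d' t' r" using fr_exists[OF um'] by blast
    have d'b: "d' b = x" by (simp add: d'_def)
    have hgs: "hg d y = hg d' y + (if y = x then 1 else 0)" for y
      using hg_add[OF um', of b y] dd d'b by simp
    have fts: "ft d y = ft d' y" if "y \<noteq> x" for y
      using ft_add_other[of y d' b] dd d'b that by simp
    have let_eq: "clet i c d' y = clet i c d y" if "y \<noteq> x" for y
      using hgs[of y] fts[OF that] that by (simp add: clet_def fc_def)
    have low: "clv i c d' m = clv i c d m" if "m \<le> x" for m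
      using let_eq that unfolding clv_def by (intro sum.cong) auto
    have lx: "clet i c d x = 1"
      using x(3) hg_pos[OF um, of x] x(2) by (simp add: clet_def bit_neq_iff)
    have ne: "0 < d' 0 \<or> c = i"
    proof (cases "b = 0")
      case False
      then show ?thesis using xb ul_peak_pos[OF ul] x(2) by (simp add: d'_def)
    qed (use cb in simp)
    have "last_argmax (clv i c d') (d' t') x"
    proof (rule last_argmaxI)
      show "x \<le> d' t'" using um_le_peak[OF um', of b] d'b by simp
      fix m assume "m \<le> x"
      then show "clv i c d' m \<le> clv i c d' x" using max(1)[of m] low lx by (simp add: clv_Suc)
    next
      fix m assume m: "m \<le> d' t'" "x < m"
      then have xp: "x < d' t'" by auto
      have "ft d' x = b"
      proof -
        have iff: "x < d' r' \<longleftrightarrow> x < d r' \<and> r' \<noteq> b" for r' using xb by (auto simp: d'_def)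
        have t'b: "t' < b" using xp iff[of t'] ul'(2) by auto
        then obtain g where g: "b = Suc g" by (cases b) auto
        have "tp d x \<le> t'" using xp iff[of t'] col(1)[of t'] by auto
        then have "x < d g" using col(1)[of g] b g t'b by auto
        then have "x < d' g" "d' (Suc g) \<le> x" using iff[of g] d'b g by auto
        then show ?thesis using ft_eq[OF um', of g x] t'b g by auto
      qed
      then have "clet i c d' x = - 1" using cb hg_pos[OF um', of x] xp by (simp add: clet_def fc_def)
      moreover have "clv i c d' m - clv i c d' (Suc x) = clv i c d m - clv i c d (Suc x)"
        using Suc_leI[OF m(2)]
      proof (induction m rule: dec_induct)
        case (step n)
        then show ?case using let_eq[of n] by (simp add: clv_Suc)
      qed simp
      ultimately show "clv i c d' m < clv i c d' x"
        using max(2)[of m] low[of x] by (simp add: clv_Suc)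
    qed
    then have dr: "d' r = d' b"
      using fr_last_argmax[OF um' r] last_argmax_unique d'b by metis
    obtain t'' where ul'': "ul (d'(r := Suc (d' r))) t''" using fr_ul[OF ul'(1) r ne] by auto
    have "samec c d c (d'(r := Suc (d' r)))"
      using samec_bump[OF um', of b r c] r ul'(2) dr cb dd by (auto simp: fr_def)
    then have "d = d'(r := Suc (d' r))" using ul_unique(1)[OF ul ul''] by auto
    then show ?thesis using ul_f_dg[OF ul'(1) r ne] by simp
  qed
  ultimately show thesis using that[OF ul'(1)] dd cb by blast
qed

lemma ul_e_None_iff: "ul d t \<Longrightarrow> ul_e i (dg c d) = None \<longleftrightarrow> ul_eps i (dg c d) = 0"
  unfolding ul_e_def ul_eps_def Let_def bottoms_dg by (auto simp: card_eq_0_iff)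

lemma ul_e_exists:
  assumes "ul d t" "0 < d 0"
  obtains i where "ul_e i (dg c d) \<noteq> None"
proof -
  define i where "i = fc c d 0 + 1"
  have "0 < hg d 0" using hg_pos[OF ul_um[OF assms(1)], of 0] ul_peak_pos[OF assms(1)] assms(2) by simp
  moreover have "fc c d 0 \<noteq> i" unfolding bit_neq_iff i_def by (simp add: add.assoc)
  ultimately have "clv i c d (Suc 0) = 1" by (simp add: clv_Suc clet_def)
  then have "ul_eps i (dg c d) \<noteq> 0" using ul_eps_ge[OF assms(1), of i c "Suc 0"] by auto
  then show thesis using that[of i] ul_e_None_iff[OF assms(1)] by simp
qed

section \<open>Floating\<close>

definition col_ht :: "cell set \<Rightarrow> nat \<Rightarrow> nat" where
  "col_ht S x = card {r. \<exists>k. (r, x, k) \<in> S}"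

definition col_foot :: "cell set \<Rightarrow> nat \<Rightarrow> bit set" where
  "col_foot S x = {k + 1 | r k. (r, x, k) \<in> S \<and> (\<forall>k'. (r + 1, x, k') \<notin> S)}"

definition vshift :: "(nat \<Rightarrow> int) \<Rightarrow> cell set \<Rightarrow> cell set" where
  "vshift g S = (\<lambda>(r, x, k). (r + g x, x, k)) ` S"

lemma vshift_mem: "(r, x, k) \<in> vshift g S \<longleftrightarrow> (r - g x, x, k) \<in> S"
  by (force simp: vshift_def)

lemma col_ht_vshift [simp]: "col_ht (vshift g S) x = col_ht S x"
proof -
  have "{r. \<exists>k. (r, x, k) \<in> vshift g S} = (\<lambda>r. r + g x) ` {r. \<exists>k. (r, x, k) \<in> S}"
    by (force simp: vshift_mem)
  then show ?thesis unfolding col_ht_def by (simp add: card_image inj_on_def)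
qed

lemma col_foot_vshift [simp]: "col_foot (vshift g S) x = col_foot S x"
proof -
  have "k \<in> col_foot (vshift g S) x \<longleftrightarrow> k \<in> col_foot S x" for k
    unfolding col_foot_def vshift_mem mem_Collect_eq
  proof (intro iffI; elim exE conjE)
    fix r l assume "k = l + 1" "(r - g x, x, l) \<in> S" "\<forall>k'. (r + 1 - g x, x, k') \<notin> S"
    then show "\<exists>r l. k = l + 1 \<and> (r, x, l) \<in> S \<and> (\<forall>k'. (r + 1, x, k') \<notin> S)"
      by (intro exI[of _ "r - g x"] exI[of _ l]) (simp add: algebra_simps)
  next
    fix r l assume "k = l + 1" "(r, x, l) \<in> S" "\<forall>k'. (r + 1, x, k') \<notin> S"
    then show "\<exists>r l. k = l + 1 \<and> (r - g x, x, l) \<in> S \<and> (\<forall>k'. (r + 1 - g x, x, k') \<notin> S)"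
      by (intro exI[of _ "r + g x"] exI[of _ l]) (simp add: algebra_simps)
  qed
  then show ?thesis by auto
qed

lemma col_ht_box [simp]: "col_ht (box c d) x = hg d x"
proof -
  have "{r. \<exists>k. (r, x, k) \<in> box c d} = int ` {r. x < d r}" by (auto simp: box_iff)
  then show ?thesis by (simp add: col_ht_def hg_def card_image)
qed

lemma col_foot_box:
  assumes um: "um d t"
  shows "col_foot (box c d) x = (if 0 < hg d x then {fc c d x} else {})"
proof (cases "x < d t")
  case False
  then have "\<not> x < d r" for r using um_le_peak[OF um, of r] by auto
  then show ?thesis using False hg_pos[OF um, of x] by (auto simp: col_foot_def box_iff)
next
  case True
  note col = um_column(1)[OF um True] um_column(2,3)[OF um True]
  obtain g where g: "ft d x = Suc g" using col(3) by (cases "ft d x") auto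
  have 1: "x < d g" "\<not> x < d (Suc g)"
    using col(1)[of g] col(1)[of "Suc g"] col(2,3) g by linarith+
  have "(r, x, k) \<in> box c d \<and> (\<forall>k'. (r + 1, x, k') \<notin> box c d) \<longleftrightarrow> r = int g \<and> k = c + of_nat g" for r k
  proof (intro iffI conjI allI; (elim conjE)?)
    assume a: "(r, x, k) \<in> box c d" "\<forall>k'. (r + 1, x, k') \<notin> box c d"
    then obtain s where s: "r = int s" "k = c + of_nat s" "x < d s" unfolding box_iff by blast
    have "nat (int s + 1) = Suc s" by simp
    then have "\<not> x < d (Suc s)" using a(2) s by (simp add: box_mem)
    then have "s = g" using col(1)[of s] col(1)[of "Suc s"] s g by linarith
    then show "r = int g" "k = c + of_nat g" using s by auto
  next
    assume "r = int g" "k = c + of_nat g"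
    then show "(r, x, k) \<in> box c d" using 1 by (simp add: box_mem)
  next
    fix k' assume "r = int g" "k = c + of_nat g"
    moreover have "nat (int g + 1) = Suc g" by simp
    ultimately show "(r + 1, x, k') \<notin> box c d" using 1 by (simp add: box_mem)
  qed
  then have "col_foot (box c d) x = {c + of_nat g + 1}" unfolding col_foot_def by auto
  then show ?thesis using hg_pos[OF um, of x] True g by (simp add: fc_def add.assoc add.commute)
qed

lemma samec_iff_cols:
  assumes "um d t" "um d' t'"
  shows "samec c d c' d' \<longleftrightarrow>
    (\<forall>x. col_ht (box c d) x = col_ht (box c' d') x \<and> col_foot (box c d) x = col_foot (box c' d') x)"
  unfolding samec_def col_ht_box col_foot_box[OF assms(1)] col_foot_box[OF assms(2)]
proof (rule iff_allI)
  fix x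
  show "(hg d x = hg d' x \<and> (0 < hg d x \<longrightarrow> fc c d x = fc c' d' x)) \<longleftrightarrow>
    (hg d x = hg d' x \<and> (if 0 < hg d x then {fc c d x} else {}) = (if 0 < hg d' x then {fc c' d' x} else {}))"
    by (cases "hg d x = hg d' x"; cases "0 < hg d' x") simp_all
qed

lemma finite_cells: "finite (cells D)"
proof (rule finite_subset)
  show "cells D \<subseteq> (\<Union>r<length D. (\<lambda>x. (int r, x, snd (D ! r))) ` {..<fst (D ! r)})"
    by (auto simp: cells_def)
qed auto

lemma box_column:
  assumes um: "um d t" and x: "x < d t"
  shows "(y, x, k) \<in> box c d \<longleftrightarrow>
    (\<exists>j<hg d x. y = int (tp d x) + int j \<and> k = c + of_nat (tp d x) + of_nat j)"
proof
  assume "(y, x, k) \<in> box c d"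
  then obtain r where r: "y = int r" "k = c + of_nat r" "x < d r" unfolding box_iff by blast
  then obtain j where "r = tp d x + j" "j < hg d x"
    using um_column(1,4)[OF um x] by (metis add_less_cancel_left le_Suc_ex)
  then show "\<exists>j<hg d x. y = int (tp d x) + int j \<and> k = c + of_nat (tp d x) + of_nat j"
    using r by (intro exI[of _ j]) (simp add: add.assoc)
next
  assume "\<exists>j<hg d x. y = int (tp d x) + int j \<and> k = c + of_nat (tp d x) + of_nat j"
  then obtain j where j: "j < hg d x" "y = int (tp d x + j)" "k = c + of_nat (tp d x + j)"
    by (auto simp: add.assoc)
  then show "(y, x, k) \<in> box c d" unfolding box_iff
    using um_column(1)[OF um x, of "tp d x + j"] um_column(4)[OF um x]
    by (intro exI[of _ "tp d x + j"]) simp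
qed

lemma samec_box:
  assumes same: "samec c d c' d'" and um: "um d t" "um d' t'" and x: "x < d t"
    and y: "y + int (tp d x) = y' + int (tp d' x)"
  shows "(y', x, k) \<in> box c d \<longleftrightarrow> (y, x, k) \<in> box c' d'"
proof -
  have x': "x < d' t'" using samec_width[OF same um] x by simp
  have "hg d x = hg d' x" using same by (simp add: samec_def)
  then show ?thesis
    unfolding box_column[OF um(1) x] box_column[OF um(2) x'] samec_top[OF same um x] using y
    by (intro ex_cong1 conj_cong refl) auto
qed

lemma float_box:
  assumes um: "um d t" and S: "cells D = vshift (\<lambda>_. z) (box c d)"
    and ul: "ul d' t'" and same: "samec c d c' d'"
  shows "float D = dg c' d'"
proof -
  note um' = ul_um[OF ul]
  define R where "R D' \<longleftrightarrow> D' \<in> UL \<and>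
        (\<exists>(s :: nat \<Rightarrow> int) m. (\<lambda>(r, c, k). (r + m, c, k)) ` cells D' =
                               (\<lambda>(r, c, k). (r + 2 * s c, c, k)) ` cells D)" for D'
  have R: "R D' \<longleftrightarrow> D' \<in> UL \<and> (\<exists>s m. vshift (\<lambda>_. m) (cells D') = vshift (\<lambda>x. 2 * s x) (vshift (\<lambda>_. z) (box c d)))" for D'
    unfolding R_def S[symmetric] by (simp add: vshift_def)
  have "R (dg c' d')"
  proof (cases "d t = 0")
    case True
    then have "\<not> x < d r" "\<not> x < d' r" for x r
      using um_le_peak[OF um, of r] um_le_peak[OF um', of r] samec_width[OF same um um'] by auto
    then have "box c d = {}" "box c' d' = {}" by (auto simp: box_def)
    then show ?thesis unfolding R cells_dg[OF ul] using dg_UL[OF ul] by (simp add: vshift_def)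
  next
    case False
    define m :: int where "m = (if c + c' = of_nat (nat (z mod 2)) then 0 else 1)"
    define s where "s x = (int (tp d' x) + m - (int (tp d x) + z)) div 2" for x
    have s: "int (tp d' x) + m = int (tp d x) + z + 2 * s x" if "x < d t" for x
    proof -
      have "c + of_nat (tp d x) = c' + of_nat (tp d' x)" using samec_top[OF same um um' that] .
      then have "c + c' = of_nat (tp d x + tp d' x)"
        by (metis add.assoc add.commute bit_add_self(2) of_nat_add)
      then have "even (tp d x + tp d' x) \<longleftrightarrow> (c + c' = 0)" by (simp add: of_nat_bit)
      moreover have "(of_nat (nat (z mod 2)) :: bit) = (if even z then 0 else 1)"
        unfolding of_nat_bit by (auto simp: even_nat_iff)
      ultimately have "even (int (tp d' x) + m - (int (tp d x) + z))"
        unfolding m_def by (auto split: if_splits)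
      then show ?thesis unfolding s_def by simp
    qed
    have "vshift (\<lambda>_. m) (box c' d') = vshift (\<lambda>x. 2 * s x) (vshift (\<lambda>_. z) (box c d))"
    proof (rule set_eqI)
      fix u :: cell
      obtain r x k where u: "u = (r, x, k)" by (cases u)
      show "u \<in> vshift (\<lambda>_. m) (box c' d') \<longleftrightarrow> u \<in> vshift (\<lambda>x. 2 * s x) (vshift (\<lambda>_. z) (box c d))"
      proof (cases "x < d t")
        case False
        then have "\<not> x < d y" "\<not> x < d' y" for y
          using um_le_peak[OF um, of y] um_le_peak[OF um', of y] samec_width[OF same um um'] by auto
        then show ?thesis unfolding u vshift_mem box_mem by simp
      next
        case True
        then show ?thesis unfolding u vshift_mem
          by (intro samec_box[OF same um um' True, symmetric]) (use s[OF True] in simp)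
      qed
    qed
    then show ?thesis unfolding R cells_dg[OF ul] using dg_UL[OF ul] by blast
  qed
  moreover have "D' = dg c' d'" if "R D'" for D'
  proof -
    have "D' \<in> UL" using \<open>R D'\<close> unfolding R by (rule conjunct1)
    then obtain e d'' t'' where D': "ul d'' t''" "D' = dg e d''" by (rule UL_dg)
    then obtain s m where eq: "vshift (\<lambda>_. m) (box e d'') = vshift (\<lambda>x. 2 * s x) (vshift (\<lambda>_. z) (box c d))"
      using \<open>R D'\<close> unfolding R by (auto simp: cells_dg[OF D'(1)])
    have "samec e d'' c d"
      unfolding samec_iff_cols[OF ul_um[OF D'(1)] um]
      using arg_cong[OF eq, of col_ht] arg_cong[OF eq, of col_foot] by (simp add: fun_eq_iff)
    then have s: "samec e d'' c' d'" using samec_trans[OF _ same] by blast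
    show ?thesis
    proof (cases "0 < d'' t''")
      case True then show ?thesis using ul_unique[OF D'(1) ul s] D'(2) by simp
    next
      case False
      then have "d'' 0 = 0" using ul_peak_pos[OF D'(1)] by simp
      then show ?thesis using ul_unique(1)[OF D'(1) ul s] D'(2) dg_zero by simp
    qed
  qed
  ultimately have "(THE D'. R D') = dg c' d'" by (rule the_equality)
  then show ?thesis unfolding float_def R_def .
qed

lemma color_Suc_iff: "c + of_nat (Suc r) = i \<longleftrightarrow> c + of_nat r \<noteq> (i :: bit)"
  by (cases c; cases i; simp add: of_nat_bit)

section \<open>Top words\<close>

definition tlet :: "bit \<Rightarrow> bit \<Rightarrow> (nat \<Rightarrow> nat) \<Rightarrow> nat \<Rightarrow> int" where
  "tlet i c d x = (if hg d x = 0 then 0 else sg i (c + of_nat (tp d x)))"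

definition tlv :: "bit \<Rightarrow> bit \<Rightarrow> (nat \<Rightarrow> nat) \<Rightarrow> nat \<Rightarrow> int" where
  "tlv i c d C = (\<Sum>x<C. tlet i c d x)"

lemma tlv_0 [simp]: "tlv i c d 0 = 0" and tlv_Suc: "tlv i c d (Suc C) = tlv i c d C + tlet i c d C"
  by (simp_all add: tlv_def)

lemma tops_dg:
  assumes ul: "ul d t"
  shows "tops i (dg c d) = (\<lambda>x. (int (tp d x), x, i)) ` {x. x < d t \<and> c + of_nat (tp d x) = i}"
proof -
  note um = ul_um[OF ul]
  have key: "(\<rho>, x, k) \<in> box c d \<and> (\<forall>k'. (\<rho> - 1, x, k') \<notin> box c d)
    \<longleftrightarrow> x < d t \<and> \<rho> = int (tp d x) \<and> k = c + of_nat (tp d x)" for \<rho> x k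
  proof (cases "x < d t")
    case False
    then show ?thesis using um_le_peak[OF um] by (auto simp: box_iff dest: less_le_trans)
  next
    case True
    note col = um_column(1)[OF um True] um_column(2,3)[OF um True]
    show ?thesis
    proof (intro iffI conjI allI; (elim conjE)?)
      assume m: "(\<rho>, x, k) \<in> box c d" "\<forall>k'. (\<rho> - 1, x, k') \<notin> box c d"
      then obtain r where r: "\<rho> = int r" "k = c + of_nat r" "x < d r" unfolding box_iff by blast
      have "r = tp d x"
      proof (rule ccontr)
        assume "r \<noteq> tp d x"
        then obtain s where s: "r = Suc s" "tp d x \<le> s" using r col(1)[of r] by (cases r) auto
        then have "(\<rho> - 1, x, c + of_nat s) \<in> box c d" using r col(1)[of s] col(1)[of r] by (simp add: box_mem)
        then show False using m by blast
      qed
      then show "\<rho> = int (tp d x)" "k = c + of_nat (tp d x)" using r by auto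
    next
      assume "\<rho> = int (tp d x)" "k = c + of_nat (tp d x)"
      then show "(\<rho>, x, k) \<in> box c d" using col(1)[of "tp d x"] col(2,3) by (simp add: box_mem)
    next
      fix k' assume "\<rho> = int (tp d x)"
      then show "(\<rho> - 1, x, k') \<notin> box c d" using col(1) by (auto simp: box_iff)
    qed (rule True)
  qed
  have "(\<rho>, x, k) \<in> tops i (dg c d) \<longleftrightarrow> k = i \<and> x < d t \<and> \<rho> = int (tp d x) \<and> k = c + of_nat (tp d x)"
    for \<rho> x k
    using key[of \<rho> x k] unfolding tops_def cells_dg[OF ul] by blast
  then show ?thesis by (auto simp: image_iff)
qed

lemma tops_bracketing:
  assumes ul: "ul d t"
  shows "bracketing (tops i (dg c d)) (tops (i + 1) (dg c d)) right_of cell_col"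
    and "bracketing.lv (tops i (dg c d)) (tops (i + 1) (dg c d)) cell_col = tlv i c d"
proof -
  note um = ul_um[OF ul]
  show "bracketing (tops i (dg c d)) (tops (i + 1) (dg c d)) right_of cell_col"
  proof
    show "finite (tops i (dg c d))" unfolding tops_dg[OF ul] by simp
    show "tops i (dg c d) \<inter> tops (i + 1) (dg c d) = {}" unfolding tops_dg[OF ul] by auto
    have "u = (int (tp d (cell_col u)), cell_col u, c + of_nat (tp d (cell_col u)))"
      if "u \<in> tops j (dg c d)" for u j
      using that unfolding tops_dg[OF ul] by (auto simp: cell_col_def)
    then show "inj_on cell_col (tops i (dg c d) \<union> tops (i + 1) (dg c d))"
      unfolding inj_on_def by (metis UnE)
    show "right_of x y = (cell_col y < cell_col x)" for x y
      by (auto simp: right_of_def cell_col_def split: prod.splits)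
  qed
  then interpret bracketing "tops i (dg c d)" "tops (i + 1) (dg c d)" right_of cell_col .
  have "x \<in> cell_col ` tops j (dg c d) \<longleftrightarrow> x < d t \<and> c + of_nat (tp d x) = j" for x j
    unfolding tops_dg[OF ul] by (simp add: cell_col_def image_image)
  then have "stp x = tlet i c d x" for x
    unfolding stp_def tlet_def sg_def using hg_pos[OF um, of x] bit_neq_iff[of "c + of_nat (tp d x)" i]
    by auto
  then show "lv = tlv i c d" by (simp add: lv_def tlv_def fun_eq_iff)
qed

lemma ul_eps_star_le_iff:
  assumes "ul d t"
  shows "ul_eps_star i (dg c d) \<le> n \<longleftrightarrow> (\<forall>C. tlv i c d C \<le> int n)"
proof -
  have "tlv i c d C \<le> int (ul_eps_star i (dg c d))" for C
    using bracketing.lv_le_card[OF tops_bracketing(1)[OF assms], of i c C]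
    by (simp add: tops_bracketing(2)[OF assms] ul_eps_star_def top_arcs_def)
  moreover obtain C where "tlv i c d C = int (ul_eps_star i (dg c d))"
    using bracketing.lv_card[OF tops_bracketing(1)[OF assms], of i c]
    by (auto simp: tops_bracketing(2)[OF assms] ul_eps_star_def top_arcs_def)
  ultimately show ?thesis by (metis of_nat_le_iff order.trans)
qed

lemma samec_tlv:
  assumes "samec c d c' d'" "um d t" "um d' t'"
  shows "tlv i c d = tlv i c' d'"
proof
  fix C
  have "tlet i c d x = tlet i c' d' x" for x
  proof (cases "x < d t")
    case True
    then show ?thesis using samec_top[OF assms True] assms(1) by (simp add: tlet_def samec_def)
  next
    case False
    then show ?thesis using hg_pos[OF assms(2), of x] assms(1) by (simp add: tlet_def samec_def)
  qed
  then show "tlv i c d C = tlv i c' d' C" by (simp add: tlv_def)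
qed

lemma tlv_segment:
  assumes um: "um d t" and r: "r \<le> t" and C: "(case r of 0 \<Rightarrow> 0 | Suc s \<Rightarrow> d s) \<le> C" "C \<le> d r"
  shows "tlv i c d C = tlv i c d (case r of 0 \<Rightarrow> 0 | Suc s \<Rightarrow> d s) +
    sg i (c + of_nat r) * (int C - int (case r of 0 \<Rightarrow> 0 | Suc s \<Rightarrow> d s))"
  using C
proof (induction C rule: dec_induct)
  case (step C)
  have x: "C < d t" using step um_le_peak[OF um, of r] by auto
  note col = um_column(1)[OF um x] um_column(2)[OF um x]
  have "C < d r" using step by auto
  then have "tp d C \<le> r" using col(1) by auto
  moreover have "\<not> tp d C < r"
  proof
    assume "tp d C < r"
    then obtain s where s: "r = Suc s" "tp d C \<le> s" by (cases r) auto
    then have "C < d s" using col(1)[of s] col(1)[of r] \<open>C < d r\<close> by auto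
    then show False using step s by auto
  qed
  ultimately have "tp d C = r" by auto
  then have "tlet i c d C = sg i (c + of_nat r)" using hg_pos[OF um, of C] x by (simp add: tlet_def)
  then show ?case using step by (simp add: tlv_Suc algebra_simps)
qed auto

lemma tlv_bound_iff:
  assumes um: "um d t"
  shows "(\<forall>C. tlv i c d C \<le> int n) \<longleftrightarrow> (\<forall>r\<le>t. c + of_nat r = i \<longrightarrow> tlv i c d (d r) \<le> int n)"
proof (intro iffI allI)
  fix C assume H: "\<forall>r\<le>t. c + of_nat r = i \<longrightarrow> tlv i c d (d r) \<le> int n"
  have low: "tlv i c d C \<le> int n" if C: "C \<le> d t" for C
  proof (cases "C = 0")
    case False
    define r where "r = (LEAST r. C \<le> d r)"
    have r: "C \<le> d r" "r \<le> t" unfolding r_def using C by (auto intro: LeastI Least_le)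
    have prev: "d s < C" if "r = Suc s" for s
      using not_less_Least[of s "\<lambda>r. C \<le> d r"] that by (auto simp: r_def)
    then have pC: "(case r of 0 \<Rightarrow> 0 | Suc s \<Rightarrow> d s) \<le> C" by (auto split: nat.split intro: less_imp_le)
    note seg = tlv_segment[OF um r(2) pC r(1), of i c]
    show ?thesis
    proof (cases "c + of_nat r = i")
      case True
      have "(case r of 0 \<Rightarrow> 0 | Suc s \<Rightarrow> d s) \<le> d r" using pC r by linarith
      then have "tlv i c d C \<le> tlv i c d (d r)"
        using seg tlv_segment[OF um r(2) _ order_refl, of i c] True r(1) by (simp add: sg_def)
      then show ?thesis using H r True by fastforce
    next
      case False
      then have le: "tlv i c d C \<le> tlv i c d (case r of 0 \<Rightarrow> 0 | Suc s \<Rightarrow> d s)"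
        using seg pC by (simp add: sg_def)
      show ?thesis
      proof (cases r)
        case 0 then show ?thesis using le by simp
      next
        case (Suc s)
        then have "c + of_nat s = i" using False color_Suc_iff by metis
        then show ?thesis using le H[rule_format, of s] r Suc by simp
      qed
    qed
  qed simp
  show "tlv i c d C \<le> int n"
  proof (cases "C \<le> d t")
    case False
    then have "d t \<le> C" by auto
    then have "tlv i c d C = tlv i c d (d t)"
    proof (induction C rule: dec_induct)
      case (step C)
      then show ?case using hg_pos[OF um, of C] by (simp add: tlv_Suc tlet_def)
    qed simp
    then show ?thesis using low[of "d t"] by simp
  qed (rule low)
qed auto

section \<open>Splitting\<close>

lemma left_justify_gen:
  fixes S :: "cell set"
  assumes fin: "finite S" and mem: "\<And>\<rho> x k. (\<rho>, x, k) \<in> S \<Longrightarrow> \<exists>r. \<rho> = z + int r \<and> k = c + of_nat r"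
    and len: "\<And>r. card {x. \<exists>k. (z + int r, x, k) \<in> S} = e r"
    and supp: "\<And>r. 0 < e r \<longleftrightarrow> s \<le> r \<and> r < s + n"
  shows "left_justify S = map (\<lambda>r. (e (r + s), c + of_nat (r + s))) [0..<n]"
proof (rule left_justify_rows[where z = "z + int s"])
  have f: "finite {x. \<exists>k. (\<rho>, x, k) \<in> S}" for \<rho>
    by (rule finite_subset[OF _ finite_imageI[OF fin, of "fst \<circ> snd"]]) force
  have row: "(\<exists>x k. (z + int r, x, k) \<in> S) \<longleftrightarrow> s \<le> r \<and> r < s + n" for r
    using supp[of r] f[of "z + int r"] unfolding len[of r, symmetric] card_gt_0_iff by auto
  show "fst ` S = (\<lambda>r. z + int s + int r) ` {0..<n}"
  proof (intro equalityI subsetI)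
    fix \<rho> assume "\<rho> \<in> fst ` S"
    then obtain x k where m: "(\<rho>, x, k) \<in> S" by auto
    then obtain r where r: "\<rho> = z + int r" using mem by blast
    then have "s \<le> r" "r < s + n" using row[of r] m by blast+
    then show "\<rho> \<in> (\<lambda>r. z + int s + int r) ` {0..<n}" using r by (intro image_eqI[of _ _ "r - s"]) auto
  next
    fix \<rho> assume "\<rho> \<in> (\<lambda>r. z + int s + int r) ` {0..<n}"
    then obtain r where r: "r < n" "\<rho> = z + int (r + s)" by auto
    then obtain x k where "(z + int (r + s), x, k) \<in> S" using row[of "r + s"] by auto
    then show "\<rho> \<in> fst ` S" using r by force
  qed
  show "card {x. \<exists>k. (z + int s + int r, x, k) \<in> S} = e (r + s)" for r
    using len[of "r + s"] by (simp add: add.assoc add.commute add.left_commute)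
  show "k = c + of_nat (r + s)" if p: "(z + int s + int r, x, k) \<in> S" for r x k
  proof -
    obtain r' where "z + int s + int r = z + int r'" "k = c + of_nat r'" using mem[OF p] by blast
    moreover from this have "r' = r + s" by linarith
    ultimately show ?thesis by simp
  qed
qed

lemma cells_shifted_map:
  assumes supp: "\<And>r. 0 < e r \<longleftrightarrow> s \<le> r \<and> r < s + n"
  shows "cells (map (\<lambda>r. (e (r + s), c + of_nat (r + s))) [0..<n]) = vshift (\<lambda>_. - int s) (box c e)"
proof (rule set_eqI)
  fix u :: cell
  obtain \<rho> x k where u: "u = (\<rho>, x, k)" by (cases u)
  have "(\<rho>, x, k) \<in> cells (map (\<lambda>r. (e (r + s), c + of_nat (r + s))) [0..<n]) \<longleftrightarrow>
    (\<exists>r<n. \<rho> = int r \<and> k = c + of_nat (r + s) \<and> x < e (r + s))"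
    unfolding cells_def by auto
  also have "\<dots> \<longleftrightarrow> (\<exists>r. \<rho> + int s = int r \<and> k = c + of_nat r \<and> x < e r)"
  proof
    assume "\<exists>r. \<rho> + int s = int r \<and> k = c + of_nat r \<and> x < e r"
    then obtain r where r: "\<rho> + int s = int r" "k = c + of_nat r" "x < e r" by auto
    then have "s \<le> r" "r < s + n" using supp[of r] by auto
    then show "\<exists>r<n. \<rho> = int r \<and> k = c + of_nat (r + s) \<and> x < e (r + s)"
      using r by (intro exI[of _ "r - s"]) auto
  next
    assume "\<exists>r<n. \<rho> = int r \<and> k = c + of_nat (r + s) \<and> x < e (r + s)"
    then show "\<exists>r. \<rho> + int s = int r \<and> k = c + of_nat r \<and> x < e r" by (metis of_nat_add)
  qed
  finally show "u \<in> cells (map (\<lambda>r. (e (r + s), c + of_nat (r + s))) [0..<n]) \<longleftrightarrow>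
      u \<in> vshift (\<lambda>_. - int s) (box c e)" unfolding u vshift_mem box_iff by simp
qed

lemma um_support:
  assumes "um d t"
  obtains s n where "\<And>r. 0 < d r \<longleftrightarrow> s \<le> r \<and> r < s + n"
proof (cases "0 < d t")
  case True
  then show thesis using that[of "tp d 0" "hg d 0"] um_column(1,4)[OF assms True] by auto
next
  case False
  then show thesis using that[of 0 0] um_le_peak[OF assms] by auto
qed

locale splitting =
  fixes c i0 :: bit and d :: "nat \<Rightarrow> nat" and t :: nat
  assumes ul: "ul d t"
begin

text \<open>
  The ray starts in row \<open>a\<close>; \<open>l\<close> and \<open>u\<close> are the row lengths of the two parts, the upper one
  left-justified but not yet floated, and only the rows \<open>r < N\<close> are long enough to meet the ray.
  For \<open>D = []\<close> or a single row of the other colour, \<open>w = 0\<close> and \<open>u = d\<close>.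
\<close>

definition a :: nat where "a = (if c = i0 then 0 else 1)"
definition l :: "nat \<Rightarrow> nat" where "l r = min (d r) (r + 1 - a)"
definition u :: "nat \<Rightarrow> nat" where "u r = d r - (r + 1 - a)"
definition N :: nat where "N = (LEAST n. d n < n + 1 - a)"
definition w :: nat where "w = N - a"

lemma um: "um d t" using ul_um[OF ul] .

lemma a_le: "a \<le> 1" by (simp add: a_def)

lemma c_a: "c + of_nat a = i0"
  using bit_neq_iff[of i0 c] by (auto simp: a_def)

lemma N_at: "d N < N + 1 - a"
proof -
  obtain n where n: "\<forall>r\<ge>n. d r = 0" using um by (auto simp: um_def)
  then have "d (Suc n) < Suc n + 1 - a" using a_le by auto
  then show ?thesis unfolding N_def by (rule LeastI)
qed

lemma below_N: "r < N \<Longrightarrow> r + 1 - a \<le> d r"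
  using not_less_Least[of r "\<lambda>n. d n < n + 1 - a"] unfolding N_def[symmetric] by auto

lemma a_N: "a \<le> N" using N_at by auto

lemma grow: "r \<le> t \<Longrightarrow> 0 < d 0 \<Longrightarrow> r + 1 \<le> d r"
proof (induction r)
  case (Suc r)
  then have "d r < d (Suc r)" using ul by (auto simp: ul_def)
  then show ?case using Suc by auto
qed auto

lemma t_less_N: "0 < d 0 \<Longrightarrow> t < N"
proof (rule ccontr)
  assume "0 < d 0" "\<not> t < N"
  then show False using grow[of N] N_at by auto
qed

lemma t_le_N: "t \<le> N"
  using t_less_N ul by (cases "0 < d 0") (auto simp: ul_def)

lemma above_N_le: "N \<le> r \<Longrightarrow> d r \<le> w"
  using um_antimono[OF um t_le_N, of r] N_at by (auto simp: w_def)

lemma above_N: "N \<le> r \<Longrightarrow> d r < r + 1 - a"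
  using above_N_le[of r] a_N by (auto simp: w_def)

lemma l_below: "r < N \<Longrightarrow> l r = r + 1 - a" and l_above: "N \<le> r \<Longrightarrow> l r = d r"
  and u_above: "N \<le> r \<Longrightarrow> u r = 0" and u_below: "r < N \<Longrightarrow> int (u r) = int (d r) - int (r + 1 - a)"
  using below_N[of r] above_N[of r] by (auto simp: l_def u_def)

lemma l_plus_u: "l r + u r = d r"
  by (simp add: l_def u_def)

lemma um_u: "um u t"
proof -
  obtain n where n: "\<forall>r\<ge>n. d r = 0" using um by (auto simp: um_def)
  have "u r \<le> u (Suc r)" if "r < t" for r
  proof -
    have "d r < d (Suc r)" using ul that by (auto simp: ul_def)
    then show ?thesis using a_le by (auto simp: u_def)
  qed
  moreover have "u (Suc r) \<le> u r" if "t \<le> r" for r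
    using um_antimono[OF um that, of "Suc r"] by (auto simp: u_def)
  moreover have "\<exists>n. \<forall>r\<ge>n. u r = 0" using n by (intro exI[of _ n]) (auto simp: u_def)
  ultimately show ?thesis by (auto simp: um_def)
qed

lemma um_l: "um l (N - 1)"
proof -
  obtain n where n: "\<forall>r\<ge>n. d r = 0" using um by (auto simp: um_def)
  have "l r \<le> l (Suc r)" if "r < N - 1" for r using l_below[of r] l_below[of "Suc r"] that by auto
  moreover have "l (Suc r) \<le> l r" if r: "N - 1 \<le> r" for r
  proof (cases "N \<le> r")
    case True
    then show ?thesis using l_above um_antimono[OF um, of r "Suc r"] t_le_N by auto
  next
    case False
    then have "Suc r = N" using r by auto
    then show ?thesis using l_above[of N] l_below[of r] above_N_le[of N] by (auto simp: w_def)
  qed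
  moreover have "\<exists>n. \<forall>r\<ge>n. l r = 0" using n by (intro exI[of _ n]) (auto simp: l_def)
  ultimately show ?thesis by (auto simp: um_def)
qed

definition l' :: "nat \<Rightarrow> nat" where "l' r = l (r + a)"

lemma l'_below: "r < w \<Longrightarrow> l' r = Suc r"
  using l_below[of "r + a"] by (auto simp: l'_def w_def)

lemma l'_le: "l' r \<le> w"
  using l_below[of "r + a"] l_above[of "r + a"] above_N_le[of "r + a"] by (cases "r + a < N") (auto simp: l'_def w_def)

lemma ul_l': "ul l' (w - 1)"
  unfolding ul_def
proof (intro conjI allI impI)
  fix r assume "r < w - 1" then show "l' r < l' (Suc r)" using l'_below by auto
next
  fix r assume r: "w - 1 \<le> r"
  show "l' (Suc r) \<le> l' r"
  proof (cases "N - 1 \<le> r + a")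
    case True then show ?thesis using um_antimono[OF um_l, of "r + a" "Suc (r + a)"] by (simp add: l'_def)
  next
    case False then show ?thesis using r by (auto simp: w_def)
  qed
next
  obtain n where n: "\<forall>r\<ge>n. l r = 0" using um_l by (auto simp: um_def)
  then show "\<exists>n. \<forall>r\<ge>n. l' r = 0" by (intro exI[of _ n]) (auto simp: l'_def)
next
  show "w - 1 = 0 \<or> 0 < l' 0" using l'_below[of 0] by (cases "w = 0") auto
qed

lemma w_0: assumes "w = 0" shows "l r = 0" "u r = d r"
proof -
  have "l r = 0"
  proof (cases "r < N")
    case True
    then show ?thesis using assms a_le l_below by (auto simp: w_def)
  next
    case False
    then show ?thesis using assms above_N_le[of r] l_above by auto
  qed
  then show "l r = 0" "u r = d r" using l_plus_u[of r] by auto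
qed

lemma hg_l: "x < w \<Longrightarrow> hg l x = ft d x - (x + a)" and hg_l_pos: "x < w \<Longrightarrow> x + a < ft d x"
  and hg_l_0: "w \<le> x \<Longrightarrow> hg l x = 0" and w_le: "x < w \<Longrightarrow> x < d t"
proof -
  assume x: "x < w"
  have "x + a < N" using x by (auto simp: w_def)
  then have xd: "x < d (x + a)" using below_N by force
  then show xt: "x < d t" using um_le_peak[OF um, of "x + a"] by auto
  note col = um_column(1)[OF um xt]
  have "tp d x \<le> x + a" using xd col by auto
  moreover have "x < l r \<longleftrightarrow> x < d r \<and> x + a \<le> r" for r by (auto simp: l_def)
  ultimately have "{r. x < l r} = {x + a..<ft d x}" using col
    by (intro set_eqI) (metis atLeastLessThan_iff le_trans mem_Collect_eq)
  then show "hg l x = ft d x - (x + a)" by (simp add: hg_def)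
  show "x + a < ft d x" using col xd by auto
next
  assume x: "w \<le> x"
  have "\<not> x < l r" for r
  proof (cases "r < N")
    case True then show ?thesis using x l_below[of r] by (auto simp: w_def)
  next
    case False then show ?thesis using x l_above[of r] above_N_le[of r] by auto
  qed
  then show "hg l x = 0" by (simp add: hg_def)
qed

lemma hg_l_strict: "hg l (Suc x) \<le> hg l x - 1"
proof (cases "Suc x < w")
  case True
  then have "ft d (Suc x) \<le> ft d x" using ft_antimono[OF um w_le] by auto
  then show ?thesis using hg_l[of x] hg_l[of "Suc x"] True by auto
next
  case False then show ?thesis using hg_l_0[of "Suc x"] by auto
qed

subsection \<open>The tensor product rule\<close>

definition T :: "bit \<Rightarrow> int" where
  "T i = clv i c d w - (if i0 + of_nat w = i then 1 else 0)"

lemma color_w: "i0 + of_nat w = c + of_nat N"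
proof -
  have "N = a + w" using a_N by (simp add: w_def)
  then show ?thesis using c_a by (simp add: add.assoc[symmetric])
qed

lemma level_sum:
  assumes r: "t \<le> r" "r < N"
  shows "clv i c d (d r) = T i + (if c + of_nat r = i then 0 else 1) + clv i c u (u r)"
proof -
  have rN: "r \<le> N - 1" using r by auto
  show ?thesis using rN
  proof (induction r rule: inc_induct)
    case base
    have N: "N - 1 < N" "t \<le> N - 1" "Suc (N - 1) = N" using r by auto
    have col: "(c + of_nat N = i) \<longleftrightarrow> c + of_nat (N - 1) \<noteq> i"
      using color_Suc_iff[of c "N - 1" i] N(3) by simp
    have "w \<le> d (N - 1)" using below_N[OF N(1)] N by (auto simp: w_def)
    then have "clv i c d (d (N - 1)) - clv i c d w = sg i (c + of_nat (N - 1)) * (int (d (N - 1)) - int w)"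
      using clv_segment[OF um N(2), of w i c] clv_segment[OF um N(2), of "d (N - 1)" i c] N above_N_le[of N]
      by (simp add: algebra_simps)
    moreover have "clv i c u (u (N - 1)) = sg i (c + of_nat (N - 1)) * (int (d (N - 1)) - int w)"
    proof -
      have "N - 1 + 1 - a = w" using N by (simp add: w_def)
      then have "int (u (N - 1)) = int (d (N - 1)) - int w" using u_below[OF N(1)] by simp
      then show ?thesis using clv_row[OF um_u N(2), of i c] N u_above[of N] by simp
    qed
    ultimately show ?case unfolding T_def color_w using col by auto
  next
    case (step s)
    then have s: "t \<le> s" "s < N" "Suc s < N" using r by auto
    have "(int (d s) - int (d (Suc s))) = (int (u s) - int (u (Suc s))) - 1"
      using u_below[OF s(2)] u_below[OF s(3)] a_le by auto
    moreover have "sg i (c + of_nat (Suc s)) = - sg i (c + of_nat s)"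
      by (simp add: add.left_commute[of c])
    ultimately show ?case
      using clv_row[OF um s(1), of i c] clv_row[OF um_u s(1), of i c] step
        color_Suc_iff[of c s i]
      by (simp add: sg_def algebra_simps split: if_splits)
  qed
qed

lemma fr_unique: "fr i c d t r \<Longrightarrow> fr i c d t r' \<Longrightarrow> r = r'"
  unfolding fr_def by (metis linorder_neqE_nat not_le)

lemma tensor_upper:
  assumes ne: "0 < d 0 \<or> c = i" and r: "fr i c d t r" and s: "fr i c u t s"
    and le: "\<And>C. C \<le> w \<Longrightarrow> clv i c d C \<le> T i + clv i c u (u s)"
  shows "r = s" "r < N" "clv i c d (d r) = T i + clv i c u (u s)"
proof -
  have ci: "c + of_nat s = i" and ts: "t \<le> s" using s by (auto simp: fr_def)
  have sN: "s < N"
  proof (rule ccontr)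
    assume sN: "\<not> s < N"
    then have us: "clv i c u (u s) = 0" using u_above by auto
    have "i0 + of_nat w \<noteq> i" using le[of w] us unfolding T_def by auto
    then have cN: "c + of_nat N \<noteq> i" using color_w by simp
    have N0: "N \<noteq> 0"
    proof
      assume z: "N = 0"
      then have "d 0 = 0" using N_at by auto
      then show False using ne cN z by simp
    qed
    then obtain M where M: "N = Suc M" by (cases N) auto
    have cM: "c + of_nat M = i" using cN color_Suc_iff unfolding M by metis
    have tM: "t \<le> M" using t_less_N ul M by (cases "0 < d 0") (auto simp: ul_def)
    have "clv i c u (u M) = int (u M)"
      using clv_row[OF um_u tM, of i c] u_above[of N] cM M by (simp add: sg_def)
    moreover have "clv i c u (u M) < clv i c u (u s)" using s tM cM sN M by (auto simp: fr_def)
    ultimately show False using us by simp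
  qed
  have Hs: "clv i c d (d s) = T i + clv i c u (u s)" using level_sum[OF ts sN, of i] ci by simp
  have goodrow: "clv i c d (d q) \<le> clv i c d (d s)" if q: "t \<le> q" "c + of_nat q = i" for q
  proof (cases "q < N")
    case True
    then show ?thesis using level_sum[OF q(1) True, of i] q Hs s by (auto simp: fr_def)
  next
    case False
    then show ?thesis using le[of "d q"] above_N_le[of q] Hs by auto
  qed
  have "fr i c d t s" unfolding fr_def
  proof (intro conjI allI impI ts ci)
    fix q assume q: "t \<le> q"
    show "clv i c d (d q) \<le> clv i c d (d s)"
    proof (cases "c + of_nat q = i")
      case False
      then have "c + of_nat (Suc q) = i" using color_Suc_iff by metis
      then show ?thesis using goodrow[of "Suc q"] q clv_next_row[OF um q False] by auto
    qed (use goodrow q in auto)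
  next
    fix q assume q: "t \<le> q \<and> q < s \<and> c + of_nat q = i"
    then have "clv i c u (u q) < clv i c u (u s)" using s by (auto simp: fr_def)
    then show "clv i c d (d q) < clv i c d (d s)" using level_sum[of q i] q sN Hs by auto
  qed
  then show "r = s" using fr_unique[OF r] by auto
  then show "r < N" "clv i c d (d r) = T i + clv i c u (u s)" using sN Hs by auto
qed

lemma tensor_lower:
  assumes r: "fr i c d t r" and s: "fr i c u t s"
    and C: "C \<le> w" "T i + clv i c u (u s) < clv i c d C"
  shows "N \<le> r" "d r \<le> w" "T i + clv i c u (u s) < clv i c d (d r)"
proof -
  show lt: "T i + clv i c u (u s) < clv i c d (d r)" using C clv_le_fr[OF um r, of C] by auto
  show "N \<le> r"
  proof (rule ccontr)
    assume n: "\<not> N \<le> r"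
    have "t \<le> r" "c + of_nat r = i" using r by (auto simp: fr_def)
    moreover from this have "clv i c u (u r) \<le> clv i c u (u s)" using s by (auto simp: fr_def)
    ultimately show False using level_sum[of r i] n lt by auto
  qed
  then show "d r \<le> w" by (rule above_N_le)
qed

subsection \<open>Tops and splitting\<close>

lemma top_levels:
  assumes pos: "0 < d 0" and r: "r \<le> t"
  shows "tlv i c d (d r) = tlv i c u (u r) + (if i = i0 then 1 else 0) - (if c + of_nat r = i then 0 else 1)"
  using r
proof (induction r)
  case 0
  have "0 < N" using t_less_N[OF pos] by auto
  have "tlv i c d (d 0) = sg i c * int (d 0)" using tlv_segment[OF um, of 0 "d 0" i c] by simp
  moreover have "tlv i c u (u 0) = sg i c * int (u 0)" using tlv_segment[OF um_u, of 0 "u 0" i c] by simp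
  moreover have "int (u 0) = int (d 0) - int (1 - a)" using u_below[OF \<open>0 < N\<close>] by simp
  ultimately show ?case using bit_neq_iff[of c i] bit_neq_iff[of c i0] bit_neq_iff[of i i0]
    by (auto simp: a_def sg_def add.assoc algebra_simps)
next
  case (Suc r)
  have rN: "r < N" "Suc r < N" using Suc t_less_N[OF pos] by auto
  have "d r \<le> d (Suc r)" "u r \<le> u (Suc r)" using um um_u Suc by (auto simp: um_def)
  then have "tlv i c d (d (Suc r)) = tlv i c d (d r) + sg i (c + of_nat (Suc r)) * (int (d (Suc r)) - int (d r))"
    "tlv i c u (u (Suc r)) = tlv i c u (u r) + sg i (c + of_nat (Suc r)) * (int (u (Suc r)) - int (u r))"
    using tlv_segment[OF um Suc.prems, of "d (Suc r)" i c] tlv_segment[OF um_u Suc.prems, of "u (Suc r)" i c]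
    by simp_all
  moreover have "int (u (Suc r)) - int (u r) = int (d (Suc r)) - int (d r) - 1"
    using u_below[OF rN(1)] u_below[OF rN(2)] a_le by auto
  moreover have "sg i (c + of_nat (Suc r)) = (if c + of_nat (Suc r) = i then 1 else - 1)"
    by (simp add: sg_def)
  moreover have "c + of_nat (Suc r) = i \<longleftrightarrow> c + of_nat r \<noteq> i"
    by (rule color_Suc_iff)
  ultimately show ?case using Suc by (auto simp: algebra_simps)
qed

lemma top_bound:
  "(\<forall>C. tlv i c d C \<le> int (n + (if i = i0 then 1 else 0))) \<longleftrightarrow> (\<forall>C. tlv i c u C \<le> int n)"
proof (cases "0 < d 0")
  case True
  then show ?thesis unfolding tlv_bound_iff[OF um] tlv_bound_iff[OF um_u]
    using top_levels[OF True, of _ i] by auto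
next
  case False
  then have "d r = 0" "u r = 0" for r using ul_zero[OF ul] l_plus_u[of r] by auto
  then have "hg d x = 0" "hg u x = 0" for x by (simp_all add: hg_def)
  then show ?thesis by (simp add: tlv_def tlet_def)
qed

subsection \<open>The splitting map\<close>

lemma split_dg:
  assumes ul': "ul d' t'" and same: "samec c u c' d'"
  shows "split i0 (dg c d) = (dg i0 l', dg c' d')"
proof -
  define R where "R = {r. (r, 0, i0) \<in> cells (dg c d)}"
  have R: "R = {int r | r. c + of_nat r = i0 \<and> 0 < d r}" by (auto simp: R_def cells_dg[OF ul] box_iff)
  have ca: "c + of_nat r = i0 \<longleftrightarrow> even r = even a" for r
  proof -
    have "c + of_nat r = c + of_nat a \<longleftrightarrow> of_nat r = (of_nat a :: bit)" by (rule add_left_cancel)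
    then show ?thesis by (simp only: c_a of_nat_bit_eq_iff)
  qed
  have mono0: "0 < d r" if "0 < d s" "r \<le> s" for r s
    using that ul_support[OF ul, of r] ul_support[OF ul, of s] by auto
  show ?thesis
  proof (cases "R = {}")
    case True
    have da: "d a = 0" using True ca[of a] unfolding R by auto
    have "w = 0"
    proof (cases "0 < d 0")
      case True
      then have "a \<noteq> 0" using da by (metis less_irrefl)
      then have "a = 1" using a_le by auto
      have "\<not> a < N" using below_N[of a] da by auto
      then show ?thesis by (simp add: w_def)
    next
      case False
      then have "\<not> a < N" using below_N[of a] da by auto
      then show ?thesis by (simp add: w_def)
    qed
    then have z: "\<And>r. l r = 0" "u = d" using w_0 by auto
    have "dg i0 l' = []" using z by (simp add: dg_zero l'_def)
    moreover have "dg c' d' = dg c d"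
    proof -
      have "samec c d c' d'" using same z by simp
      from ul_unique[OF ul ul' this] show ?thesis using dg_zero[of d] ul_peak_pos[OF ul] by (cases "0 < d t") auto
    qed
    ultimately show ?thesis unfolding split_def Let_def R_def[symmetric] using True by simp
  next
    case False
    have al: "a \<le> s" if "even s = even a" for s using that a_le by (cases s; cases a) auto
    obtain s where "even s = even a" "0 < d s" using False unfolding R ca by blast
    then have "0 < d a" using al mono0 by blast
    have "Min R = int a"
    proof (rule Min_eqI)
      show "finite R" unfolding R using um_finite[OF um, of 0] by auto
      show "int a \<in> R" unfolding R ca using \<open>0 < d a\<close> by auto
      show "int a \<le> y" if y: "y \<in> R" for y
      proof -
        obtain s where "y = int s" "even s = even a" using y unfolding R ca by blast
        then show ?thesis using al[of s] by simp
      qed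
    qed
    define L where "L = {(r, x, k) \<in> cells (dg c d). Min R \<le> r - int x}"
    have L: "L = box c l"
    proof (rule set_eqI)
      fix v :: cell
      obtain \<rho> x k where v: "v = (\<rho>, x, k)" by (cases v)
      show "v \<in> L \<longleftrightarrow> v \<in> box c l"
        unfolding v L_def \<open>Min R = int a\<close> cells_dg[OF ul] by (auto simp: box_mem l_def)
    qed
    have "left_justify L = dg i0 l'"
    proof -
      have "0 < l (r + a) \<longleftrightarrow> r < nr l'" for r using ul_support[OF ul_l', of r] by (simp add: l'_def)
      moreover have "l r = 0" if "r < a" for r using that a_le by (auto simp: l_def)
      ultimately show ?thesis unfolding L using left_justify_shift[of l a "nr l'" c] c_a by (simp add: l'_def[abs_def])
    qed
    moreover have "float (left_justify (cells (dg c d) - L)) = dg c' d'"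
    proof -
      obtain s n where supp: "\<And>r. 0 < u r \<longleftrightarrow> s \<le> r \<and> r < s + n" using um_support[OF um_u] by blast
      have m: "(\<rho>, x, k) \<in> cells (dg c d) - L \<longleftrightarrow>
          0 \<le> \<rho> \<and> k = c + of_nat (nat \<rho>) \<and> nat \<rho> + 1 - a \<le> x \<and> x < d (nat \<rho>)" for \<rho> x k
        unfolding Diff_iff L cells_dg[OF ul] box_mem by (auto simp: l_def)
      have "left_justify (cells (dg c d) - L) = map (\<lambda>r. (u (r + s), c + of_nat (r + s))) [0..<n]"
      proof (rule left_justify_gen[where z = 0])
        show "finite (cells (dg c d) - L)"
          by (simp add: finite_cells)
        show "\<exists>r. \<rho> = 0 + int r \<and> k = c + of_nat r" if "(\<rho>, x, k) \<in> cells (dg c d) - L" for \<rho> x k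
          using that unfolding m by (intro exI[of _ "nat \<rho>"]) auto
        show "card {x. \<exists>k. (0 + int r, x, k) \<in> cells (dg c d) - L} = u r" for r
        proof -
          have "{x. \<exists>k. (0 + int r, x, k) \<in> cells (dg c d) - L} = {r + 1 - a..<d r}" unfolding m by auto
          then show ?thesis by (simp add: u_def)
        qed
      qed (rule supp)
      then have "cells (left_justify (cells (dg c d) - L)) = vshift (\<lambda>_. - int s) (box c u)"
        using cells_shifted_map[OF supp] by simp
      then show ?thesis by (rule float_box[OF um_u _ ul' same])
    qed
    ultimately show ?thesis unfolding split_def Let_def R_def[symmetric] L_def[symmetric] using False by simp
  qed
qed

end

lemma even_if_bits:
  assumes "(c :: bit) + of_nat m = c' + of_nat n" "c + of_nat a = i"
  shows "even (int m - int n - int a - (if i = c' then 0 else - 1))"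
  using assms by (cases c; cases c'; cases i; simp add: of_nat_bit split: if_splits)

lemma hd_dg: "ul d t \<Longrightarrow> 0 < d 0 \<Longrightarrow> hd (dg c d) = (d 0, c)"
  using ul_support[of d t 0] by (simp add: dg_def upt_conv_Cons)

lemma col_bottom_dg:
  assumes ul: "ul d t" and x: "x < d t"
  shows "col_bottom (dg c d) x = int (ft d x) - 1"
  unfolding col_bottom_def cells_dg[OF ul]
proof (rule Max_eqI)
  note col = um_column(1)[OF ul_um[OF ul] x] um_column(2,3)[OF ul_um[OF ul] x]
  have e: "{r. \<exists>k. (r, x, k) \<in> box c d} = int ` {r. x < d r}" by (auto simp: box_iff)
  show "finite {r. \<exists>k. (r, x, k) \<in> box c d}" unfolding e using um_finite[OF ul_um[OF ul]] by simp
  show "y \<le> int (ft d x) - 1" if "y \<in> {r. \<exists>k. (r, x, k) \<in> box c d}" for y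
    using that col(1) unfolding e by force
  show "int (ft d x) - 1 \<in> {r. \<exists>k. (r, x, k) \<in> box c d}"
    unfolding e using col(1)[of "ft d x - 1"] col(2,3) by (intro image_eqI[of _ _ "ft d x - 1"]) auto
qed

context splitting
begin

lemma dg_w_0:
  assumes ul': "ul d' t'" and same: "samec c u c' d'" and w: "w = 0"
  shows "dg i0 l' = []" "dg c' d' = dg c d"
proof -
  have z: "\<And>r. l r = 0" "u = d" using w_0[OF w] by auto
  show "dg i0 l' = []" using z by (simp add: dg_zero l'_def)
  have "samec c d c' d'" using same z by simp
  from ul_unique[OF ul ul' this] show "dg c' d' = dg c d"
    using dg_zero[of d] ul_peak_pos[OF ul] by (cases "0 < d t") auto
qed

lemma pos_of_w: "0 < w \<Longrightarrow> 0 < d 0"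
proof (rule ccontr)
  assume "0 < w" "\<not> 0 < d 0"
  then have "a < N" "d a = 0" using ul_zero[OF ul, of a] by (auto simp: w_def)
  then show False using below_N[of a] by simp
qed

lemma u_below_N: "x < u r \<Longrightarrow> r < N"
  using u_above[of r] by (cases "r < N") auto

lemma ft_u_le: "x < u t \<Longrightarrow> ft u x \<le> N"
proof -
  assume x: "x < u t"
  note col = um_column(1)[OF um_u x] um_column(2,3)[OF um_u x]
  have "x < u (ft u x - 1)" using col(1)[of "ft u x - 1"] col(2,3) by linarith
  then show ?thesis using u_below_N by force
qed

lemma ft_u_0: "0 < u t \<Longrightarrow> N \<le> Suc (ft u 0)"
proof (rule ccontr)
  assume x: "0 < u t" and n: "\<not> N \<le> Suc (ft u 0)"
  note col = um_column(1)[OF um_u x] um_column(2,3)[OF um_u x]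
  define g where "g = ft u 0"
  have g: "Suc g < N" "t < g" "u g = 0" using n col(1)[of "ft u 0"] col(3) by (auto simp: g_def)
  have "Suc g + 1 - a \<le> d (Suc g)" "d (Suc g) \<le> d g"
    using below_N[OF g(1)] um_antimono[OF um, of g "Suc g"] g by auto
  then show False using g(3) a_le by (auto simp: u_def)
qed

lemma ft_u_step: "Suc x < u t \<Longrightarrow> ft u x \<le> Suc (ft u (Suc x))"
proof -
  assume x: "Suc x < u t"
  have x': "x < u t" using x by auto
  note col = um_column(1)[OF um_u x'] um_column(2,3)[OF um_u x']
  note col' = um_column(1)[OF um_u x] um_column(2,3)[OF um_u x]
  obtain g where g: "ft u x = Suc g" using col(3) by (cases "ft u x") auto
  have xg: "x < u g" using col(1)[of g] col(2,3) g by linarith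
  show ?thesis
  proof (cases "g = t")
    case True then show ?thesis using col'(3) g by auto
  next
    case False
    then obtain h where h: "g = Suc h" "t \<le> h" using col(3) g by (cases g) auto
    have "Suc x < u h"
      using xg h um_antimono[OF um, of h g] a_le by (auto simp: u_def)
    then show ?thesis using col'(1)[of h] g h by auto
  qed
qed

lemma glue_split:
  assumes ul': "ul d' t'" and same: "samec c u c' d'"
  shows "glue (dg i0 l') (dg c' d') = dg c d"
proof (cases "w = 0")
  case True
  then show ?thesis using dg_w_0[OF assms] by (simp add: glue_def)
next
  case False
  then have w: "0 < w" by auto
  note um' = ul_um[OF ul']
  have d0: "0 < d 0" by (rule pos_of_w[OF w])
  have l0: "0 < l' 0" using l'_below[OF w] by simp
  have D1: "dg i0 l' \<noteq> []" using dg_Nil_iff[OF ul_l'] l0 by simp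
  have width': "d' t' = u t" using samec_width[OF same um_u um'] by simp
  show ?thesis
  proof (cases "d' 0 = 0")
    case True
    then have "u t = 0" using ul_zero[OF ul'] width' by metis
    then have u0: "u r = 0" for r using um_le_peak[OF um_u, of r] by simp
    have az: "a = 0"
    proof (rule ccontr)
      assume "a \<noteq> 0"
      then have "a = 1" using a_le by auto
      then show False using u0[of 0] d0 by (auto simp: u_def)
    qed
    have "l r = d r" for r using l_plus_u[of r] u0[of r] by simp
    then have "l' = d" by (simp add: l'_def[abs_def] az)
    moreover have "c = i0" using c_a az by simp
    ultimately show ?thesis using True dg_zero[of d'] D1 by (simp add: glue_def)
  next
    case False
    then have D2: "dg c' d' \<noteq> []" and d'0: "0 < d' 0" using dg_Nil_iff[OF ul'] by auto
    have ut: "0 < u t" using d'0 ul_peak_pos[OF ul'] width' by auto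
    define D1 where "D1 = dg i0 l'"
    define D2 where "D2 = dg c' d'"
    define off :: int where "off = (if i0 = c' then 0 else - 1)"
    define p :: int where "p = int w - 1"
    define q where "q = col_bottom D1 (w - 1)"
    define b where "b x = col_bottom D2 x + off" for x
    have nz: "l' (w - 1) = w" using l'_below[of "w - 1"] w by simp
    have wn: "w - 1 < nr l'" using ul_support[OF ul_l', of "w - 1"] nz w by simp
    have wd: "width D1 = w" unfolding width_def D1_def
    proof (rule Max_eqI)
      show "w \<in> fst ` set (dg i0 l')" using wn nz by (force simp: dg_def)
      show "y \<le> w" if "y \<in> fst ` set (dg i0 l')" for y using that l'_le by (auto simp: dg_def)
    qed simp
    have pk: "peak_row D1 = w - 1" unfolding peak_row_def wd unfolding D1_def
    proof (rule Least_equality)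
      show "w - 1 < length (dg i0 l') \<and> fst (dg i0 l' ! (w - 1)) = w" using wn nz by (simp add: dg_def)
      show "w - 1 \<le> y" if "y < length (dg i0 l') \<and> fst (dg i0 l' ! y) = w" for y
        using that l'_below[of y] by (cases "y < w") (auto simp: dg_def)
    qed
    have pq: "p \<le> q"
    proof -
      have "col_bottom D1 (w - 1) = int (ft l' (w - 1)) - 1" unfolding D1_def
        by (rule col_bottom_dg[OF ul_l']) (use nz w in simp)
      moreover have "w - 1 < ft l' (w - 1)" using um_column(3)[OF ul_um[OF ul_l'], of "w - 1"] nz w by simp
      ultimately show ?thesis by (simp add: p_def q_def)
    qed
    define e where "e x = int (tp u x) - int (tp d' x) - int a - off" for x
    have ev: "even (e x)" if "x < u t" for x
      unfolding e_def off_def by (rule even_if_bits[OF samec_top[OF same um_u um' that] c_a])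
    have e0: "0 \<le> e x" if "x < u t" for x using that
    proof (induction x)
      case 0
      have t0: "tp d' 0 = 0" by (rule ul_tp_0[OF ul']) (use ut width' in simp)
      show ?case
      proof (cases "a = 0")
        case False
        then have a1: "a = 1" using a_le by auto
        then have "0 < u 0" using d0 by (simp add: u_def)
        then have "tp u 0 = 0" using um_column(1)[OF um_u ut, of 0] by simp
        then have "c = c'" using samec_top[OF same um_u um' ut] t0 by simp
        moreover have "c \<noteq> i0" using a1 by (auto simp: a_def split: if_splits)
        ultimately show ?thesis using a1 \<open>tp u 0 = 0\<close> t0 by (simp add: e_def off_def)
      qed (simp add: e_def off_def t0)
    next
      case (Suc x)
      have "tp d' (Suc x) \<le> Suc (tp d' x)" using ul_tp_step[OF ul', of x] Suc.prems width' by auto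
      moreover have "tp u x \<le> tp u (Suc x)" using tp_mono[OF um_u Suc.prems] .
      ultimately have "-1 \<le> e (Suc x)" using Suc by (simp add: e_def)
      moreover have "e (Suc x) \<noteq> -1" using ev[OF Suc.prems] by auto
      ultimately show ?case by linarith
    qed
    define B where "B x = int (ft u x) - 1 - int a" for x
    have Bb: "B x = b x + e x" if x: "x < u t" for x
    proof -
      have x': "x < d' t'" using x width' by simp
      have "hg u x = hg d' x" using same by (simp add: samec_def)
      then show ?thesis using um_column(4)[OF um_u x] um_column(4)[OF um' x']
        unfolding b_def D2_def col_bottom_dg[OF ul' x'] B_def e_def by simp
    qed
    have Bp: "B x \<le> p" if "x < u t" for x
      using ft_u_le[OF that] a_N by (simp add: B_def p_def w_def)
    have drop: "2 * int (col_drop p q b x) = e x" if "x < u t" for x using that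
    proof (induction x)
      case 0
      define k where "k = nat (e 0 div 2)"
      have k: "2 * int k = e 0" using ev[OF 0] e0[OF 0] by (simp add: k_def)
      have up: "p < B 0 + 2" using ft_u_0[OF 0] a_N by (simp add: B_def p_def w_def)
      show ?case
      proof (cases "b 0 < p")
        case True
        have "(GREATEST k. b 0 + 2 * int k \<le> p \<and> b 0 + 2 * int k \<le> q) = k"
          by (rule Greatest_equality) (use k Bb[OF 0] Bp[OF 0] up pq in auto)
        then show ?thesis using True k by simp
      next
        case False
        then show ?thesis using Bb[OF 0] Bp[OF 0] e0[OF 0] by simp
      qed
    next
      case (Suc x)
      have x: "x < u t" using Suc.prems by auto
      define k where "k = nat (e (Suc x) div 2)"
      have k: "2 * int k = e (Suc x)" using ev[OF Suc.prems] e0[OF Suc.prems] by (simp add: k_def)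
      have prev: "b x + 2 * int (col_drop p q b x) = B x" using Suc.IH[OF x] Bb[OF x] by simp
      have st: "B (Suc x) \<le> B x" "B x < B (Suc x) + 2"
        using ft_antimono[OF um_u Suc.prems] ft_u_step[OF Suc.prems] by (simp_all add: B_def)
      show ?case
      proof (cases "\<exists>c'\<le>Suc x. b c' < p")
        case True
        have "(GREATEST k. b (Suc x) + 2 * int k \<le> p \<and> b (Suc x) + 2 * int k \<le> B x) = k"
          by (rule Greatest_equality) (use k Bb[OF Suc.prems] Bp[OF Suc.prems] st in auto)
        then show ?thesis using True k prev by simp
      next
        case False
        then have "p \<le> b (Suc x)" by (auto simp: not_less)
        moreover have "col_drop p q b (Suc x) = 0" unfolding col_drop.simps using False by (rule if_not_P)
        ultimately show ?thesis using Bb[OF Suc.prems] Bp[OF Suc.prems] e0[OF Suc.prems] by linarith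
      qed
    qed
    define S where "S = cells D1 \<union> (\<lambda>(r, x, k). (r + off + 2 * int (col_drop p q b x), w + x, k)) ` cells D2"
    have S1: "(- int a + int r, x, k) \<in> cells D1 \<longleftrightarrow> x < l r \<and> k = c + of_nat r" for r x k
    proof (cases "a \<le> r")
      case True
      then have "nat (- int a + int r) = r - a" "r = (r - a) + a" by auto
      then have "c + of_nat r = i0 + of_nat (r - a)" using c_a by (metis add.assoc add.commute of_nat_add)
      then show ?thesis using True unfolding D1_def cells_dg[OF ul_l'] box_mem
        by (auto simp: l'_def nat_diff_distrib)
    next
      case False
      then have "l r = 0" using a_le by (auto simp: l_def)
      then show ?thesis using False unfolding D1_def cells_dg[OF ul_l'] box_mem by auto
    qed
    have S2: "(- int a + \<rho>, y, k) \<in> (\<lambda>(r, x, k). (r + off + 2 * int (col_drop p q b x), w + x, k)) ` cells D2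
      \<longleftrightarrow> (\<exists>x. y = w + x \<and> (\<rho>, x, k) \<in> box c u)" for \<rho> y k
    proof -
      have "(- int a + \<rho>, y, k) \<in> (\<lambda>(r, x, k). (r + off + 2 * int (col_drop p q b x), w + x, k)) ` cells D2
        \<longleftrightarrow> (\<exists>x. y = w + x \<and> (- int a + \<rho> - off - 2 * int (col_drop p q b x), x, k) \<in> box c' d')"
        unfolding D2_def cells_dg[OF ul'] by (force simp: image_iff)
      also have "\<dots> \<longleftrightarrow> (\<exists>x. y = w + x \<and> (\<rho>, x, k) \<in> box c u)"
      proof (intro ex_cong1 conj_cong refl)
        fix x
        show "(- int a + \<rho> - off - 2 * int (col_drop p q b x), x, k) \<in> box c' d' \<longleftrightarrow> (\<rho>, x, k) \<in> box c u"
        proof (cases "x < u t")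
          case True
          show ?thesis
            by (rule samec_box[OF same um_u um' True, symmetric]) (use drop[OF True] in \<open>simp add: e_def\<close>)
        next
          case False
          then have "\<not> x < u r" "\<not> x < d' r" for r
            using um_le_peak[OF um_u, of r] um_le_peak[OF um', of r] width' by auto
          then show ?thesis by (simp add: box_mem)
        qed
      qed
      finally show ?thesis .
    qed
    have "left_justify S = map (\<lambda>r. (d (r + 0), c + of_nat (r + 0))) [0..<nr d]"
    proof (rule left_justify_gen[where z = "- int a"])
      show "finite S" unfolding S_def by (simp add: finite_cells)
      show "\<exists>r. \<rho> = - int a + int r \<and> k = c + of_nat r" if m: "(\<rho>, y, k) \<in> S" for \<rho> y k
      proof (cases "(\<rho>, y, k) \<in> cells D1")
        case True
        then have "0 \<le> \<rho>" unfolding D1_def cells_dg[OF ul_l'] box_mem by auto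
        then have "\<rho> = - int a + int (nat \<rho> + a)" by simp
        moreover from this have "k = c + of_nat (nat \<rho> + a)" using S1[of "nat \<rho> + a" y k] True by simp
        ultimately show ?thesis by blast
      next
        case False
        then have "(- int a + (\<rho> + int a), y, k)
          \<in> (\<lambda>(r, x, k). (r + off + 2 * int (col_drop p q b x), w + x, k)) ` cells D2"
          using m by (simp add: S_def)
        then show ?thesis unfolding S2 box_iff by force
      qed
      show "card {y. \<exists>k. (- int a + int r, y, k) \<in> S} = d r" for r
      proof -
        have "{y. \<exists>k. (- int a + int r, y, k) \<in> S} = {..<l r} \<union> (+) w ` {..<u r}"
          unfolding S_def Un_iff S1 S2 by (auto simp: box_mem)
        moreover have "l r \<le> w"
          using l_below[of r] l_above[of r] above_N_le[of r] by (cases "r < N") (auto simp: w_def)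
        then have "{..<l r} \<inter> (+) w ` {..<u r} = {}" by auto
        ultimately show ?thesis using l_plus_u[of r] by (simp add: card_Un_disjoint card_image)
      qed
      show "0 < d r \<longleftrightarrow> 0 \<le> r \<and> r < 0 + nr d" for r using ul_support[OF ul, of r] by simp
    qed
    then have "left_justify S = dg c d" by (simp add: dg_def)
    moreover have "glue D1 D2 = left_justify S"
      using \<open>dg i0 l' \<noteq> []\<close> \<open>dg c' d' \<noteq> []\<close> hd_dg[OF ul_l' l0, of i0] hd_dg[OF ul' d'0, of c']
      unfolding glue_def Let_def wd pk S_def q_def b_def p_def off_def
      using w by (simp add: D1_def[symmetric] D2_def[symmetric] of_nat_diff)
    ultimately show ?thesis by (simp add: D1_def D2_def)
  qed
qed

end

section \<open>Multipartitions with strictly decreasing columns\<close>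

definition mph :: "(nat \<Rightarrow> nat \<Rightarrow> nat) \<Rightarrow> multipartition" where
  "mph h = (\<lambda>t. {(r, x). r < h t x})"

definition inc_col :: "(nat \<Rightarrow> nat \<Rightarrow> nat) \<Rightarrow> nat \<Rightarrow> nat \<Rightarrow> nat \<Rightarrow> nat \<Rightarrow> nat" where
  "inc_col h t x = h(t := (h t)(x := Suc (h t x)))"

text \<open>The signature of column \<open>x\<close>; \<open>q + of_nat (x + g x)\<close> is the residue of the box below it.\<close>

definition mlet :: "bit \<Rightarrow> bit \<Rightarrow> (nat \<Rightarrow> nat) \<Rightarrow> nat \<Rightarrow> int" where
  "mlet i q g x = (if x = 0 \<or> 0 < g (x - 1)
     then (if q + of_nat (x + g x) = i then - 1 else if 0 < g x then 1 else 0) else 0)"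

definition mlv1 :: "bit \<Rightarrow> bit \<Rightarrow> (nat \<Rightarrow> nat) \<Rightarrow> nat \<Rightarrow> int" where
  "mlv1 i q g C = (\<Sum>x<C. mlet i q g x)"

definition mlv :: "nat \<Rightarrow> bit \<Rightarrow> (nat \<Rightarrow> bit) \<Rightarrow> (nat \<Rightarrow> nat \<Rightarrow> nat) \<Rightarrow> nat \<Rightarrow> nat \<Rightarrow> int" where
  "mlv K i \<kappa> h t C = (\<Sum>s<t. mlv1 i (\<kappa> s) (h s) K) + mlv1 i (\<kappa> t) (h t) C"

lemma mlv_Suc:
  "mlv K i \<kappa> h (Suc t) C = mlv1 i (\<kappa> 0) (h 0) K + mlv K i (\<lambda>s. \<kappa> (Suc s)) (\<lambda>s. h (Suc s)) t C"
  by (simp add: mlv_def sum.lessThan_Suc_shift del: sum.lessThan_Suc)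

lemma add_node_mph: "add_node (t, h t x, x) (mph h) = mph (inc_col h t x)"
  unfolding add_node_def mph_def inc_col_def
  by (auto simp: fun_eq_iff less_Suc_eq split: if_splits)

lemma young_heights:
  assumes "\<And>x. g (Suc x) \<le> g x" "\<And>x. K \<le> x \<Longrightarrow> g x = 0"
  shows "young {(r, x). r < g x}"
proof -
  have anti: "g y \<le> g x" if "x \<le> y" for x y using that
    by (induction y rule: dec_induct) (auto intro: order.trans assms)
  have "{(r, x). r < g x} \<subseteq> {..<g 0} \<times> {..<K}"
    using assms(2) anti[of 0] by (force simp: not_less[symmetric] intro: less_le_trans)
  then have "finite {(r, x). r < g x}" using finite_subset by blast
  moreover have "r' < g x'" if "r < g x" "r' \<le> r" "x' \<le> x" for r x r' x'
    using anti[OF that(3)] that by linarith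
  ultimately show ?thesis unfolding young_def by auto
qed

locale heights =
  fixes h :: "nat \<Rightarrow> nat \<Rightarrow> nat" and K M :: nat and \<kappa> :: "nat \<Rightarrow> bit" and i :: bit
  assumes strict: "\<And>t x. h t (Suc x) \<le> h t x - 1"
    and wide: "\<And>t x. K \<le> Suc x \<Longrightarrow> h t x = 0" and deep: "\<And>t x. M \<le> t \<Longrightarrow> h t x = 0"
    and K_pos: "0 < K"
begin

lemma anti: "x \<le> y \<Longrightarrow> h t y \<le> h t x"
proof (induction y rule: dec_induct)
  case (step n)
  then show ?case using strict[of t n] by linarith
qed simp

lemma less: "x < y \<Longrightarrow> y = 0 \<or> 0 < h t (y - 1) \<Longrightarrow> h t y < h t x"
proof -
  assume xy: "x < y" "y = 0 \<or> 0 < h t (y - 1)"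
  then obtain z where z: "y = Suc z" "0 < h t z" "x \<le> z" by (cases y) auto
  then show ?thesis using strict[of t z] anti[of x z t] by auto
qed

lemma mph_MP:
  assumes "\<And>x. g (Suc x) \<le> g x" "\<And>x. K \<le> x \<Longrightarrow> g x = 0"
  shows "(mph h)(t := {(r, x). r < g x}) \<in> MP"
proof -
  have y: "young {(r, x). r < h s x}" for s
    by (rule young_heights[of _ K]) (use strict[of s] wide in \<open>auto intro: order.trans[OF _ diff_le_self]\<close>)
  have "{s. ((mph h)(t := {(r, x). r < g x})) s \<noteq> {}} \<subseteq> insert t {..<M}"
    using deep by (force simp: mph_def not_less[symmetric])
  then have "finite {s. ((mph h)(t := {(r, x). r < g x})) s \<noteq> {}}" using finite_subset by blast
  moreover have "young (((mph h)(t := {(r, x). r < g x})) s)" for s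
    using y[of s] young_heights[of g K, OF assms] by (auto simp: mph_def)
  ultimately show ?thesis unfolding MP_def by blast
qed

lemma removables_mph:
  "removables \<kappa> i (mph h) = {(t, r, x). h t x = Suc r \<and> \<kappa> t + of_nat (x + h t x) \<noteq> i}"
proof -
  have col: "residue \<kappa> (t, r, x) = i \<longleftrightarrow> \<kappa> t + of_nat (x + Suc r) \<noteq> i" for t r x
    using color_Suc_iff[of "\<kappa> t" "x + r" i] by (simp add: residue_def add.assoc[symmetric])
  have "u \<in> nodes (mph h) \<and> del_node u (mph h) \<in> MP \<longleftrightarrow> h t x = Suc r" if u: "u = (t, r, x)" for u t r x
  proof
    assume a: "u \<in> nodes (mph h) \<and> del_node u (mph h) \<in> MP"
    then have rh: "r < h t x" by (simp add: u nodes_def mph_def)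
    have "young (del_node u (mph h) t)" using a by (auto simp: MP_def)
    then have y: "young ({(r, x). r < h t x} - {(r, x)})" by (simp add: u del_node_def mph_def)
    have "\<not> Suc r < h t x"
    proof
      assume "Suc r < h t x"
      then have "(Suc r, x) \<in> {(r, x). r < h t x} - {(r, x)}" by auto
      then have "(r, x) \<in> {(r, x). r < h t x} - {(r, x)}" using y unfolding young_def
        by (metis (no_types, lifting) case_prodD le_refl lessI less_imp_le)
      then show False by auto
    qed
    then show "h t x = Suc r" using rh by auto
  next
    assume a: "h t x = Suc r"
    define g where "g = (h t)(x := r)"
    have "g (Suc y) \<le> g y" for y using strict[of t y] strict[of t x] a by (auto simp: g_def)
    moreover have "g y = 0" if "K \<le> y" for y using wide[of y t] wide[of x t] that a by (auto simp: g_def)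
    ultimately have m: "(mph h)(t := {(r, x). r < g x}) \<in> MP" by (rule mph_MP)
    have "del_node u (mph h) = (mph h)(t := {(r, x). r < g x})"
      unfolding u del_node_def mph_def g_def using a
      by (auto simp: fun_eq_iff less_Suc_eq split: if_splits)
    then show "u \<in> nodes (mph h) \<and> del_node u (mph h) \<in> MP"
      using m a by (simp add: u nodes_def mph_def)
  qed
  then have "(t, r, x) \<in> removables \<kappa> i (mph h) \<longleftrightarrow> h t x = Suc r \<and> residue \<kappa> (t, r, x) = i" for t r x
    unfolding removables_def by blast
  then show ?thesis unfolding col by auto
qed

lemma addables_mph:
  "addables \<kappa> i (mph h) =
    {(t, r, x). r = h t x \<and> (x = 0 \<or> 0 < h t (x - 1)) \<and> \<kappa> t + of_nat (x + h t x) = i}"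
proof -
  have col: "residue \<kappa> (t, r, x) = i \<longleftrightarrow> \<kappa> t + of_nat (x + r) = i" for t r x
    by (simp add: residue_def add.assoc[symmetric])
  have key: "u \<notin> nodes (mph h) \<and> add_node u (mph h) \<in> MP \<longleftrightarrow> r = h t x \<and> (x = 0 \<or> 0 < h t (x - 1))"
    if u: "u = (t, r, x)" for u t r x
  proof
    assume a: "u \<notin> nodes (mph h) \<and> add_node u (mph h) \<in> MP"
    then have rh: "h t x \<le> r" by (simp add: u nodes_def mph_def)
    have "young (add_node u (mph h) t)" using a by (auto simp: MP_def)
    then have y: "young (insert (r, x) {(r, x). r < h t x})" by (simp add: u add_node_def mph_def)
    have closed: "(r', x') \<in> insert (r, x) {(r, x). r < h t x}" if "r' \<le> r" "x' \<le> x" for r' x'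
      using y that unfolding young_def by blast
    have "r = h t x"
    proof (rule ccontr)
      assume "r \<noteq> h t x"
      then show False using closed[of "h t x" x] rh by auto
    qed
    moreover have "x = 0 \<or> 0 < h t (x - 1)" using closed[of r "x - 1"] by (cases x) auto
    ultimately show "r = h t x \<and> (x = 0 \<or> 0 < h t (x - 1))" by simp
  next
    assume a: "r = h t x \<and> (x = 0 \<or> 0 < h t (x - 1))"
    define g where "g = (h t)(x := Suc (h t x))"
    have "g (Suc y) \<le> g y" for y using strict[of t y] less[of y x t] a by (auto simp: g_def)
    moreover have "g y = 0" if "K \<le> y" for y using wide[of y t] wide[of "x - 1" t] that a K_pos
      by (cases x) (auto simp: g_def)
    ultimately have m: "(mph h)(t := {(r, x). r < g x}) \<in> MP" by (rule mph_MP)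
    have "add_node u (mph h) = (mph h)(t := {(r, x). r < g x})"
      unfolding u add_node_def mph_def g_def using a
      by (auto simp: fun_eq_iff less_Suc_eq split: if_splits)
    then show "u \<notin> nodes (mph h) \<and> add_node u (mph h) \<in> MP"
      using m a by (simp add: u nodes_def mph_def)
  qed
  have A: "(t, r, x) \<in> addables \<kappa> i (mph h) \<longleftrightarrow>
      r = h t x \<and> (x = 0 \<or> 0 < h t (x - 1)) \<and> residue \<kappa> (t, r, x) = i" for t r x
    using key[of "(t, r, x)" t r x, OF refl] unfolding addables_def mem_Collect_eq by metis
  show ?thesis
  proof (rule set_eqI)
    fix u :: node
    obtain t r x where u: "u = (t, r, x)" by (cases u)
    show "u \<in> addables \<kappa> i (mph h) \<longleftrightarrow> u \<in> {(t, r, x). r = h t x \<and>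
        (x = 0 \<or> 0 < h t (x - 1)) \<and> \<kappa> t + of_nat (x + h t x) = i}"
      unfolding u A col by (simp only: mem_Collect_eq case_prod_conv cong: conj_cong)
  qed
qed

definition rnk :: "node \<Rightarrow> nat" where
  "rnk u = (case u of (t, r, x) \<Rightarrow> t * K + x)"

lemma rnk_eq_iff: "x < K \<Longrightarrow> x' < K \<Longrightarrow> t * K + x = t' * K + x' \<longleftrightarrow> t = t' \<and> x = x'"
  by (metis add.commute add_right_cancel div_mult_self1 div_less K_pos add_0 less_numeral_extra(3))

lemma letters:
  assumes "u \<in> removables \<kappa> i (mph h) \<union> addables \<kappa> i (mph h)"
  obtains t x where "u = (t, (if \<kappa> t + of_nat (x + h t x) = i then h t x else h t x - 1), x)"
    "x < K" "x = 0 \<or> 0 < h t (x - 1)" "\<kappa> t + of_nat (x + h t x) \<noteq> i \<Longrightarrow> 0 < h t x"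
proof -
  obtain t r x where u: "u = (t, r, x)" by (cases u)
  have "x < K" if "0 < h t x \<or> x = 0 \<or> 0 < h t (x - 1)"
    using that wide[of x t] wide[of "x - 1" t] K_pos by (cases "x < K") (auto simp: not_less)
  moreover have "x = 0 \<or> 0 < h t (x - 1)" if "0 < h t x" using anti[of "x - 1" x t] that by auto
  ultimately show thesis using that[of t x] assms unfolding removables_mph addables_mph u by auto
qed

lemma bracket: "bracketing (removables \<kappa> i (mph h)) (addables \<kappa> i (mph h)) above rnk"
proof
  let ?R = "removables \<kappa> i (mph h)" and ?A = "addables \<kappa> i (mph h)"
  have "?R \<subseteq> (\<lambda>(t, x). (t, h t x - 1, x)) ` ({..<M} \<times> {..<K})"
  proof
    fix u assume "u \<in> ?R"
    then obtain t r x where u: "u = (t, r, x)" "h t x = Suc r" unfolding removables_mph by auto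
    have "t < M" using deep[of t x] u by (cases "t < M") auto
    moreover have "x < K" using wide[of x t] u by (cases "x < K") auto
    ultimately show "u \<in> (\<lambda>(t, x). (t, h t x - 1, x)) ` ({..<M} \<times> {..<K})" using u by force
  qed
  then show "finite ?R" using finite_subset by blast
  show "?R \<inter> ?A = {}" by (auto simp: removables_def addables_def)
  show "inj_on rnk (?R \<union> ?A)"
  proof (rule inj_onI)
    fix u v assume u: "u \<in> ?R \<union> ?A" and v: "v \<in> ?R \<union> ?A" and eq: "rnk u = rnk v"
    from u obtain t x where u': "u = (t, (if \<kappa> t + of_nat (x + h t x) = i then h t x else h t x - 1), x)" "x < K"
      by (rule letters)
    from v obtain s y where v': "v = (s, (if \<kappa> s + of_nat (y + h s y) = i then h s y else h s y - 1), y)" "y < K"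
      by (rule letters)
    have "t = s \<and> x = y" using eq rnk_eq_iff[OF u'(2) v'(2)] by (simp add: rnk_def u'(1) v'(1))
    then show "u = v" using u' v' by simp
  qed
  fix u v assume u: "u \<in> ?R \<union> ?A" and v: "v \<in> ?R \<union> ?A"
  from u obtain t x where u': "u = (t, (if \<kappa> t + of_nat (x + h t x) = i then h t x else h t x - 1), x)" "x < K"
    "x = 0 \<or> 0 < h t (x - 1)" "\<kappa> t + of_nat (x + h t x) \<noteq> i \<Longrightarrow> 0 < h t x" using letters by blast
  from v obtain s y where v': "v = (s, (if \<kappa> s + of_nat (y + h s y) = i then h s y else h s y - 1), y)" "y < K"
    "y = 0 \<or> 0 < h s (y - 1)" "\<kappa> s + of_nat (y + h s y) \<noteq> i \<Longrightarrow> 0 < h s y" using letters by blast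
  have order: "(if \<kappa> t + of_nat (x + h t x) = i then h t x else h t x - 1)
      < (if \<kappa> t + of_nat (y + h t y) = i then h t y else h t y - 1)"
    if lt: "y < x" and x: "x = 0 \<or> 0 < h t (x - 1)" and p: "\<kappa> t + of_nat (x + h t x) \<noteq> i \<Longrightarrow> 0 < h t x" for x y
  proof -
    have l: "h t x < h t y" using less[OF lt x] .
    show ?thesis
    proof (cases "\<kappa> t + of_nat (x + h t x) = i \<and> \<kappa> t + of_nat (y + h t y) \<noteq> i")
      case True
      have "h t y \<noteq> Suc (h t x)"
      proof
        assume e: "h t y = Suc (h t x)"
        have "y = x - 1"
        proof (rule ccontr)
          assume "y \<noteq> x - 1"
          then have "y < x - 1" "0 < h t (x - 1)" using lt x by auto
          moreover from this have "0 < h t (x - 1 - 1)" using anti[of "x - 1 - 1" "x - 1" t] by linarith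
          ultimately have "h t (x - 1) < h t y" using less[of y "x - 1" t] by blast
          moreover have "h t x < h t (x - 1)" using less[of "x - 1" x t] lt x by auto
          ultimately show False using e by auto
        qed
        then have "y + h t y = x + h t x" using e lt by auto
        then show False using True by simp
      qed
      then show ?thesis using l True by auto
    next
      case False
      then show ?thesis using l p by auto
    qed
  qed
  show "above u v \<longleftrightarrow> rnk v < rnk u"
  proof (cases "t = s")
    case True
    then have "above u v \<longleftrightarrow> fst (snd u) < fst (snd v)" "rnk v < rnk u \<longleftrightarrow> y < x"
      by (auto simp: above_def rnk_def u'(1) v'(1))
    moreover have "x = y \<Longrightarrow> fst (snd u) = fst (snd v)" using True u' v' by simp
    moreover have "y < x \<Longrightarrow> fst (snd u) < fst (snd v)" using order[of y x] u' v' unfolding True by simp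
    moreover have "x < y \<Longrightarrow> fst (snd v) < fst (snd u)" using order[of x y] v' u' unfolding True by simp
    ultimately show ?thesis by (metis linorder_neqE_nat not_less_iff_gr_or_eq)
  next
    case False
    have "s * K + y < t * K + x \<longleftrightarrow> s < t"
    proof
      assume "s < t"
      then have "Suc s * K \<le> t * K" by (intro mult_le_mono1) auto
      then show "s * K + y < t * K + x" using v'(2) by auto
    next
      assume l: "s * K + y < t * K + x"
      show "s < t"
      proof (rule ccontr)
        assume "\<not> s < t"
        then have "Suc t * K \<le> s * K" using False by (intro mult_le_mono1) auto
        then show False using u'(2) l by auto
      qed
    qed
    then show ?thesis using False by (simp add: above_def rnk_def u'(1) v'(1))
  qed
qed

sublocale bracketing "removables \<kappa> i (mph h)" "addables \<kappa> i (mph h)" above rnk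
  by (rule bracket)

lemma stp_mlet: "x < K \<Longrightarrow> stp (t * K + x) = mlet i (\<kappa> t) (h t) x"
proof -
  assume x: "x < K"
  have "t * K + x \<in> rnk ` removables \<kappa> i (mph h) \<longleftrightarrow> 0 < h t x \<and> \<kappa> t + of_nat (x + h t x) \<noteq> i"
  proof
    assume "t * K + x \<in> rnk ` removables \<kappa> i (mph h)"
    then obtain u where u: "u \<in> removables \<kappa> i (mph h)" "rnk u = t * K + x" by auto
    obtain s r y where s: "u = (s, r, y)" by (cases u)
    have r: "u = (s, r, y)" "h s y = Suc r" "\<kappa> s + of_nat (y + h s y) \<noteq> i"
      using u(1) unfolding removables_mph s by auto
    then have "y < K" using wide[of y s] by (cases "y < K") auto
    then show "0 < h t x \<and> \<kappa> t + of_nat (x + h t x) \<noteq> i"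
      using u r rnk_eq_iff[OF \<open>y < K\<close> x, of s t] by (auto simp: rnk_def)
  next
    assume "0 < h t x \<and> \<kappa> t + of_nat (x + h t x) \<noteq> i"
    then show "t * K + x \<in> rnk ` removables \<kappa> i (mph h)" unfolding removables_mph
      by (intro image_eqI[of _ _ "(t, h t x - 1, x)"]) (auto simp: rnk_def)
  qed
  moreover have "t * K + x \<in> rnk ` addables \<kappa> i (mph h) \<longleftrightarrow>
      (x = 0 \<or> 0 < h t (x - 1)) \<and> \<kappa> t + of_nat (x + h t x) = i"
  proof
    assume "t * K + x \<in> rnk ` addables \<kappa> i (mph h)"
    then obtain u where u: "u \<in> addables \<kappa> i (mph h)" "rnk u = t * K + x" by auto
    then obtain s y where r: "u = (s, h s y, y)" "y = 0 \<or> 0 < h s (y - 1)" "\<kappa> s + of_nat (y + h s y) = i"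
      unfolding addables_mph by auto
    then have "y < K" using wide[of "y - 1" s] K_pos by (cases "y < K") auto
    then show "(x = 0 \<or> 0 < h t (x - 1)) \<and> \<kappa> t + of_nat (x + h t x) = i"
      using u r rnk_eq_iff[OF \<open>y < K\<close> x, of s t] by (auto simp: rnk_def)
  next
    assume "(x = 0 \<or> 0 < h t (x - 1)) \<and> \<kappa> t + of_nat (x + h t x) = i"
    then show "t * K + x \<in> rnk ` addables \<kappa> i (mph h)" unfolding addables_mph
      by (intro image_eqI[of _ _ "(t, h t x, x)"]) (auto simp: rnk_def)
  qed
  moreover have "x = 0 \<or> 0 < h t (x - 1)" if "0 < h t x" using anti[of "x - 1" x t] that by auto
  ultimately show ?thesis unfolding stp_def mlet_def
    by (cases "\<kappa> t + of_nat (x + h t x) = i"; cases "0 < h t x") simp_all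
qed

lemma lv_mlv: "C \<le> K \<Longrightarrow> lv (t * K + C) = mlv K i \<kappa> h t C"
proof -
  have seg: "lv (t * K + C) = lv (t * K) + mlv1 i (\<kappa> t) (h t) C" if "C \<le> K" for t C using that
  proof (induction C)
    case (Suc C)
    then show ?case using stp_mlet[of C t] by (simp add: lv_Suc mlv1_def)
  qed (simp add: mlv1_def)
  have blocks: "lv (t * K) = (\<Sum>s<t. mlv1 i (\<kappa> s) (h s) K)" for t
  proof (induction t)
    case (Suc t)
    then show ?case using seg[of K t] by (simp add: add.commute)
  qed simp
  assume "C \<le> K"
  then show ?thesis using seg blocks by (simp add: mlv_def)
qed

lemma lv_at: "lv m = mlv K i \<kappa> h (m div K) (m mod K)"
  using lv_mlv[of "m mod K" "m div K"] K_pos by (simp add: mod_less_divisor less_imp_le)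

lemma eps_ge: "C \<le> K \<Longrightarrow> mlv K i \<kappa> h t C \<le> int (card (free_removables \<kappa> i (mph h)))"
  using lv_le_card[of "t * K + C"] lv_mlv[of C t] by (simp add: free_removables_def mp_arcs_def)

lemma eps_attained: "\<exists>t C. C \<le> K \<and> mlv K i \<kappa> h t C = int (card (free_removables \<kappa> i (mph h)))"
proof -
  obtain m where "lv m = int (card (free_removables \<kappa> i (mph h)))"
    using lv_card by (auto simp: free_removables_def mp_arcs_def)
  then show ?thesis using lv_at[of m] K_pos
    by (intro exI[of _ "m div K"] exI[of _ "m mod K"]) (simp add: less_imp_le)
qed

lemma after:
  assumes late: "\<And>s B. B \<le> K \<Longrightarrow> t < s \<or> t = s \<and> C < B \<Longrightarrow> mlv K i \<kappa> h s B < E"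
    and m: "t * K + C < m" and C: "C < K"
  shows "lv m < E"
proof -
  have "t \<le> m div K" using m K_pos by (simp add: less_eq_div_iff_mult_less_eq)
  moreover have "C < m mod K" if "t = m div K"
  proof -
    have "t * K + m mod K = m" using that div_mult_mod_eq[of m K] by simp
    then show ?thesis using m by linarith
  qed
  ultimately show ?thesis using late[of "m mod K" "m div K"] lv_at[of m] K_pos
    by (auto simp: le_less)
qed

lemma mp_f_mph:
  assumes C: "C < K" and letter: "mlet i (\<kappa> t) (h t) C = - 1"
    and max: "\<And>s B. B \<le> K \<Longrightarrow> mlv K i \<kappa> h s B \<le> mlv K i \<kappa> h t C"
    and late: "\<And>s B. B \<le> K \<Longrightarrow> t < s \<or> t = s \<and> C < B \<Longrightarrow> mlv K i \<kappa> h s B < mlv K i \<kappa> h t C"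
  shows "mp_f \<kappa> i (mph h) = mph (inc_col h t C)"
proof -
  define v where "v = (t, h t C, C)"
  have v: "v \<in> addables \<kappa> i (mph h)" using letter unfolding addables_mph v_def mlet_def by (auto split: if_splits)
  have rv: "rnk v = t * K + C" by (simp add: v_def rnk_def)
  have lvv: "lv (rnk v) = mlv K i \<kappa> h t C" unfolding rv using lv_mlv[of C t] C by simp
  have "last_in above (free_addables \<kappa> i (mph h)) = v"
    unfolding free_addables_def mp_arcs_def
  proof (rule last_free_cls(2)[OF v])
    show "lv m < lv (rnk v)" if "rnk v < m" for m
    proof -
      have "lv m < mlv K i \<kappa> h t C"
        by (rule after[where t = t and C = C]) (use late C that rv in auto)
      then show ?thesis unfolding lvv .
    qed
    show "lv m \<le> lv (rnk v)" for m unfolding lvv lv_at[of m] by (rule max) (simp add: K_pos less_imp_le)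
  qed
  then show ?thesis using add_node_mph[of t h C] by (simp add: mp_f_def v_def)
qed

end

lemma mlet_inc:
  assumes "mlet i q g C = - 1" and le: "g (Suc C) \<le> g C"
  shows "mlet i q (g(C := Suc (g C))) x = mlet i q g x + (if x = C then 2 else 0)"
proof -
  have a: "C = 0 \<or> 0 < g (C - 1)" "q + of_nat (C + g C) = i" using assms by (auto simp: mlet_def split: if_splits)
  have "q + of_nat (C + Suc (g C)) \<noteq> i" using a(2) color_Suc_iff[of q "C + g C" i] by simp
  moreover have "q + of_nat (Suc C) \<noteq> i" if "g C = 0" using a(2) color_Suc_iff[of q C i] that by simp
  ultimately show ?thesis using a le
    by (cases "x = C"; cases "x = Suc C"; cases "g C = 0"; cases "x = 0")
      (auto simp: mlet_def split: if_splits)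
qed

lemma mlv1_inc:
  assumes "mlet i q g C = - 1" "g (Suc C) \<le> g C"
  shows "mlv1 i q (g(C := Suc (g C))) B = mlv1 i q g B + (if C < B then 2 else 0)"
  unfolding mlv1_def mlet_inc[OF assms] by (simp add: sum.distrib sum.delta')

lemma mlv_inc:
  assumes "mlet i (\<kappa> t) (h t) C = - 1" "C < K" and le: "h t (Suc C) \<le> h t C"
  shows "mlv K i \<kappa> (inc_col h t C) s B = mlv K i \<kappa> h s B + (if t < s \<or> t = s \<and> C < B then 2 else 0)"
proof -
  have eq: "mlv1 i (\<kappa> s) (inc_col h t C s) B = mlv1 i (\<kappa> s) (h s) B + (if s = t \<and> C < B then 2 else 0)" for s B
    using mlv1_inc[OF assms(1) le, of B] by (simp add: inc_col_def)
  show ?thesis unfolding mlv_def eq using assms(2) by (simp add: sum.distrib)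
qed

lemma (in heights) mp_e_mph:
  assumes C: "C < K" and letter: "mlet i (\<kappa> t) (h t) C = - 1"
    and max: "\<And>s B. B \<le> K \<Longrightarrow> mlv K i \<kappa> h s B \<le> mlv K i \<kappa> h t C"
    and late: "\<And>s B. B \<le> K \<Longrightarrow> t < s \<or> t = s \<and> C < B \<Longrightarrow> mlv K i \<kappa> h s B < mlv K i \<kappa> h t C"
    and h': "heights (inc_col h t C) K M'"
  shows "mp_e \<kappa> i (mph (inc_col h t C)) = Some (mph h)"
proof -
  interpret H: heights "inc_col h t C" K M' \<kappa> i by fact
  have le: "h t (Suc C) \<le> h t C" using anti[of C "Suc C" t] by simp
  have let1: "mlet i (\<kappa> t) (inc_col h t C t) C = 1"
    using mlet_inc[OF letter le, of C] letter by (simp add: inc_col_def)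
  define v where "v = (t, h t C, C)"
  have "\<kappa> t + of_nat (C + inc_col h t C t C) \<noteq> i"
    using let1 unfolding mlet_def by (metis one_neq_neg_one zero_neq_one)
  then have v: "v \<in> removables \<kappa> i (mph (inc_col h t C))"
    unfolding H.removables_mph v_def by (simp add: inc_col_def ac_simps)
  have rv: "H.rnk v = t * K + C" by (simp add: v_def H.rnk_def)
  have lvS: "H.lv (Suc (H.rnk v)) = mlv K i \<kappa> h t C + 1"
    unfolding rv using H.lv_mlv[of "Suc C" t] C mlv_inc[where h = h and \<kappa> = \<kappa>, OF letter C le, of t "Suc C"] letter
    by (simp add: mlv_def mlv1_def)
  have lem: "H.lv m \<le> mlv K i \<kappa> h t C" if m: "m \<le> H.rnk v" for m
  proof -
    have n: "\<not> (t < m div K \<or> t = m div K \<and> C < m mod K)"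
    proof
      assume "t < m div K \<or> t = m div K \<and> C < m mod K"
      then have "t * K + C < m"
      proof
        assume "t < m div K"
        then have "Suc t * K \<le> m div K * K" by (intro mult_le_mono1) auto
        moreover have "m div K * K \<le> m" by simp
        ultimately have "K + t * K \<le> m" unfolding mult_Suc by (rule order.trans)
        then show ?thesis using C by linarith
      next
        assume a: "t = m div K \<and> C < m mod K"
        then have "t * K + m mod K = m" using div_mult_mod_eq[of m K] by simp
        then show ?thesis using a by linarith
      qed
      then show False using m rv by simp
    qed
    show ?thesis unfolding H.lv_at mlv_inc[where h = h and \<kappa> = \<kappa>, OF letter C le] if_not_P[OF n]
      using max[of "m mod K" "m div K"] K_pos by (simp add: less_imp_le)
  qed
  have all: "H.lv m \<le> mlv K i \<kappa> h t C + 1" for m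
  proof (cases "t < m div K \<or> t = m div K \<and> C < m mod K")
    case True
    have "mlv K i \<kappa> h (m div K) (m mod K) < mlv K i \<kappa> h t C"
      by (rule late[OF _ True]) (simp add: K_pos less_imp_le)
    then show ?thesis unfolding H.lv_at mlv_inc[where h = h and \<kappa> = \<kappa>, OF letter C le] by simp
  next
    case False
    show ?thesis unfolding H.lv_at mlv_inc[where h = h and \<kappa> = \<kappa>, OF letter C le] if_not_P[OF False]
      using max[of "m mod K" "m div K"] K_pos by (simp add: less_imp_le)
  qed
  have f: "v \<in> free_removables \<kappa> i (mph (inc_col h t C))"
    "first_in above (free_removables \<kappa> i (mph (inc_col h t C))) = v"
    unfolding free_removables_def mp_arcs_def
    by (rule H.first_free_opn[OF v], use lem all lvS in force, use all lvS in force)+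
  have "del_node v (mph (inc_col h t C)) = mph h"
    unfolding del_node_def v_def mph_def inc_col_def by (auto simp: fun_eq_iff less_Suc_eq)
  then show ?thesis using f by (auto simp: mp_e_def)
qed

section \<open>Weights\<close>

lemma (in bracketing) lv_count:
  "lv m = int (card {u \<in> opn. rk u < m}) - int (card {v \<in> cls. rk v < m})"
proof -
  have dj: "rk ` opn \<inter> rk ` cls = {}" using disj rk_inj by blast
  have "stp j = (if j \<in> rk ` opn then 1 else 0) - (if j \<in> rk ` cls then 1 else 0)" for j
    using dj by (auto simp: stp_def)
  then have "lv m = (\<Sum>j<m. if j \<in> rk ` opn then 1 else 0) - (\<Sum>j<m. if j \<in> rk ` cls then 1 else 0)"
    by (simp add: lv_def sum_subtractf)
  moreover have "(\<Sum>j<m. if j \<in> rk ` A then 1 else (0 :: int)) = int (card {u \<in> A. rk u < m})" if "A \<subseteq> opn \<union> cls" for A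
  proof -
    have "inj_on rk {u \<in> A. rk u < m}" using inj by (rule inj_on_subset) (use that in auto)
    then have "card {u \<in> A. rk u < m} = card (rk ` {u \<in> A. rk u < m})" by (simp add: card_image)
    also have "rk ` {u \<in> A. rk u < m} = {j. j < m \<and> j \<in> rk ` A}" by auto
    finally show ?thesis by (simp add: sum.If_cases Int_def)
  qed
  from this[of opn] this[of cls] show ?thesis using calculation by simp
qed

lemma (in heights) phi_eps:
  "int (card {u \<in> free_addables \<kappa> i (mph h). fst u < M}) =
   int (card (free_removables \<kappa> i (mph h))) - (\<Sum>s<M. mlv1 i (\<kappa> s) (h s) K)"
proof -
  let ?R = "removables \<kappa> i (mph h)" and ?A = "addables \<kappa> i (mph h)"
  define X where "X = {v \<in> ?A. fst v < M}"
  have rk: "rnk u < M * K \<longleftrightarrow> fst u < M" if u: "u \<in> ?R \<union> ?A" for u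
  proof -
    from u obtain t x where u': "u = (t, (if \<kappa> t + of_nat (x + h t x) = i then h t x else h t x - 1), x)" "x < K"
      by (rule letters)
    have "t * K + x < M * K \<longleftrightarrow> t < M"
    proof
      assume "t < M"
      then have "Suc t * K \<le> M * K" by (intro mult_le_mono1) auto
      then show "t * K + x < M * K" using u'(2) by auto
    next
      assume l: "t * K + x < M * K"
      show "t < M"
      proof (rule ccontr)
        assume "\<not> t < M"
        then have "M * K \<le> t * K" by (intro mult_le_mono1) auto
        then show False using l by linarith
      qed
    qed
    then show ?thesis by (simp add: u'(1) rnk_def)
  qed
  have R: "fst u < M" if "u \<in> ?R" for u
    using that deep unfolding removables_mph by (auto simp: not_le[symmetric])
  have "inj_on rnk X" using inj by (rule inj_on_subset) (auto simp: X_def)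
  moreover have "rnk ` X \<subseteq> {..<M * K}" using rk by (auto simp: X_def)
  ultimately have fX: "finite X" using finite_subset finite_imageD by blast
  have "{u \<in> free_addables \<kappa> i (mph h). fst u < M} = X - Field (arcs ?R ?A above)"
    by (auto simp: free_addables_def mp_arcs_def X_def)
  moreover have "int (card (X - Field (arcs ?R ?A above))) =
      int (card X) - int (card ?R) + int (card (?R - Field (arcs ?R ?A above)))"
  proof (rule card_free_cls[OF fX])
    show "X \<subseteq> ?A" by (auto simp: X_def)
    show "v \<in> X" if "matched u v" for u v
    proof -
      have m: "u \<in> ?R" "v \<in> ?A" "rnk v < rnk u" using that by (auto simp: matched_def)
      then have "rnk u < M * K" using rk[of u] R[of u] by auto
      then show ?thesis using m rk[of v] by (auto simp: X_def)
    qed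
  qed
  moreover have "lv (M * K) = int (card ?R) - int (card X)"
  proof -
    have "{u \<in> ?R. rnk u < M * K} = ?R" "{v \<in> ?A. rnk v < M * K} = X"
      using rk R by (auto simp: X_def)
    then show ?thesis using lv_count[of "M * K"] by simp
  qed
  moreover have "lv (M * K) = (\<Sum>s<M. mlv1 i (\<kappa> s) (h s) K)"
    using lv_mlv[of 0 M] by (simp add: mlv_def mlv1_def)
  ultimately show ?thesis by (simp add: free_removables_def mp_arcs_def)
qed

lemma column_sum: "2 * (\<Sum>r<n. sg i (q + of_nat r)) = sg i q - sg i (q + of_nat n)"
proof (induction n)
  case (Suc n)
  have "sg i (q + of_nat (Suc n)) = - sg i (q + of_nat n)" by (simp add: add.left_commute[of q])
  then show ?case using Suc by simp
qed simp

lemma mlv1_total: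
  assumes strict: "\<And>x. g (Suc x) \<le> g x - 1" and wide: "\<And>x. K \<le> Suc x \<Longrightarrow> g x = 0" and K: "0 < K"
  shows "mlv1 i q g K = 2 * (\<Sum>x<K. \<Sum>r<g x. sg i (q + of_nat x + of_nat r)) - (if q = i then 1 else 0)"
proof -
  define N where "N = (LEAST x. g x = 0)"
  have gK: "g (K - 1) = 0" using wide K by auto
  have gN: "g N = 0" unfolding N_def using gK by (rule LeastI)
  have NK: "N < K" using Least_le[of "\<lambda>x. g x = 0", OF gK] K by (auto simp: N_def)
  have pos: "0 < g x" if "x < N" for x using not_less_Least[of x "\<lambda>x. g x = 0"] that by (auto simp: N_def)
  have zero: "g x = 0" if "N \<le> x" for x using that
    by (induction x rule: dec_induct) (use gN strict in \<open>auto simp: le_less_trans\<close>, metis diff_0_eq_0 le_zero_eq strict)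
  define S where "S C = (\<Sum>x<C. \<Sum>r<g x. sg i (q + of_nat x + of_nat r))" for C
  have low: "mlv1 i q g C = 2 * S C - (if q = i then 1 else 0) + (if q + of_nat C = i then 1 else 0)"
    if "C \<le> N" for C using that
  proof (induction C)
    case (Suc C)
    have "mlet i q g C = - sg i (q + of_nat C + of_nat (g C))"
      using pos[of C] pos[of "C - 1"] Suc.prems by (auto simp: mlet_def sg_def add.assoc)
    moreover have "2 * S (Suc C) = 2 * S C + (sg i (q + of_nat C) - sg i (q + of_nat C + of_nat (g C)))"
      using column_sum[of i "q + of_nat C" "g C"] by (simp add: S_def distrib_left)
    moreover have "sg i (q + of_nat C) =
        (if q + of_nat C = i then 1 else 0) - (if q + of_nat (Suc C) = i then 1 else 0)"
      using color_Suc_iff[of q C i] by (simp add: sg_def del: of_nat_Suc)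
    ultimately show ?case using Suc by (simp add: mlv1_def del: of_nat_Suc)
  qed (simp add: S_def mlv1_def)
  have "mlv1 i q g C = 2 * S C - (if q = i then 1 else 0)" if "Suc N \<le> C" for C using that
  proof (induction C rule: dec_induct)
    case base
    have "mlet i q g N = - (if q + of_nat N = i then 1 else 0)"
      using gN pos[of "N - 1"] by (cases "N = 0") (auto simp: mlet_def)
    then show ?case using low[of N] gN by (simp add: mlv1_def S_def)
  next
    case (step C)
    have "mlet i q g C = 0" using zero[of "C - 1"] zero[of C] step by (auto simp: mlet_def)
    then show ?case using step zero[of C] by (simp add: mlv1_def S_def)
  qed
  then show ?thesis using NK by (simp add: S_def)
qed

lemma pairing_0 [simp]: "pairing 0 i = 0"
  and pairing_add: "pairing (v + w) i = pairing v i + pairing w i"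
  and pairing_diff: "pairing (v - w) i = pairing v i - pairing w i"
  and pairing_uminus: "pairing (- v) i = - pairing v i"
  by (simp_all add: pairing_def zero_prod_def split: prod.splits)

lemma pairing_sum: "pairing (sum f A) i = (\<Sum>x\<in>A. pairing (f x) i)"
  by (induction A rule: infinite_finite_induct) (simp_all add: pairing_add)

lemma pairing_root: "pairing (simple_root k) i = 2 * sg i k"
  by (cases i; cases k; simp add: pairing_def simple_root_def sg_def)

lemma pairing_dom_weight: "pairing (dom_weight t) i = int (t i)"
  by (cases i; simp add: pairing_def dom_weight_def wscale_def fund_def)

lemma pairing_level_weight: "pairing (level_weight \<kappa> l) i = int (card {s. s < l \<and> \<kappa> s = i})"
proof -
  have "pairing (level_weight \<kappa> l) i = (\<Sum>s<l. if \<kappa> s = i then 1 else 0)"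
    unfolding level_weight_def pairing_sum pairing_fund by (intro sum.cong) auto
  then show ?thesis by (simp add: sum.If_cases Int_def)
qed

lemma (in heights) nodes_mph:
  "nodes (mph h) = (\<lambda>(t, x, r). (t, r, x)) ` (SIGMA t:{..<M}. SIGMA x:{..<K}. {..<h t x})"
proof -
  have b: "t < M" "x < K" if "r < h t x" for t x r
    using deep[of t x] wide[of x t] that by (cases "t < M"; cases "x < K"; auto)+
  show ?thesis unfolding nodes_def mph_def
    by (auto simp: image_iff b)
qed

lemma (in heights) phi_weight:
  "int (card {u \<in> free_addables \<kappa> i (mph h). fst u < M}) =
   int (card (free_removables \<kappa> i (mph h))) + pairing (level_weight \<kappa> M - mp_cont \<kappa> (mph h)) i"
proof -
  have inj: "inj_on (\<lambda>(t, x, r). (t, r, x)) A" for A :: "(nat \<times> nat \<times> nat) set"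
    by (auto simp: inj_on_def)
  have "pairing (mp_cont \<kappa> (mph h)) i = (\<Sum>u\<in>nodes (mph h). 2 * sg i (residue \<kappa> u))"
    unfolding mp_cont_def pairing_sum pairing_root ..
  also have "\<dots> = (\<Sum>(t, x, r)\<in>(SIGMA t:{..<M}. SIGMA x:{..<K}. {..<h t x}). 2 * sg i (\<kappa> t + of_nat x + of_nat r))"
    unfolding nodes_mph sum.reindex[OF inj] by (intro sum.cong refl) (auto simp: residue_def)
  also have "\<dots> = (\<Sum>t<M. \<Sum>x<K. \<Sum>r<h t x. 2 * sg i (\<kappa> t + of_nat x + of_nat r))"
    by (simp add: sum.Sigma)
  also have "\<dots> = (\<Sum>t<M. mlv1 i (\<kappa> t) (h t) K + (if \<kappa> t = i then 1 else 0))"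
  proof (intro sum.cong refl)
    fix t
    show "(\<Sum>x<K. \<Sum>r<h t x. 2 * sg i (\<kappa> t + of_nat x + of_nat r)) =
        mlv1 i (\<kappa> t) (h t) K + (if \<kappa> t = i then 1 else 0)"
      using mlv1_total[of "h t" K i "\<kappa> t", OF strict wide K_pos] by (simp add: sum_distrib_left)
  qed
  also have "\<dots> = (\<Sum>s<M. mlv1 i (\<kappa> s) (h s) K) + pairing (level_weight \<kappa> M) i"
    unfolding pairing_level_weight by (simp add: sum.distrib sum.If_cases Int_def)
  finally show ?thesis unfolding phi_eps pairing_diff by simp
qed

lemma (in heights) mp_cont_inc:
  assumes "mlet i (\<kappa> t) (h t) x = - 1"
  shows "mp_cont \<kappa> (mph (inc_col h t x)) = mp_cont \<kappa> (mph h) + simple_root i"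
proof -
  have "nodes (mph (inc_col h t x)) = insert (t, h t x, x) (nodes (mph h))"
    unfolding add_node_mph[symmetric] by (auto simp: nodes_def add_node_def split: if_splits)
  moreover have "finite (nodes (mph h))" unfolding nodes_mph by auto
  moreover have "(t, h t x, x) \<notin> nodes (mph h)" by (simp add: nodes_def mph_def)
  moreover have "residue \<kappa> (t, h t x, x) = i"
    using assms by (auto simp: mlet_def residue_def add.assoc split: if_splits)
  ultimately show ?thesis by (simp add: mp_cont_def add.commute)
qed

lemma ul_cont_inc:
  assumes "ul d t" "ul (d(r := Suc (d r))) t'"
  shows "ul_cont (dg c (d(r := Suc (d r)))) = ul_cont (dg c d) + simple_root (c + of_nat r)"
proof -
  have "finite (box c d)" using finite_cells[of "dg c d"] cells_dg[OF assms(1)] by simp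
  moreover have "(int r, d r, c + of_nat r) \<notin> box c d" by (simp add: box_mem)
  ultimately show ?thesis
    unfolding ul_cont_def cells_dg[OF assms(1)] cells_dg[OF assms(2)] box_insert[symmetric]
    by (simp add: add.commute)
qed

section \<open>One step of the splitting\<close>

definition Lh :: "bit \<Rightarrow> diagram \<Rightarrow> nat \<Rightarrow> nat" where
  "Lh j D = col_ht (cells (fst (split j D)))"

definition Up :: "bit \<Rightarrow> diagram \<Rightarrow> diagram" where
  "Up j D = snd (split j D)"

context splitting
begin

lemma hg_l': "hg l' x = hg l x"
proof -
  have "{r. x < l r} = (\<lambda>r. r + a) ` {r. x < l' r}"
  proof (intro equalityI subsetI)
    fix r assume r: "r \<in> {r. x < l r}"
    then have "a \<le> r" using a_le by (auto simp: l_def)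
    then show "r \<in> (\<lambda>r. r + a) ` {r. x < l' r}" using r by (intro image_eqI[of _ _ "r - a"]) (auto simp: l'_def)
  qed (auto simp: l'_def)
  then show ?thesis by (simp add: hg_def card_image)
qed

lemma hg_l_pos_iff: "0 < hg l x \<longleftrightarrow> x < w"
  using hg_l[of x] hg_l_pos[of x] hg_l_0[of x] by (cases "x < w") auto

lemma mlet_l: "mlet i i0 (hg l) x = (if x < w then clet i c d x else if x = w \<and> i0 + of_nat w = i then - 1 else 0)"
proof (cases "x < w")
  case True
  then have "x + hg l x + a = ft d x" using hg_l[OF True] hg_l_pos[OF True] by auto
  then have "c + of_nat (ft d x) = c + of_nat a + of_nat (x + hg l x)"
    by (metis add.assoc add.commute of_nat_add)
  then have "i0 + of_nat (x + hg l x) = fc c d x" by (simp add: fc_def c_a)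
  moreover have "x = 0 \<or> 0 < hg l (x - 1)" using True by (auto simp: hg_l_pos_iff)
  moreover have "0 < hg l x" using True by (simp add: hg_l_pos_iff)
  moreover have "0 < hg d x" using hg_pos[OF um] w_le[OF True] by simp
  ultimately show ?thesis using True by (auto simp: mlet_def clet_def)
next
  case False
  then have "hg l x = 0" using hg_l_0 by simp
  moreover have "(x = 0 \<or> 0 < hg l (x - 1)) \<longleftrightarrow> x = w"
    using False unfolding hg_l_pos_iff by (cases x) auto
  ultimately show ?thesis using False by (cases "x = w") (simp_all add: mlet_def)
qed

lemma mlv1_l_low: "C \<le> w \<Longrightarrow> mlv1 i i0 (hg l) C = clv i c d C"
  unfolding mlv1_def clv_def by (intro sum.cong) (auto simp: mlet_l)

lemma mlv1_l_high: "w < C \<Longrightarrow> mlv1 i i0 (hg l) C = T i"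
proof -
  assume "w < C"
  then have "Suc w \<le> C" by auto
  then show ?thesis
  proof (induction C rule: dec_induct)
    case base
    then show ?case using mlv1_l_low[of w i] by (simp add: mlv1_def mlet_l T_def)
  next
    case (step C)
    then show ?case by (simp add: mlv1_def mlet_l)
  qed
qed

lemma split_heights:
  assumes "ul d' t'" "samec c u c' d'"
  shows "Lh i0 (dg c d) = hg l" "Up i0 (dg c d) = dg c' d'"
  by (simp_all add: Lh_def Up_def split_dg[OF assms] cells_dg[OF ul_l'] hg_l' fun_eq_iff)

end

lemma split_obtain:
  assumes "D \<in> UL"
  obtains c d t c' d' t' where "splitting d t" "D = dg c d" "0 < d 0 \<or> c = i" "ul d' t'"
    "samec c (splitting.u c j d) c' d'" "0 < d' 0 \<or> c' = i"
proof -
  obtain c0 d t where D: "ul d t" "D = dg c0 d" using UL_dg[OF assms] .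
  define c where "c = (if 0 < d 0 then c0 else i)"
  have D': "D = dg c d" using D(2) dg_zero[of d c0] dg_zero[of d c] by (auto simp: c_def)
  interpret S: splitting c j d t by standard (rule D)
  obtain c1 d' t' where e: "ul d' t'" "samec c S.u c1 d'" using ul_exists[OF S.um_u, of c] by blast
  define c' where "c' = (if 0 < d' 0 then c1 else i)"
  have "samec c S.u c' d'"
  proof (cases "0 < d' 0")
    case False
    then have "hg d' x = 0" for x using ul_zero[OF e(1)] by (simp add: hg_def)
    then show ?thesis using e(2) by (simp add: samec_def)
  qed (use e in \<open>simp add: c'_def\<close>)
  then show thesis using that[of d t c d' t' c'] D' e(1) S.splitting_axioms by (simp add: c_def c'_def)
qed

lemma Up_UL: "D \<in> UL \<Longrightarrow> Up j D \<in> UL"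
  and Lh_strict: "D \<in> UL \<Longrightarrow> Lh j D (Suc x) \<le> Lh j D x - 1"
  and Lh_finite: "D \<in> UL \<Longrightarrow> \<exists>w. \<forall>x\<ge>w. Lh j D x = 0"
proof -
  assume D: "D \<in> UL"
  obtain c d t c' d' t' where s: "splitting d t" "D = dg c d" "ul d' t'" "samec c (splitting.u c j d) c' d'"
    using split_obtain[OF D, of _ j] by metis
  interpret S: splitting c j d t by fact
  note h = S.split_heights[OF s(3,4), folded s(2)]
  show "Up j D \<in> UL" unfolding h by (rule dg_UL[OF s(3)])
  show "Lh j D (Suc x) \<le> Lh j D x - 1" unfolding h by (rule S.hg_l_strict)
  show "\<exists>w. \<forall>x\<ge>w. Lh j D x = 0" unfolding h using S.hg_l_0 by blast
qed

lemma ul_f_UL: "D \<in> UL \<Longrightarrow> ul_f i D \<in> UL"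
  and ul_cont_f: "D \<in> UL \<Longrightarrow> ul_cont (ul_f i D) = ul_cont D + simple_root i"
proof -
  assume D: "D \<in> UL"
  obtain c d t where s: "splitting d t" "D = dg c d" "0 < d 0 \<or> c = i" using split_obtain[OF D] by metis
  then have ul: "ul d t" by (simp add: splitting_def)
  obtain r where r: "fr i c d t r" using fr_exists[OF ul_um[OF ul]] by blast
  obtain t' where ul': "ul (d(r := Suc (d r))) t'" using fr_ul[OF ul r s(3)] by blast
  have f: "ul_f i D = dg c (d(r := Suc (d r)))" unfolding s(2) by (rule ul_f_dg[OF ul r s(3)])
  show "ul_f i D \<in> UL" unfolding f by (rule dg_UL[OF ul'])
  show "ul_cont (ul_f i D) = ul_cont D + simple_root i"
    unfolding f unfolding s(2) using ul_cont_inc[OF ul ul', of c] r by (simp add: fr_def)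
qed

text \<open>
  The tensor product rule of crystals for splitting: the lower part comes last in the reading
  order, and \<open>- q K\<close> is its \<open>\<phi>\<^sub>i - \<epsilon>\<^sub>i\<close>.
\<close>

lemma tensor_rule:
  fixes i j :: bit
  assumes D: "D \<in> UL" and K: "\<And>x. K \<le> Suc x \<Longrightarrow> Lh j D x = 0" "0 < K"
  defines "q \<equiv> mlv1 i j (Lh j D)" and "E \<equiv> int (ul_eps i D)" and "E' \<equiv> int (ul_eps i (Up j D))"
  shows "q B \<le> E" "q K + E' \<le> E"
    "Lh j (ul_f i D) = Lh j D \<and> Up j (ul_f i D) = ul_f i (Up j D) \<and> q K + E' = E \<and> (D = [] \<longrightarrow> i \<noteq> j) \<or>
     (\<exists>C. C < K \<and> Lh j (ul_f i D) = (Lh j D)(C := Suc (Lh j D C)) \<and> Up j (ul_f i D) = Up j D \<and>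
       mlet i j (Lh j D) C = - 1 \<and> q C = E \<and> (\<forall>B>C. q B < E) \<and> q K + E' < E)"
proof -
  obtain c d t c' d' t' where s: "splitting d t" "D = dg c d" "0 < d 0 \<or> c = i" "ul d' t'"
    "samec c (splitting.u c j d) c' d'" "0 < d' 0 \<or> c' = i"
    using split_obtain[OF D] by metis
  interpret S: splitting c j d t by fact
  note h = S.split_heights[OF s(4,5), folded s(2)]
  have wK: "S.w < K"
  proof (rule ccontr)
    assume "\<not> S.w < K"
    then have "0 < S.w" "Lh j D (S.w - 1) = 0" using K by auto
    then show False using S.hg_l_pos_iff[of "S.w - 1"] unfolding h by auto
  qed
  have qlow: "q B = clv i c d B" if "B \<le> S.w" for B unfolding q_def h using S.mlv1_l_low[OF that] .
  have qhigh: "q B = S.T i" if "S.w < B" for B unfolding q_def h using S.mlv1_l_high[OF that] .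
  obtain r where r: "fr i c d t r" using fr_exists[OF S.um] by blast
  obtain b where b: "fr i c S.u t b" using fr_exists[OF S.um_u] by blast
  obtain b' where b': "fr i c' d' t' b'" using fr_exists[OF ul_um[OF s(4)]] by blast
  have E: "E = clv i c d (d r)" unfolding E_def s(2) by (rule ul_eps_fr[OF S.ul r])
  note add = samec_add[OF s(5) S.um_u ul_um[OF s(4)] b b']
  have E': "E' = clv i c S.u (S.u b)"
    unfolding E'_def h ul_eps_fr[OF s(4) b'] add(2) using samec_clv[OF s(5)] by simp
  have E'0: "0 \<le> E'" by (simp add: E'_def)
  obtain t1 where ul1: "ul (d(r := Suc (d r))) t1" using fr_ul[OF S.ul r s(3)] by blast
  interpret S1: splitting c j "d(r := Suc (d r))" t1 by standard (rule ul1)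
  have f: "ul_f i D = dg c (d(r := Suc (d r)))" unfolding s(2) by (rule ul_f_dg[OF S.ul r s(3)])
  obtain t2 where ul2: "ul (d'(b' := Suc (d' b'))) t2" using fr_ul[OF s(4) b' s(6)] by blast
  have TE: "S.T i \<le> E - E' \<Longrightarrow> S.T i \<le> E" using E'0 by simp
  have C: "(\<forall>C\<le>S.w. clv i c d C \<le> S.T i + E') \<or> (\<exists>C\<le>S.w. S.T i + E' < clv i c d C)"
    by (meson not_le)
  then have main: "q K + E' \<le> E \<and>
    (Lh j (ul_f i D) = Lh j D \<and> Up j (ul_f i D) = ul_f i (Up j D) \<and> q K + E' = E \<and> (D = [] \<longrightarrow> i \<noteq> j) \<or>
     (\<exists>C. C < K \<and> Lh j (ul_f i D) = (Lh j D)(C := Suc (Lh j D C)) \<and> Up j (ul_f i D) = Up j D \<and>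
       mlet i j (Lh j D) C = - 1 \<and> q C = E \<and> (\<forall>B>C. q B < E) \<and> q K + E' < E))"
  proof
    assume le: "\<forall>C\<le>S.w. clv i c d C \<le> S.T i + E'"
    then have u: "r = b" "r < S.N" "E = S.T i + E'"
      using S.tensor_upper[OF s(3) r b] unfolding E E' by auto
    have "S1.l = S.l"
    proof
      fix x show "S1.l x = S.l x" using S.below_N[OF u(2)] by (auto simp: S1.l_def S.l_def)
    qed
    moreover have u': "S1.u = S.u(r := Suc (S.u r))"
    proof
      fix x show "S1.u x = (S.u(r := Suc (S.u r))) x"
        using S.below_N[OF u(2)] by (auto simp: S1.u_def S.u_def Suc_diff_le)
    qed
    have "samec c S1.u c' (d'(b' := Suc (d' b')))" using add(1) u(1) unfolding u' by simp
    note h1 = S1.split_heights[OF ul2 this, folded f]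
    moreover have "ul_f i (dg c' d') = dg c' (d'(b' := Suc (d' b')))" by (rule ul_f_dg[OF s(4) b' s(6)])
    moreover have "i \<noteq> j" if "D = []"
    proof
      assume "i = j"
      have z: "d x = 0" for x using that s(2) dg_Nil_iff[OF S.ul] ul_zero[OF S.ul] by metis
      then have ci: "c = i" using s(3) by auto
      have "S.a = 0" unfolding S.a_def using ci \<open>i = j\<close> by simp
      then have "\<not> 0 < S.N" using S.below_N[of 0] z[of 0] by fastforce
      then have "S.N = 0" by simp
      then have w: "S.w = 0" by (simp add: S.w_def)
      have "S.u x = 0" for x using z[of x] S.l_plus_u[of x] by simp
      then have "E' = 0" unfolding E' by simp
      moreover have "S.T i = - 1" unfolding S.T_def w using \<open>i = j\<close> by simp
      ultimately show False using le[rule_format, of 0] by simp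
    qed
    ultimately show ?thesis using u qhigh[OF wK] by (simp add: h h1)
  next
    assume "\<exists>C\<le>S.w. S.T i + E' < clv i c d C"
    then obtain C where "C \<le> S.w" "S.T i + clv i c S.u (S.u b) < clv i c d C" unfolding E' by auto
    note t = S.tensor_lower[OF r b this]
    have lt: "S.T i + E' < E" using t(3) unfolding E E' .
    have lr: "S.l r = d r" using S.l_above[OF t(1)] .
    have l': "S1.l = S.l(r := Suc (S.l r))"
    proof
      fix x show "S1.l x = (S.l(r := Suc (S.l r))) x"
        using S.above_N[OF t(1)] by (auto simp: S1.l_def S.l_def)
    qed
    have u': "S1.u = S.u"
    proof
      fix x show "S1.u x = S.u x" using S.above_N[OF t(1)] by (auto simp: S1.u_def S.u_def)
    qed
    have "samec c S1.u c' d'" unfolding u' by (rule s(5))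
    note h1 = S1.split_heights[OF s(4) this, folded f]
    have "hg S1.l = (hg S.l)(d r := Suc (hg S.l (d r)))"
    proof
      fix x show "hg S1.l x = ((hg S.l)(d r := Suc (hg S.l (d r)))) x"
        unfolding l' using hg_add[OF S.um_l, of r x] lr by simp
    qed
    moreover have am: "last_argmax (clv i c d) (d t) (d r)" by (rule fr_last_argmax[OF S.um r])
    have "mlet i j (hg S.l) (d r) = - 1"
    proof (cases "d r < S.w")
      case True
      then have "clv i c d (Suc (d r)) < clv i c d (d r)" "0 < hg d (d r)"
        using am S.w_le[OF True] hg_pos[OF S.um] by (auto simp: last_argmax_def)
      then show ?thesis using True by (auto simp: S.mlet_l clv_Suc clet_def split: if_splits)
    next
      case False
      then have "d r = S.w" using t(2) by simp
      moreover from this have "j + of_nat S.w = i" using lt E'0 unfolding E S.T_def by (auto split: if_splits)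
      ultimately show ?thesis by (simp add: S.mlet_l)
    qed
    moreover have "q B < E" if "d r < B" for B
    proof (cases "B \<le> S.w")
      case True
      then have "B \<le> d t" using S.w_le[of "B - 1"] that by linarith
      then show ?thesis using qlow[OF True] am that unfolding E last_argmax_def by auto
    next
      case False
      then show ?thesis using qhigh[of B] lt E'0 by simp
    qed
    ultimately show ?thesis using lt qhigh[OF wK] qlow[OF t(2)] t(2) wK
      by (intro conjI disjI2 exI[of _ "d r"]) (simp_all add: h h1 E)
  qed
  then show "q K + E' \<le> E" by (rule conjunct1)
  show "q B \<le> E"
  proof (cases "B \<le> S.w")
    case True then show ?thesis using qlow[OF True] clv_le_fr[OF S.um r, of B] E by simp
  next
    case False then show ?thesis using qhigh[of B] qhigh[OF wK] main E'0 by simp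
  qed
  from main show "Lh j (ul_f i D) = Lh j D \<and> Up j (ul_f i D) = ul_f i (Up j D) \<and> q K + E' = E \<and> (D = [] \<longrightarrow> i \<noteq> j) \<or>
     (\<exists>C. C < K \<and> Lh j (ul_f i D) = (Lh j D)(C := Suc (Lh j D C)) \<and> Up j (ul_f i D) = Up j D \<and>
       mlet i j (Lh j D) C = - 1 \<and> q C = E \<and> (\<forall>B>C. q B < E) \<and> q K + E' < E)" by (rule conjunct2)
qed

lemma eps_star_Up:
  assumes D: "D \<in> UL"
  shows "ul_eps_star i D \<le> n + (if i = j then 1 else 0) \<longleftrightarrow> ul_eps_star i (Up j D) \<le> n"
proof -
  obtain c d t c' d' t' where s: "splitting d t" "D = dg c d" "ul d' t'" "samec c (splitting.u c j d) c' d'"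
    using split_obtain[OF D, of _ j] by metis
  interpret S: splitting c j d t by fact
  show ?thesis unfolding S.split_heights[OF s(3,4), folded s(2)] unfolding s(2)
    ul_eps_star_le_iff[OF S.ul] ul_eps_star_le_iff[OF s(3)] S.top_bound
    using samec_tlv[OF s(4) S.um_u ul_um[OF s(3)]] by simp
qed

lemma eps_star_Nil: "D \<in> UL \<Longrightarrow> (\<forall>i. ul_eps_star i D = 0) \<longleftrightarrow> D = []"
proof -
  assume D: "D \<in> UL"
  obtain c d t where s: "ul d t" "D = dg c d" using UL_dg[OF D] .
  show ?thesis
  proof
    assume z: "\<forall>i. ul_eps_star i D = 0"
    show "D = []"
    proof (rule ccontr)
      assume "D \<noteq> []"
      then have p: "0 < d t" using s dg_Nil_iff[OF s(1)] ul_peak_pos[OF s(1)] by simp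
      have "ul_eps_star c (dg c d) \<le> 0" using z s by simp
      then have "tlv c c d (Suc 0) \<le> 0" using ul_eps_star_le_iff[OF s(1), of c c 0] by simp
      moreover have "tlet c c d 0 = 1"
        using p hg_pos[OF ul_um[OF s(1)], of 0] ul_tp_0[OF s(1) p] by (simp add: tlet_def sg_def)
      ultimately show False by (simp add: tlv_Suc)
    qed
  next
    assume "D = []"
    then have "tops i D = {}" for i by (simp add: tops_def cells_def)
    then show "\<forall>i. ul_eps_star i D = 0" by (simp add: ul_eps_star_def)
  qed
qed

lemma glue_split_UL: "D \<in> UL \<Longrightarrow> glue (fst (split j D)) (Up j D) = D"
  and split_fst_Nil: "D \<in> UL \<Longrightarrow> fst (split j D) = [] \<Longrightarrow> Up j D = D"
  and split_fst_Nil_iff: "D \<in> UL \<Longrightarrow> fst (split j D) = [] \<longleftrightarrow> Lh j D 0 = 0"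
  and split_fst_cells: "D \<in> UL \<Longrightarrow>
    (\<lambda>(r, x). (int r + int x, x, j + of_nat x + of_nat r)) ` {(r, x). r < Lh j D x} = cells (fst (split j D))"
  and split_fst_justify: "D \<in> UL \<Longrightarrow> left_justify (cells (fst (split j D))) = fst (split j D)"
proof -
  assume D: "D \<in> UL"
  obtain c d t c' d' t' where s: "splitting d t" "D = dg c d" "ul d' t'" "samec c (splitting.u c j d) c' d'"
    using split_obtain[OF D, of _ j] by metis
  interpret S: splitting c j d t by fact
  note sp = S.split_dg[OF s(3,4), folded s(2)]
  note h = S.split_heights[OF s(3,4), folded s(2)]
  show "glue (fst (split j D)) (Up j D) = D"
    unfolding Up_def sp using S.glue_split[OF s(3,4)] by (simp add: s(2))
  have nil: "fst (split j D) = [] \<longleftrightarrow> S.w = 0"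
    using dg_Nil_iff[OF S.ul_l'] S.l'_below[of 0] S.l'_le[of 0] by (cases "S.w = 0") (auto simp: sp)
  then show "Up j D = D" if "fst (split j D) = []"
    unfolding h(2) using S.dg_w_0(2)[OF s(3,4)] that by (simp add: s(2))
  show "fst (split j D) = [] \<longleftrightarrow> Lh j D 0 = 0"
    using nil S.hg_l_pos_iff[of 0] unfolding h by (metis neq0_conv)
  have c: "cells (fst (split j D)) = box j S.l'" by (simp add: sp cells_dg[OF S.ul_l'])
  show "left_justify (cells (fst (split j D))) = fst (split j D)"
    unfolding c using left_justify_box[OF S.ul_l'] by (simp add: sp)
  have col: "x < S.l' \<rho> \<longleftrightarrow> x \<le> \<rho> \<and> \<rho> < x + Lh j D x" for x \<rho>
  proof (cases "x < S.w")
    case True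
    have pk: "x < S.l' (S.w - 1)" using S.l'_below[of "S.w - 1"] True by simp
    note u = um_column[OF ul_um[OF S.ul_l'] pk]
    have "x < S.l' x" using S.l'_below[OF True] by simp
    then have "tp S.l' x \<le> x" using u(1) by simp
    moreover have "x \<le> r" if "x < S.l' r" for r using that S.a_le by (simp add: S.l'_def S.l_def)
    then have "x \<le> tp S.l' x" using u(1)[of "tp S.l' x"] u(2,3) by simp
    ultimately show ?thesis using u(1,4) by (simp add: h S.hg_l')
  next
    case False
    then have "\<not> x < S.l' \<rho>" using S.l'_le[of \<rho>] by simp
    then show ?thesis using S.hg_l_0[of x] False by (simp add: h)
  qed
  show "(\<lambda>(r, x). (int r + int x, x, j + of_nat x + of_nat r)) ` {(r, x). r < Lh j D x} = cells (fst (split j D))"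
    unfolding c
  proof (rule set_eqI)
    fix v :: cell
    obtain \<rho> x k where v: "v = (\<rho>, x, k)" by (cases v)
    have "v \<in> (\<lambda>(r, x). (int r + int x, x, j + of_nat x + of_nat r)) ` {(r, x). r < Lh j D x} \<longleftrightarrow>
      (\<exists>r. \<rho> = int (x + r) \<and> k = j + of_nat (x + r) \<and> r < Lh j D x)"
      unfolding v by (auto simp: image_iff add.assoc add.commute)
    also have "\<dots> \<longleftrightarrow> (\<exists>y. \<rho> = int y \<and> k = j + of_nat y \<and> x < S.l' y)"
    proof
      assume "\<exists>y. \<rho> = int y \<and> k = j + of_nat y \<and> x < S.l' y"
      then obtain y where "\<rho> = int y" "k = j + of_nat y" "x \<le> y" "y < x + Lh j D x" unfolding col by blast
      then show "\<exists>r. \<rho> = int (x + r) \<and> k = j + of_nat (x + r) \<and> r < Lh j D x"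
        by (intro exI[of _ "y - x"]) auto
    next
      assume "\<exists>r. \<rho> = int (x + r) \<and> k = j + of_nat (x + r) \<and> r < Lh j D x"
      then obtain r where "\<rho> = int (x + r)" "k = j + of_nat (x + r)" "r < Lh j D x" by blast
      then show "\<exists>y. \<rho> = int y \<and> k = j + of_nat y \<and> x < S.l' y" unfolding col
        by (intro exI[of _ "x + r"]) auto
    qed
    finally show "v \<in> (\<lambda>(r, x). (int r + int x, x, j + of_nat x + of_nat r)) ` {(r, x). r < Lh j D x} \<longleftrightarrow> v \<in> box j S.l'"
      unfolding v box_iff .
  qed
qed

section \<open>The iterated splitting\<close>

abbreviation tail :: "(nat \<Rightarrow> bit) \<Rightarrow> nat \<Rightarrow> bit" where
  "tail \<kappa> \<equiv> \<lambda>s. \<kappa> (Suc s)"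

primrec res :: "(nat \<Rightarrow> bit) \<Rightarrow> diagram \<Rightarrow> nat \<Rightarrow> diagram" where
  "res \<kappa> D 0 = D"
| "res \<kappa> D (Suc n) = res (tail \<kappa>) (Up (\<kappa> 0) D) n"

definition wh :: "(nat \<Rightarrow> bit) \<Rightarrow> diagram \<Rightarrow> nat \<Rightarrow> nat \<Rightarrow> nat" where
  "wh \<kappa> D t = col_ht (cells (split_seq \<kappa> D t))"

lemma W_map_mph: "W_map \<kappa> D = mph (wh \<kappa> D)"
  by (simp add: W_map_def mph_def wh_def col_ht_def)

lemma wh_0: "wh \<kappa> D 0 = Lh (\<kappa> 0) D"
  and wh_Suc: "wh \<kappa> D (Suc t) = wh (tail \<kappa>) (Up (\<kappa> 0) D) t"
  by (simp_all add: wh_def Lh_def Up_def)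

lemma res_UL: "D \<in> UL \<Longrightarrow> res \<kappa> D n \<in> UL"
  by (induction n arbitrary: \<kappa> D) (auto intro: Up_UL)

lemma split_seq_shift: "split_seq \<kappa> D (n + s) = split_seq (\<lambda>s. \<kappa> (n + s)) (res \<kappa> D n) s"
  by (induction n arbitrary: \<kappa> D) (simp_all add: Up_def)

lemma split_Nil [simp]: "split j [] = ([], [])"
  by (simp add: split_def cells_def)

lemma Nil_UL: "[] \<in> UL"
  by (simp add: UL_def alternating_def)

lemma split_seq_Nil: "split_seq \<kappa> [] t = []"
  by (induction t arbitrary: \<kappa>) simp_all

lemma count_Suc: "card {s. s < Suc n \<and> \<kappa> s = i} = card {s. s < n \<and> \<kappa> (Suc s) = i} + (if \<kappa> 0 = (i :: bit) then 1 else 0)"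
proof -
  have "{s. s < Suc n \<and> \<kappa> s = i} = Suc ` {s. s < n \<and> \<kappa> (Suc s) = i} \<union> (if \<kappa> 0 = i then {0} else {})"
    by (auto simp: image_iff less_Suc_eq_0_disj)
  then show ?thesis by (auto simp: card_image card_insert_if)
qed

lemma eps_star_res:
  "D \<in> UL \<Longrightarrow> (\<forall>i. ul_eps_star i D \<le> card {s. s < n \<and> \<kappa> s = i}) \<longleftrightarrow> res \<kappa> D n = []"
proof (induction n arbitrary: \<kappa> D)
  case 0
  then show ?case using eps_star_Nil by simp
next
  case (Suc n)
  have "(\<forall>i. ul_eps_star i D \<le> card {s. s < Suc n \<and> \<kappa> s = i}) \<longleftrightarrow>
      (\<forall>i. ul_eps_star i (Up (\<kappa> 0) D) \<le> card {s. s < n \<and> \<kappa> (Suc s) = i})"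
    unfolding count_Suc eps_star_Up[OF Suc.prems, symmetric] by (simp add: eq_commute)
  then show ?case using Suc.IH[OF Up_UL[OF Suc.prems], of "\<kappa> 0" "tail \<kappa>"] by simp
qed

lemma multicharge_infinite: "multicharge \<kappa> \<Longrightarrow> infinite {s. \<kappa> s = i}"
  by (cases i) (simp_all add: multicharge_def)

lemma multicharge_shift: "multicharge \<kappa> \<Longrightarrow> multicharge (\<lambda>s. \<kappa> (n + s))"
proof -
  assume m: "multicharge \<kappa>"
  have "infinite {s. \<kappa> (n + s) = i}" for i
  proof
    assume "finite {s. \<kappa> (n + s) = i}"
    then have "finite ({..<n} \<union> (+) n ` {s. \<kappa> (n + s) = i})" by simp
    moreover have "{s. \<kappa> s = i} \<subseteq> {..<n} \<union> (+) n ` {s. \<kappa> (n + s) = i}"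
    proof
      fix s assume "s \<in> {s. \<kappa> s = i}"
      then show "s \<in> {..<n} \<union> (+) n ` {s. \<kappa> (n + s) = i}"
        by (cases "s < n") (auto simp: image_iff intro!: exI[of _ "s - n"])
    qed
    ultimately show False using multicharge_infinite[OF m] finite_subset by blast
  qed
  then show ?thesis by (simp add: multicharge_def)
qed

lemma count_large: "multicharge \<kappa> \<Longrightarrow> \<exists>n. k \<le> card {s. s < n \<and> \<kappa> s = i}"
proof -
  assume "multicharge \<kappa>"
  then obtain F where F: "F \<subseteq> {s. \<kappa> s = i}" "finite F" "card F = k"
    using infinite_arbitrarily_large[OF multicharge_infinite] by metis
  have "F \<subseteq> {s. s < Suc (Max F) \<and> \<kappa> s = i}" using F Max_ge[OF F(2)] by (auto simp: less_Suc_eq_le)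
  then have "k \<le> card {s. s < Suc (Max F) \<and> \<kappa> s = i}" using F card_mono[of "{s. s < Suc (Max F) \<and> \<kappa> s = i}" F] by simp
  then show ?thesis by blast
qed

lemma res_eventually_Nil:
  assumes D: "D \<in> UL" and \<kappa>: "multicharge \<kappa>"
  obtains m where "res \<kappa> D m = []" "\<kappa> m = i"
proof -
  obtain n0 n1 where n: "ul_eps_star 0 D \<le> card {s. s < n0 \<and> \<kappa> s = 0}"
    "ul_eps_star 1 D \<le> card {s. s < n1 \<and> \<kappa> s = 1}"
    using count_large[OF \<kappa>] by metis
  have "\<not> {s. \<kappa> s = i} \<subseteq> {..<max n0 n1}"
    using multicharge_infinite[OF \<kappa>] finite_subset[OF _ finite_lessThan] by blast
  then obtain m where "\<not> m < max n0 n1" "\<kappa> m = i" by blast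
  then have m: "max n0 n1 \<le> m" "\<kappa> m = i" by (simp_all only: not_less)
  have mono: "card {s. s < n \<and> \<kappa> s = j} \<le> card {s. s < m \<and> \<kappa> s = j}" if "n \<le> m" for n j
    by (rule card_mono) (use that in auto)
  have "ul_eps_star j D \<le> card {s. s < m \<and> \<kappa> s = j}" for j
  proof (cases j)
    case zero then show ?thesis using n(1) mono[of n0 0] m by simp
  next
    case one then show ?thesis using n(2) mono[of n1 1] m by simp
  qed
  then have "res \<kappa> D m = []" using eps_star_res[OF D] by blast
  then show thesis using that m by blast
qed

lemma split_seq_all_Nil:
  assumes D: "D \<in> UL" and \<kappa>: "multicharge \<kappa>" and nil: "\<And>s. split_seq \<kappa> D s = []"
  shows "D = []"
proof -
  obtain m where m: "res \<kappa> D m = []" using res_eventually_Nil[OF D \<kappa>] by metis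
  have "(\<And>s. split_seq \<kappa> D s = []) \<Longrightarrow> res \<kappa> D m = D" using D
  proof (induction m arbitrary: \<kappa> D)
    case (Suc m)
    have "Up (\<kappa> 0) D = D" using split_fst_Nil[OF Suc.prems(2)] Suc.prems(1)[of 0] by simp
    moreover from this have "split_seq (tail \<kappa>) D s = []" for s
      using Suc.prems(1)[of "Suc s"] by (simp add: Up_def)
    ultimately show ?case using Suc.IH[of "tail \<kappa>" D] Suc.prems by simp
  qed simp
  then show ?thesis using m nil by simp
qed

lemma split_seq_eq_fst: "split_seq \<kappa> D t = fst (split (\<kappa> t) (res \<kappa> D t))"
  using split_seq_shift[of \<kappa> D t 0] by simp

lemma split_seq_Nil_iff: "D \<in> UL \<Longrightarrow> split_seq \<kappa> D t = [] \<longleftrightarrow> W_map \<kappa> D t = {}"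
proof -
  assume D: "D \<in> UL"
  have w: "wh \<kappa> D t = Lh (\<kappa> t) (res \<kappa> D t)" by (simp add: wh_def Lh_def split_seq_eq_fst)
  have anti: "Lh j E x \<le> Lh j E 0" if "E \<in> UL" for j E x
  proof (induction x)
    case (Suc x)
    then show ?case using Lh_strict[OF that, of j x] by linarith
  qed simp
  have "W_map \<kappa> D t = {} \<longleftrightarrow> Lh (\<kappa> t) (res \<kappa> D t) 0 = 0"
    using anti[OF res_UL[OF D], of "\<kappa> t" \<kappa> t] unfolding W_map_mph mph_def w by fastforce
  then show ?thesis using split_fst_Nil_iff[OF res_UL[OF D]] by (simp add: split_seq_eq_fst)
qed

lemma level_iff:
  assumes D: "D \<in> UL" and \<kappa>: "multicharge \<kappa>"
  shows "res \<kappa> D n = [] \<longleftrightarrow> (\<forall>t\<ge>n. W_map \<kappa> D t = {})"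
proof
  assume "res \<kappa> D n = []"
  then have "split_seq \<kappa> D (n + s) = []" for s unfolding split_seq_shift by (simp add: split_seq_Nil)
  then show "\<forall>t\<ge>n. W_map \<kappa> D t = {}" unfolding split_seq_Nil_iff[OF D, symmetric] by (metis le_Suc_ex)
next
  assume "\<forall>t\<ge>n. W_map \<kappa> D t = {}"
  then have "split_seq \<kappa> D (n + s) = []" for s unfolding split_seq_Nil_iff[OF D] by simp
  then show "res \<kappa> D n = []"
    using split_seq_all_Nil[OF res_UL[OF D] multicharge_shift[OF \<kappa>, of n]] by (simp add: split_seq_shift)
qed

lemma wh_strict: "D \<in> UL \<Longrightarrow> wh \<kappa> D t (Suc x) \<le> wh \<kappa> D t x - 1"
  using Lh_strict[OF res_UL, of D "\<kappa> t" \<kappa> t x] by (simp add: wh_def Lh_def split_seq_eq_fst)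

lemma wh_heights:
  assumes D: "D \<in> UL" and M: "res \<kappa> D M = []"
  shows "\<exists>K. heights (wh \<kappa> D) K M"
proof -
  have z: "wh \<kappa> D t x = 0" if Mt: "M \<le> t" for t x
  proof -
    obtain s where "t = M + s" using Mt le_Suc_ex by blast
    then show ?thesis using M by (simp add: wh_def split_seq_shift split_seq_Nil cells_def col_ht_def)
  qed
  have "\<exists>w. \<forall>x\<ge>w. wh \<kappa> D t x = 0" for t
    using Lh_finite[OF res_UL[OF D], of "\<kappa> t" \<kappa> t] by (simp add: wh_def Lh_def split_seq_eq_fst)
  then obtain w where w: "\<And>t x. w t \<le> x \<Longrightarrow> wh \<kappa> D t x = 0" by metis
  have "heights (wh \<kappa> D) (Suc (\<Sum>t<M. w t)) M"
  proof
    show "wh \<kappa> D t (Suc x) \<le> wh \<kappa> D t x - 1" for t x by (rule wh_strict[OF D])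
    show "wh \<kappa> D t x = 0" if "Suc (\<Sum>t<M. w t) \<le> Suc x" for t x
    proof (cases "t < M")
      case True
      then have "w t \<le> (\<Sum>t<M. w t)" by (intro member_le_sum) auto
      then show ?thesis using that w by simp
    qed (use z in simp)
  qed (use z in auto)
  then show ?thesis by blast
qed

lemma heights_mono: "heights h K M \<Longrightarrow> K \<le> K' \<Longrightarrow> M \<le> M' \<Longrightarrow> heights h K' M'"
  unfolding heights_def by (meson le_trans less_le_trans)

section \<open>Compatibility with the crystal operators\<close>

lemma mlv_0: "mlv K i \<kappa> h 0 C = mlv1 i (\<kappa> 0) (h 0) C"
  by (simp add: mlv_def)

lemma mlv_le_eps:
  assumes "D \<in> UL" "\<And>t x. K \<le> Suc x \<Longrightarrow> wh \<kappa> D t x = 0" "0 < K"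
  shows "mlv K i \<kappa> (wh \<kappa> D) t C \<le> int (ul_eps i D)"
  using assms
proof (induction t arbitrary: \<kappa> D)
  case 0
  have "K \<le> Suc x \<Longrightarrow> Lh (\<kappa> 0) D x = 0" for x using 0(2)[of x 0] by (simp add: wh_0)
  then show ?case using tensor_rule(1)[OF 0(1) _ 0(3)] by (simp add: mlv_0 wh_0)
next
  case (Suc t)
  have l: "K \<le> Suc x \<Longrightarrow> Lh (\<kappa> 0) D x = 0" for x using Suc.prems(2)[of x 0] by (simp add: wh_0)
  have "K \<le> Suc x \<Longrightarrow> wh (tail \<kappa>) (Up (\<kappa> 0) D) t x = 0" for t x
    using Suc.prems(2)[of x "Suc t"] by (simp add: wh_Suc)
  then have "mlv K i (tail \<kappa>) (wh (tail \<kappa>) (Up (\<kappa> 0) D)) t C \<le> int (ul_eps i (Up (\<kappa> 0) D))"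
    by (intro Suc.IH Up_UL Suc.prems)
  then show ?case using tensor_rule(2)[OF Suc.prems(1) l Suc.prems(3), of i]
    by (simp add: mlv_Suc wh_0 wh_Suc)
qed

lemma location_lower:
  assumes D: "D \<in> UL" and K: "\<And>t x. K \<le> Suc x \<Longrightarrow> wh \<kappa> D t x = 0" "0 < K" and "C < K"
    and L: "Lh (\<kappa> 0) (ul_f i D) = (Lh (\<kappa> 0) D)(C := Suc (Lh (\<kappa> 0) D C))"
    and U: "Up (\<kappa> 0) (ul_f i D) = Up (\<kappa> 0) D"
    and q: "mlet i (\<kappa> 0) (Lh (\<kappa> 0) D) C = - 1" "mlv1 i (\<kappa> 0) (Lh (\<kappa> 0) D) C = int (ul_eps i D)"
      "\<forall>B>C. mlv1 i (\<kappa> 0) (Lh (\<kappa> 0) D) B < int (ul_eps i D)"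
      "mlv1 i (\<kappa> 0) (Lh (\<kappa> 0) D) K + int (ul_eps i (Up (\<kappa> 0) D)) < int (ul_eps i D)"
  shows "\<exists>t C. C < K \<and> wh \<kappa> (ul_f i D) = inc_col (wh \<kappa> D) t C \<and> mlet i (\<kappa> t) (wh \<kappa> D t) C = - 1 \<and>
    mlv K i \<kappa> (wh \<kappa> D) t C = int (ul_eps i D) \<and>
    (\<forall>s B. B \<le> K \<and> (t < s \<or> t = s \<and> C < B) \<longrightarrow> mlv K i \<kappa> (wh \<kappa> D) s B < int (ul_eps i D))"
proof -
  have A: "wh \<kappa> (ul_f i D) = inc_col (wh \<kappa> D) 0 C"
  proof
    fix t show "wh \<kappa> (ul_f i D) t = inc_col (wh \<kappa> D) 0 C t"
      by (cases t) (simp_all add: wh_0 wh_Suc inc_col_def L U)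
  qed
  have tail: "K \<le> Suc x \<Longrightarrow> wh (tail \<kappa>) (Up (\<kappa> 0) D) t x = 0" for t x
    using K(1)[of x "Suc t"] by (simp add: wh_Suc)
  have "mlv K i \<kappa> (wh \<kappa> D) (Suc t) B < int (ul_eps i D)" for t B
    using mlv_le_eps[OF Up_UL[OF D] tail K(2), where t = t and C = B and i = i] q(4)
    unfolding mlv_Suc wh_0 wh_Suc by linarith
  then have "mlv K i \<kappa> (wh \<kappa> D) s B < int (ul_eps i D)" if "0 < s \<or> 0 = s \<and> C < B" for s B
    using q(3) that by (cases s) (simp_all add: mlv_0 wh_0)
  moreover have "mlet i (\<kappa> 0) (wh \<kappa> D 0) C = - 1" "mlv K i \<kappa> (wh \<kappa> D) 0 C = int (ul_eps i D)"
    using q by (simp_all add: mlv_0 wh_0)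
  ultimately show ?thesis using A \<open>C < K\<close> by blast
qed

text \<open>
  The witness \<open>m\<close> makes the recursion terminate: at the latest it stops at component \<open>m\<close>, where
  the upper part is exhausted and a new first column can be added.
\<close>

lemma ul_f_location:
  assumes "D \<in> UL" "\<And>t x. K \<le> Suc x \<Longrightarrow> wh \<kappa> D t x = 0" "0 < K" "res \<kappa> D m = []" "\<kappa> m = i"
  shows "\<exists>t C. C < K \<and> wh \<kappa> (ul_f i D) = inc_col (wh \<kappa> D) t C \<and> mlet i (\<kappa> t) (wh \<kappa> D t) C = - 1 \<and>
    mlv K i \<kappa> (wh \<kappa> D) t C = int (ul_eps i D) \<and>
    (\<forall>s B. B \<le> K \<and> (t < s \<or> t = s \<and> C < B) \<longrightarrow> mlv K i \<kappa> (wh \<kappa> D) s B < int (ul_eps i D))"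
  using assms
proof (induction m arbitrary: \<kappa> D)
  case (0 \<kappa> D)
  have l: "K \<le> Suc x \<Longrightarrow> Lh (\<kappa> 0) D x = 0" for x using 0(2)[of x 0] by (simp add: wh_0)
  from 0 tensor_rule(3)[OF 0(1) l 0(3), of i]
  have "\<exists>C. C < K \<and> Lh (\<kappa> 0) (ul_f i D) = (Lh (\<kappa> 0) D)(C := Suc (Lh (\<kappa> 0) D C)) \<and>
    Up (\<kappa> 0) (ul_f i D) = Up (\<kappa> 0) D \<and> mlet i (\<kappa> 0) (Lh (\<kappa> 0) D) C = - 1 \<and>
    mlv1 i (\<kappa> 0) (Lh (\<kappa> 0) D) C = int (ul_eps i D) \<and>
    (\<forall>B>C. mlv1 i (\<kappa> 0) (Lh (\<kappa> 0) D) B < int (ul_eps i D)) \<and>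
    mlv1 i (\<kappa> 0) (Lh (\<kappa> 0) D) K + int (ul_eps i (Up (\<kappa> 0) D)) < int (ul_eps i D)" by simp
  then show ?case using location_lower[OF 0(1-3)] by blast
next
  case (Suc m \<kappa> D)
  have l: "K \<le> Suc x \<Longrightarrow> Lh (\<kappa> 0) D x = 0" for x using Suc.prems(2)[of x 0] by (simp add: wh_0)
  have w: "K \<le> Suc x \<Longrightarrow> wh (tail \<kappa>) (Up (\<kappa> 0) D) t x = 0" for t x
    using Suc.prems(2)[of x "Suc t"] by (simp add: wh_Suc)
  note U = Up_UL[OF Suc.prems(1), of "\<kappa> 0"]
  from tensor_rule(3)[OF Suc.prems(1) l Suc.prems(3), of i]
  show ?case
  proof
    assume up: "Lh (\<kappa> 0) (ul_f i D) = Lh (\<kappa> 0) D \<and> Up (\<kappa> 0) (ul_f i D) = ul_f i (Up (\<kappa> 0) D) \<and>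
      mlv1 i (\<kappa> 0) (Lh (\<kappa> 0) D) K + int (ul_eps i (Up (\<kappa> 0) D)) = int (ul_eps i D) \<and> (D = [] \<longrightarrow> i \<noteq> \<kappa> 0)"
    obtain t C where IH: "C < K"
      "wh (tail \<kappa>) (ul_f i (Up (\<kappa> 0) D)) = inc_col (wh (tail \<kappa>) (Up (\<kappa> 0) D)) t C"
      "mlet i (\<kappa> (Suc t)) (wh (tail \<kappa>) (Up (\<kappa> 0) D) t) C = - 1"
      "mlv K i (tail \<kappa>) (wh (tail \<kappa>) (Up (\<kappa> 0) D)) t C = int (ul_eps i (Up (\<kappa> 0) D))"
      "\<And>s B. B \<le> K \<Longrightarrow> t < s \<or> t = s \<and> C < B \<Longrightarrow>
         mlv K i (tail \<kappa>) (wh (tail \<kappa>) (Up (\<kappa> 0) D)) s B < int (ul_eps i (Up (\<kappa> 0) D))"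
    proof -
      have "res (tail \<kappa>) (Up (\<kappa> 0) D) m = []" "\<kappa> (Suc m) = i" using Suc.prems(4,5) by simp_all
      from Suc.IH[OF U w Suc.prems(3) this] show thesis using that by blast
    qed
    have "wh \<kappa> (ul_f i D) = inc_col (wh \<kappa> D) (Suc t) C"
    proof
      fix s show "wh \<kappa> (ul_f i D) s = inc_col (wh \<kappa> D) (Suc t) C s"
        using up IH(2) by (cases s) (simp_all add: wh_0 wh_Suc inc_col_def)
    qed
    moreover have "mlet i (\<kappa> (Suc t)) (wh \<kappa> D (Suc t)) C = - 1" using IH(3) by (simp add: wh_Suc)
    moreover have "mlv K i \<kappa> (wh \<kappa> D) (Suc t) C = int (ul_eps i D)"
      using IH(4) up by (simp add: mlv_Suc wh_0 wh_Suc)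
    moreover have "mlv K i \<kappa> (wh \<kappa> D) s B < int (ul_eps i D)"
      if s: "B \<le> K" "Suc t < s \<or> Suc t = s \<and> C < B" for s B
    proof -
      obtain s' where s': "s = Suc s'" using s(2) by (cases s) auto
      then show ?thesis using IH(5)[of B s'] s up by (simp add: mlv_Suc wh_0 wh_Suc)
    qed
    ultimately show ?thesis using IH(1) by blast
  next
    assume "\<exists>C<K. Lh (\<kappa> 0) (ul_f i D) = (Lh (\<kappa> 0) D)(C := Suc (Lh (\<kappa> 0) D C)) \<and>
      Up (\<kappa> 0) (ul_f i D) = Up (\<kappa> 0) D \<and> mlet i (\<kappa> 0) (Lh (\<kappa> 0) D) C = - 1 \<and>
      mlv1 i (\<kappa> 0) (Lh (\<kappa> 0) D) C = int (ul_eps i D) \<and>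
      (\<forall>B>C. mlv1 i (\<kappa> 0) (Lh (\<kappa> 0) D) B < int (ul_eps i D)) \<and>
      mlv1 i (\<kappa> 0) (Lh (\<kappa> 0) D) K + int (ul_eps i (Up (\<kappa> 0) D)) < int (ul_eps i D)"
    then show ?thesis using location_lower[OF Suc.prems(1-3)] by blast
  qed
qed

lemma W_crystal:
  assumes D: "D \<in> UL" and \<kappa>: "multicharge \<kappa>"
  shows "W_map \<kappa> (ul_f i D) = mp_f \<kappa> i (W_map \<kappa> D)"
    and "mp_e \<kappa> i (W_map \<kappa> (ul_f i D)) = Some (W_map \<kappa> D)"
    and "card (free_removables \<kappa> i (W_map \<kappa> D)) = ul_eps i D"
    and "mp_cont \<kappa> (W_map \<kappa> (ul_f i D)) = mp_cont \<kappa> (W_map \<kappa> D) + simple_root i"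
proof -
  note D' = ul_f_UL[OF D, of i]
  obtain m where m: "res \<kappa> D m = []" "\<kappa> m = i" using res_eventually_Nil[OF D \<kappa>] .
  obtain m' where m': "res \<kappa> (ul_f i D) m' = []" using res_eventually_Nil[OF D' \<kappa>] by metis
  obtain K0 where K0: "heights (wh \<kappa> D) K0 m" using wh_heights[OF D m(1)] by blast
  obtain K1 where K1: "heights (wh \<kappa> (ul_f i D)) K1 m'" using wh_heights[OF D' m'] by blast
  define K where "K = max K0 K1"
  have h: "heights (wh \<kappa> D) K m" "heights (wh \<kappa> (ul_f i D)) K m'"
    using heights_mono[OF K0] heights_mono[OF K1] by (auto simp: K_def)
  interpret H: heights "wh \<kappa> D" K m \<kappa> i by (rule h(1))
  obtain t C where loc: "C < K" "wh \<kappa> (ul_f i D) = inc_col (wh \<kappa> D) t C" "mlet i (\<kappa> t) (wh \<kappa> D t) C = - 1"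
    "mlv K i \<kappa> (wh \<kappa> D) t C = int (ul_eps i D)"
    "\<And>s B. B \<le> K \<Longrightarrow> t < s \<or> t = s \<and> C < B \<Longrightarrow> mlv K i \<kappa> (wh \<kappa> D) s B < mlv K i \<kappa> (wh \<kappa> D) t C"
    using ul_f_location[OF D H.wide H.K_pos m] by auto
  have max: "mlv K i \<kappa> (wh \<kappa> D) s B \<le> mlv K i \<kappa> (wh \<kappa> D) t C" for s B
    using mlv_le_eps[OF D H.wide H.K_pos] loc(4) by simp
  show "W_map \<kappa> (ul_f i D) = mp_f \<kappa> i (W_map \<kappa> D)"
    unfolding W_map_mph loc(2) by (rule H.mp_f_mph[symmetric, OF loc(1,3) max loc(5)])
  show "mp_e \<kappa> i (W_map \<kappa> (ul_f i D)) = Some (W_map \<kappa> D)"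
    unfolding W_map_mph loc(2)
    by (rule H.mp_e_mph[OF loc(1,3) max loc(5)]) (use h(2) in \<open>simp_all add: loc(2)\<close>)
  obtain s B where "B \<le> K" "mlv K i \<kappa> (wh \<kappa> D) s B = int (card (free_removables \<kappa> i (W_map \<kappa> D)))"
    using H.eps_attained by (auto simp: W_map_mph)
  then show "card (free_removables \<kappa> i (W_map \<kappa> D)) = ul_eps i D"
    using max[of s B] loc(1,4) H.eps_ge[of C t] by (simp add: W_map_mph)
  show "mp_cont \<kappa> (W_map \<kappa> (ul_f i D)) = mp_cont \<kappa> (W_map \<kappa> D) + simple_root i"
    unfolding W_map_mph loc(2) by (rule H.mp_cont_inc[OF loc(3)])
qed

lemma W_Nil: "W_map \<kappa> [] = empty_mp"
  by (simp add: W_map_def empty_mp_def split_seq_Nil cells_def)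

lemma ul_e_inverse:
  assumes "D \<in> UL" "ul_e i D = Some D'"
  shows "D' \<in> UL" "ul_f i D' = D" "card (cells D') < card (cells D)"
proof -
  obtain c d t where D: "ul d t" "D = dg c d" using UL_dg[OF assms(1)] .
  obtain b d' t' where e: "ul d' t'" "D' = dg c d'" "d = d'(b := Suc (d' b))" "c + of_nat b = i"
    "ul_f i (dg c d') = dg c d"
    using ul_e_dg[OF D(1)] assms(2) D(2) by metis
  show "D' \<in> UL" using dg_UL[OF e(1)] e(2) by simp
  show "ul_f i D' = D" using e D by simp
  have "cells D = insert (int b, d' b, c + of_nat b) (cells D')"
    unfolding D(2) e(2) cells_dg[OF D(1)] cells_dg[OF e(1)] box_insert by (simp add: e(3)[symmetric])
  moreover have "(int b, d' b, c + of_nat b) \<notin> cells D'"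
    unfolding e(2) cells_dg[OF e(1)] by (simp add: box_mem)
  ultimately show "card (cells D') < card (cells D)" by (simp add: finite_cells)
qed

lemma UL_generated: "D \<in> UL \<Longrightarrow> \<exists>is. D = fold ul_f is []"
proof (induction "card (cells D)" arbitrary: D rule: less_induct)
  case less
  obtain c d t where D: "ul d t" "D = dg c d" using UL_dg[OF less.prems] .
  show ?case
  proof (cases "0 < d 0")
    case True
    obtain i where "ul_e i D \<noteq> None" using ul_e_exists[OF D(1) True] D(2) by metis
    then obtain D' where e: "ul_e i D = Some D'" by auto
    note inv = ul_e_inverse[OF less.prems e]
    then obtain "is" where "D' = fold ul_f is []" using less.hyps by blast
    then have "D = fold ul_f (is @ [i]) []" using inv(2) by simp
    then show ?thesis by blast
  next
    case False
    then have "D = fold ul_f [] []" using D dg_zero by simp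
    then show ?thesis by blast
  qed
qed

lemma fold_ul_f_UL: "D \<in> UL \<Longrightarrow> fold ul_f is D \<in> UL"
  by (induction "is" arbitrary: D) (simp_all add: ul_f_UL)

lemma fold_W:
  "D \<in> UL \<Longrightarrow> multicharge \<kappa> \<Longrightarrow> fold (mp_f \<kappa>) is (W_map \<kappa> D) = W_map \<kappa> (fold ul_f is D)"
  by (induction "is" arbitrary: D) (simp_all add: ul_f_UL W_crystal(1)[symmetric])

lemma MPK_image: "multicharge \<kappa> \<Longrightarrow> MPK \<kappa> = W_map \<kappa> ` UL"
proof (intro equalityI subsetI)
  fix \<mu> assume \<kappa>: "multicharge \<kappa>" and "\<mu> \<in> MPK \<kappa>"
  then obtain "is" where "\<mu> = fold (mp_f \<kappa>) is empty_mp" by (auto simp: MPK_def)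
  then have "\<mu> = W_map \<kappa> (fold ul_f is [])" using fold_W[OF Nil_UL \<kappa>] by (simp add: W_Nil)
  then show "\<mu> \<in> W_map \<kappa> ` UL" using fold_ul_f_UL[OF Nil_UL] by blast
next
  fix \<mu> assume \<kappa>: "multicharge \<kappa>" and "\<mu> \<in> W_map \<kappa> ` UL"
  then obtain D where D: "D \<in> UL" "\<mu> = W_map \<kappa> D" by auto
  then obtain "is" where "D = fold ul_f is []" using UL_generated by blast
  then have "\<mu> = fold (mp_f \<kappa>) is empty_mp" using D fold_W[OF Nil_UL \<kappa>, of "is"] by (simp add: W_Nil)
  then show "\<mu> \<in> MPK \<kappa>" by (auto simp: MPK_def)
qed

lemma W_cont: "D \<in> UL \<Longrightarrow> multicharge \<kappa> \<Longrightarrow> mp_cont \<kappa> (W_map \<kappa> D) = ul_cont D"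
proof -
  assume D: "D \<in> UL" and \<kappa>: "multicharge \<kappa>"
  have "mp_cont \<kappa> (W_map \<kappa> (fold ul_f is [])) = ul_cont (fold ul_f is [])" for "is"
  proof (induction "is" rule: rev_induct)
    case Nil
    have "nodes empty_mp = {}" by (auto simp: nodes_def empty_mp_def)
    then show ?case by (simp add: W_Nil mp_cont_def ul_cont_def cells_def)
  next
    case (snoc i "is")
    note U = fold_ul_f_UL[OF Nil_UL, of "is"]
    show ?case using snoc W_crystal(4)[OF U \<kappa>, of i] ul_cont_f[OF U, of i] by simp
  qed
  then show ?thesis using UL_generated[OF D] by metis
qed

section \<open>Gluing the components\<close>

lemma ledge_of_W: "D \<in> UL \<Longrightarrow> ledge_of \<kappa> (W_map \<kappa> D) t = split_seq \<kappa> D t"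
proof -
  assume D: "D \<in> UL"
  let ?E = "res \<kappa> D t"
  have "W_map \<kappa> D t = {(r, x). r < Lh (\<kappa> t) ?E x}"
    by (simp add: W_map_mph mph_def wh_def Lh_def split_seq_eq_fst)
  moreover have "(\<lambda>(r, c). (int r + int c, c, residue \<kappa> (t, r, c))) =
      (\<lambda>(r, x). (int r + int x, x, \<kappa> t + of_nat x + of_nat r))"
    by (simp add: residue_def fun_eq_iff)
  ultimately show ?thesis
    unfolding ledge_of_def using split_fst_cells[OF res_UL[OF D], of "\<kappa> t" \<kappa> t]
      split_fst_justify[OF res_UL[OF D], of "\<kappa> t" \<kappa> t]
    by (simp add: split_seq_eq_fst)
qed

lemma foldr_glue: "D \<in> UL \<Longrightarrow> foldr glue (map (split_seq \<kappa> D) [0..<n]) (res \<kappa> D n) = D"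
proof (induction n arbitrary: \<kappa> D)
  case (Suc n)
  have "map (split_seq \<kappa> D) [0..<Suc n] = fst (split (\<kappa> 0) D) # map (split_seq (tail \<kappa>) (Up (\<kappa> 0) D)) [0..<n]"
    by (simp add: map_upt_Suc Up_def del: upt_Suc)
  then show ?case using Suc.IH[OF Up_UL[OF Suc.prems], of "tail \<kappa>" "\<kappa> 0"] glue_split_UL[OF Suc.prems]
    by (simp del: upt_Suc)
qed simp

lemma Z_W:
  assumes D: "D \<in> UL" and \<kappa>: "multicharge \<kappa>"
  shows "Z_map \<kappa> (W_map \<kappa> D) = D"
proof -
  have l: "ledge_of \<kappa> (W_map \<kappa> D) = split_seq \<kappa> D" using ledge_of_W[OF D] by auto
  show ?thesis
  proof (cases "\<forall>t. split_seq \<kappa> D t = []")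
    case True
    have "Z_map \<kappa> (W_map \<kappa> D) = []" unfolding Z_map_def l glue_seq_def using True by simp
    then show ?thesis using split_seq_all_Nil[OF D \<kappa>] True by simp
  next
    case False
    define g where "g = (GREATEST t. split_seq \<kappa> D t \<noteq> [])"
    obtain m where m: "res \<kappa> D m = []" using res_eventually_Nil[OF D \<kappa>] by metis
    have bound: "t \<le> m" if "split_seq \<kappa> D t \<noteq> []" for t
    proof (rule ccontr)
      assume "\<not> t \<le> m"
      then obtain s where "t = m + s" by (metis le_Suc_ex nat_le_linear)
      then show False using that m by (simp add: split_seq_shift split_seq_Nil)
    qed
    have "split_seq \<kappa> D t = []" if "g < t" for t
    proof (rule ccontr)
      assume "split_seq \<kappa> D t \<noteq> []"
      then have "t \<le> g" unfolding g_def by (rule Greatest_le_nat) (use bound in blast)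
      then show False using that by simp
    qed
    then have "res \<kappa> D (Suc g) = []"
      using level_iff[OF D \<kappa>, of "Suc g"] split_seq_Nil_iff[OF D, of \<kappa>] by auto
    then have "foldr glue (map (split_seq \<kappa> D) [0..<Suc g]) [] = D" using foldr_glue[OF D, of \<kappa> "Suc g"] by simp
    then show ?thesis unfolding Z_map_def l glue_seq_def if_not_P[OF False] by (simp only: g_def)
  qed
qed

section \<open>The isomorphism\<close>

lemma crystal_iso_inverse:
  assumes iso: "crystal_iso h X Y"
    and g: "\<And>x. x \<in> cr_set X \<Longrightarrow> g (h x) = x" "\<And>y. y \<in> cr_set Y \<Longrightarrow> h (g y) = y"
    and closed: "\<And>x i z. x \<in> cr_set X \<Longrightarrow> cr_e X i x = Some z \<or> cr_f X i x = Some z \<Longrightarrow> z \<in> cr_set X"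
  shows "crystal_iso g Y X"
proof -
  have bij: "bij_betw h (cr_set X) (cr_set Y)" using iso by (simp add: crystal_iso_def)
  then have gX: "g y \<in> cr_set X" if "y \<in> cr_set Y" for y
    using that g(1) by (force simp: bij_betw_def)
  have "bij_betw g (cr_set Y) (cr_set X)"
    by (rule bij_betw_byWitness[of _ h]) (use g gX bij in \<open>auto simp: bij_betw_def\<close>)
  moreover have opt: "map_option g (map_option h z) = z" if "\<And>w. z = Some w \<Longrightarrow> w \<in> cr_set X" for z
    using that g(1) by (cases z) auto
  have "cr_e X i (g y) = map_option g (cr_e Y i y) \<and> cr_f X i (g y) = map_option g (cr_f Y i y)"
    if y: "y \<in> cr_set Y" for i y
  proof -
    have "cr_e Y i y = map_option h (cr_e X i (g y))" "cr_f Y i y = map_option h (cr_f X i (g y))"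
      using iso gX[OF y] g(2)[OF y] unfolding crystal_iso_def by metis+
    moreover have "map_option g (map_option h (cr_e X i (g y))) = cr_e X i (g y)"
      "map_option g (map_option h (cr_f X i (g y))) = cr_f X i (g y)"
      by (rule opt, use closed[OF gX[OF y]] in blast)+
    ultimately show ?thesis by simp
  qed
  moreover have "cr_wt X (g y) = cr_wt Y y \<and> cr_eps X i (g y) = cr_eps Y i y \<and> cr_phi X i (g y) = cr_phi Y i y"
    if y: "y \<in> cr_set Y" for i y
    using iso gX[OF y] g(2)[OF y] unfolding crystal_iso_def by metis
  ultimately show ?thesis unfolding crystal_iso_def by blast
qed

lemma zero_outside_Some: "zero_outside S x = Some y \<longleftrightarrow> x = Some y \<and> y \<in> S"
  by (cases x) (auto simp: zero_outside_def)

theorem corollaryH: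
  fixes t :: "bit \<Rightarrow> nat" and \<Lambda> :: weight and \<kappa> :: "nat \<Rightarrow> bit" and l :: nat
  assumes "\<Lambda> = dom_weight t"
    and "multicharge \<kappa>"
    and "l > 0"
    and "\<Lambda> = level_weight \<kappa> l"
  shows "crystal_iso (W_map \<kappa>) (UL_crystal t) (MPK_crystal \<kappa> l) \<and>
    crystal_iso (Z_map \<kappa>) (MPK_crystal \<kappa> l) (UL_crystal t) \<and>
    (\<forall>D \<in> UL_level t. Z_map \<kappa> (W_map \<kappa> D) = D) \<and>
    (\<forall>\<mu> \<in> MPK_level \<kappa> l. W_map \<kappa> (Z_map \<kappa> \<mu>) = \<mu>)"
proof -
  note \<kappa> = assms(2)
  have wt: "dom_weight t = level_weight \<kappa> l" using assms by simp
  have t: "t i = card {s. s < l \<and> \<kappa> s = i}" for i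
    using arg_cong[OF wt, of "\<lambda>w. pairing w i"] unfolding pairing_dom_weight pairing_level_weight by simp
  have ul: "D \<in> UL_level t \<longleftrightarrow> D \<in> UL \<and> res \<kappa> D l = []" for D
    using eps_star_res[of D l \<kappa>] by (auto simp: UL_level_def t)
  have lev: "D \<in> UL_level t \<longleftrightarrow> W_map \<kappa> D \<in> MPK_level \<kappa> l" if "D \<in> UL" for D
    using that MPK_image[OF \<kappa>] level_iff[OF that \<kappa>, of l] by (auto simp: ul MPK_level_def)
  have surj: "\<exists>D \<in> UL_level t. \<mu> = W_map \<kappa> D" if "\<mu> \<in> MPK_level \<kappa> l" for \<mu>
  proof -
    have "\<mu> \<in> W_map \<kappa> ` UL" using that MPK_image[OF \<kappa>] by (simp add: MPK_level_def)
    then show ?thesis using lev that by blast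
  qed
  have UL: "D \<in> UL" if "D \<in> UL_level t" for D using that by (simp add: ul)
  have ZW: "Z_map \<kappa> (W_map \<kappa> D) = D" if "D \<in> UL_level t" for D by (rule Z_W[OF UL[OF that] \<kappa>])
  have WZ: "W_map \<kappa> (Z_map \<kappa> \<mu>) = \<mu>" if "\<mu> \<in> MPK_level \<kappa> l" for \<mu>
    using surj[OF that] ZW by auto
  have ZU: "Z_map \<kappa> \<mu> \<in> UL_level t" if "\<mu> \<in> MPK_level \<kappa> l" for \<mu>
    using surj[OF that] ZW by auto
  have bij: "bij_betw (W_map \<kappa>) (UL_level t) (MPK_level \<kappa> l)"
    by (rule bij_betw_byWitness[of _ "Z_map \<kappa>"]) (use ZW WZ ZU lev[OF UL] in auto)
  have zo: "zero_outside (MPK_level \<kappa> l) (map_option (W_map \<kappa>) z) = map_option (W_map \<kappa>) (zero_outside (UL_level t) z)"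
    if "\<And>E. z = Some E \<Longrightarrow> E \<in> UL" for z
    using that lev by (cases z) (auto simp: zero_outside_def)
  have e: "mp_e \<kappa> i (W_map \<kappa> D) = map_option (W_map \<kappa>) (ul_e i D)" if D: "D \<in> UL" for i D
  proof (cases "ul_e i D")
    case None
    obtain c d s where "ul d s" "D = dg c d" using UL_dg[OF D] .
    then have "ul_eps i D = 0" using ul_e_None_iff None by metis
    then have "card (free_removables \<kappa> i (W_map \<kappa> D)) = 0" using W_crystal(3)[OF D \<kappa>] by simp
    moreover have "finite (free_removables \<kappa> i (W_map \<kappa> D))"
    proof -
      obtain m where "res \<kappa> D m = []" using res_eventually_Nil[OF D \<kappa>] by metis
      then obtain K where "heights (wh \<kappa> D) K m" using wh_heights[OF D] by blast
      then interpret heights "wh \<kappa> D" K m \<kappa> i .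
      show ?thesis using fin by (simp add: W_map_mph free_removables_def)
    qed
    ultimately show ?thesis using None by (simp add: mp_e_def)
  next
    case (Some D')
    show ?thesis using ul_e_inverse[OF D Some] W_crystal(2)[of D' \<kappa> i] \<kappa> Some by simp
  qed
  have phi: "int (card {u \<in> free_addables \<kappa> i (W_map \<kappa> D). fst u < l}) = ul_phi i D + int (t i)"
    if D: "D \<in> UL_level t" for i D
  proof -
    have D': "D \<in> UL" "res \<kappa> D l = []" using D by (simp_all add: ul)
    obtain K where "heights (wh \<kappa> D) K l" using wh_heights[OF D'] by blast
    then interpret heights "wh \<kappa> D" K l \<kappa> i .
    have "int (card {u \<in> free_addables \<kappa> i (W_map \<kappa> D). fst u < l}) =
      int (ul_eps i D) + pairing (level_weight \<kappa> l - ul_cont D) i"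
      using phi_weight W_crystal(3)[OF D'(1) \<kappa>, of i] W_cont[OF D'(1) \<kappa>] by (simp add: W_map_mph)
    then show ?thesis
      by (simp add: ul_phi_def pairing_diff pairing_uminus wt[symmetric] pairing_dom_weight)
  qed
  have iso: "crystal_iso (W_map \<kappa>) (UL_crystal t) (MPK_crystal \<kappa> l)"
    unfolding crystal_iso_def UL_crystal_def MPK_crystal_def crystal.simps
  proof (intro conjI ballI allI bij)
    fix D i assume D: "D \<in> UL_level t"
    note U = UL[OF D]
    show "level_weight \<kappa> l - mp_cont \<kappa> (W_map \<kappa> D) = dom_weight t - ul_cont D"
      by (simp add: wt W_cont[OF U \<kappa>])
    show "int (card (free_removables \<kappa> i (W_map \<kappa> D))) = int (ul_eps i D)"
      using W_crystal(3)[OF U \<kappa>] by simp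
    show "int (card {u \<in> free_addables \<kappa> i (W_map \<kappa> D). fst u < l}) = ul_phi i D + int (t i)"
      by (rule phi[OF D])
    show "zero_outside (MPK_level \<kappa> l) (mp_e \<kappa> i (W_map \<kappa> D)) =
        map_option (W_map \<kappa>) (zero_outside (UL_level t) (ul_e i D))"
      unfolding e[OF U] by (rule zo) (rule ul_e_inverse(1)[OF U])
    show "zero_outside (MPK_level \<kappa> l) (Some (mp_f \<kappa> i (W_map \<kappa> D))) =
        map_option (W_map \<kappa>) (zero_outside (UL_level t) (Some (ul_f i D)))"
      using zo[of "Some (ul_f i D)"] ul_f_UL[OF U] W_crystal(1)[OF U \<kappa>] by simp
  qed
  moreover have "crystal_iso (Z_map \<kappa>) (MPK_crystal \<kappa> l) (UL_crystal t)"
    by (rule crystal_iso_inverse[OF iso])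
       (use ZW WZ in \<open>auto simp: UL_crystal_def MPK_crystal_def zero_outside_Some\<close>)
  ultimately show ?thesis using ZW WZ by blast
qed

end
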